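(* Let $m\ge 6$. Every stratum $S\in\mathcal{S}_{3,m}$ satisfies $\rho(S)\in\{-1,0,+1\}$. More precisely: (a) If $n_h(S)=1$ for some $h\ge3$ and $n_i(S)=0$ for all $i\neq h$ (with $i\ge3$), then $\rho(S)=(-1)^{h-1}$. (b) In all other cases, $\rho(S)=0$.
   Context: $X(3,m)$ is the complex moduli space of $m$-tuples $[P]=[P_1,\dots,P_m]$ of points in $\mathbb{P}^2$, no three on a line, modulo the action of $\mathrm{GL}(3,\mathbb{C})$. For $[P]\in X(3,m)$, let $\mathcal{B}(P)$ be the arrangement of the $\binom m2$ lines $\overline{P_iP_j}$ in $\mathbb{P}^2$. The deletion map $\pi_{3,m}\colon X(3,m+1)\to X(3,m)$ forgets $P_{m+1}$; its fiber over $[P]$ is $\mathbb{P}^2\setminus\bigcup_{H\in\mathcal{B}(P)}H$. The discriminantal stratification $\mathcal{S}_{3,m}$ is the stratification of $X(3,m)$ according to the intersection lattice of the labeled arrangement $\mathcal{B}(P)$. Concretely, for pairwise disjoint pairs $ij,kl,rs$ of indices let $S_{(ij)(kl)(rs)}\subset X(3,m)$ be the closed locus where the lines $\overline{P_iP_j},\overline{P_kP_l},\overline{P_rP_s}$ are concurrent (necessarily at a new point, not one of $P_1,\dots,P_m$). For $[P]\in X(3,m)$ let $T(P)$ be the set of all triples $(ij)(kl)(rs)$ with $[P]\in S_{(ij)(kl)(rs)}$. For each set $T$ occurring as some $T(P)$, the closed stratum is $S=\bigcap_{\tau\in T}S_\tau$ (with $S=X(3,m)$ for $T=\emptyset$)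 and its open stratum is $S^\circ=\{[P]: T(P)=T\}=S\setminus\bigcup_{S'\subsetneq S}S'$. $\mathcal{S}_{3,m}$ is the finite poset of these closed strata ordered by inclusion, with Möbius function $\mu(S,S')$ for $S\subseteq S'$. Write $F_S$ for the fiber of $\pi_{3,m}$ over a point of $S^\circ$; its Euler characteristic $\chi(F_S)$ depends only on $S$. For $h\ge3$, $n_h(S)$ denotes the number of points of $\mathbb{P}^2$, other than $P_1,\dots,P_m$, where exactly $h$ lines of $\mathcal{B}(P)$ meet, for $[P]$ a general element of $S$ (i.e. $[P]\in S^\circ$). Finally, $$\rho(S)=\sum_{S'\in\mathcal{S}_{3,m},\,S'\supseteq S}\mu(S,S')\cdot\bigl(\chi(F_{X(3,m)})-\chi(F_{S'})\bigr).$$ *)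

theory Defs
  imports "HOL-Analysis.Analysis" "HOL-Homology.Homology"
begin

section \<open>The complex projective plane\<close>

typedef cp2 = "{L :: (complex^3) set. vec.subspace L \<and> vec.dim L = 1}"
  morphisms vectors Abs_cp2
proof -
  have "vec.dim (vec.span {axis 1 1 :: complex^3}) = 1"
    by (simp add: vec.dim_span_eq_card_independent axis_eq_0_iff)
  then show ?thesis
    using vec.subspace_span by blast
qed

definition cp2_of :: "complex^3 \<Rightarrow> cp2" where
  "cp2_of v = Abs_cp2 (vec.span {v})"

text \<open>The Euclidean topology of the projective plane is the quotient topology under
  \<open>v \<mapsto> [v]\<close>, \<open>v \<noteq> 0\<close>. As \<open>- {0}\<close> is open, a subset of \<open>- {0}\<close> is open in it iff it is open
  in the whole space.\<close>

instantiation cp2 :: topological_space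
begin

definition open_cp2 :: "cp2 set \<Rightarrow> bool" where
  "open_cp2 U \<longleftrightarrow> open {v. v \<noteq> 0 \<and> cp2_of v \<in> U}"

instance
proof
  show "open (UNIV :: cp2 set)"
    unfolding open_cp2_def by (auto simp: Collect_neg_eq[symmetric] intro!: open_Collect_neq continuous_intros)
next
  fix U V :: "cp2 set" assume "open U" "open V"
  moreover have "{v. v \<noteq> 0 \<and> cp2_of v \<in> U \<inter> V} =
      {v. v \<noteq> 0 \<and> cp2_of v \<in> U} \<inter> {v. v \<noteq> 0 \<and> cp2_of v \<in> V}" by auto
  ultimately show "open (U \<inter> V)"
    unfolding open_cp2_def by auto
next
  fix K :: "cp2 set set" assume "\<forall>U\<in>K. open U"
  moreover have "{v. v \<noteq> 0 \<and> cp2_of v \<in> \<Union>K} = (\<Union>U\<in>K. {v. v \<noteq> 0 \<and> cp2_of v \<in> U})" by auto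
  ultimately show "open (\<Union>K)"
    unfolding open_cp2_def by auto
qed

end

definition is_line :: "cp2 set \<Rightarrow> bool" where
  "is_line H \<longleftrightarrow> (\<exists>W. vec.subspace W \<and> vec.dim W = 2 \<and> H = {p. vectors p \<subseteq> W})"

text \<open>Only meaningful for invertible matrices.\<close>

definition gl_act :: "complex^3^3 \<Rightarrow> cp2 \<Rightarrow> cp2" where
  "gl_act A p = Abs_cp2 ((\<lambda>v. A *v v) ` vectors p)"


section \<open>The moduli space of point configurations\<close>

definition config :: "nat \<Rightarrow> (nat \<Rightarrow> cp2) set" where
  "config m = {P \<in> {1..m} \<rightarrow>\<^sub>E UNIV.
     \<forall>i\<in>{1..m}. \<forall>j\<in>{1..m}. \<forall>k\<in>{1..m}. i \<noteq> j \<and> i \<noteq> k \<and> j \<noteq> k \<longrightarrow>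
       \<not> (\<exists>H. is_line H \<and> {P i, P j, P k} \<subseteq> H)}"

definition gl_equiv :: "nat \<Rightarrow> ((nat \<Rightarrow> cp2) \<times> (nat \<Rightarrow> cp2)) set" where
  "gl_equiv m = {(P, Q). P \<in> config m \<and> Q \<in> config m \<and>
     (\<exists>A. invertible A \<and> (\<forall>i\<in>{1..m}. Q i = gl_act A (P i)))}"

definition X3 :: "nat \<Rightarrow> (nat \<Rightarrow> cp2) set set" where
  "X3 m = config m // gl_equiv m"

definition orbit3 :: "nat \<Rightarrow> (nat \<Rightarrow> cp2) \<Rightarrow> (nat \<Rightarrow> cp2) set" where
  "orbit3 m P = gl_equiv m `` {P}"


section \<open>The arrangement of the lines joining the points\<close>

definition index_pairs :: "nat \<Rightarrow> nat set set" where
  "index_pairs m = {e. e \<subseteq> {1..m} \<and> card e = 2}"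

definition join_line :: "(nat \<Rightarrow> cp2) \<Rightarrow> nat set \<Rightarrow> cp2 set" where
  "join_line P e = {q. vectors q \<subseteq> vec.span (\<Union>i\<in>e. vectors (P i))}"

definition arrangement :: "nat \<Rightarrow> (nat \<Rightarrow> cp2) \<Rightarrow> cp2 set set" where
  "arrangement m P = join_line P ` index_pairs m"

definition deletion :: "nat \<Rightarrow> (nat \<Rightarrow> cp2) set \<Rightarrow> (nat \<Rightarrow> cp2) set" where
  "deletion m x = (\<lambda>P. restrict P {1..m}) ` x"

text \<open>The fibre of the deletion map over the class of \<open>P\<close>, in its description as a line
  complement; see \<open>bij_betw_fibre\<close> below.\<close>

definition fibre :: "nat \<Rightarrow> (nat \<Rightarrow> cp2) \<Rightarrow> cp2 set" where
  "fibre m P = UNIV - \<Union>(arrangement m P)"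


section \<open>The discriminantal stratification\<close>

text \<open>The triple \<open>(ij)(kl)(rs)\<close> is the set \<open>{{i,j},{k,l},{r,s}}\<close>.\<close>

definition pair_triples :: "nat \<Rightarrow> nat set set set" where
  "pair_triples m = {\<tau>. \<tau> \<subseteq> index_pairs m \<and> card \<tau> = 3 \<and> disjoint \<tau>}"

text \<open>Two lines \<open>P\<^sub>iP\<^sub>j\<close>, \<open>P\<^sub>kP\<^sub>l\<close> with disjoint index pairs are distinct and meet outside
  \<open>P\<^sub>1, \<dots>, P\<^sub>m\<close>, so a common point of the three lines is automatically a new point.\<close>

definition concurrent_locus :: "nat \<Rightarrow> nat set set \<Rightarrow> (nat \<Rightarrow> cp2) set set" where
  "concurrent_locus m \<tau> = {x \<in> X3 m. \<exists>P\<in>x. (\<Inter>e\<in>\<tau>. join_line P e) \<noteq> {}}"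

definition concurrences :: "nat \<Rightarrow> (nat \<Rightarrow> cp2) set \<Rightarrow> nat set set set" where
  "concurrences m x = {\<tau> \<in> pair_triples m. x \<in> concurrent_locus m \<tau>}"

definition closed_stratum :: "nat \<Rightarrow> nat set set set \<Rightarrow> (nat \<Rightarrow> cp2) set set" where
  "closed_stratum m T = X3 m \<inter> (\<Inter>\<tau>\<in>T. concurrent_locus m \<tau>)"

definition strata :: "nat \<Rightarrow> (nat \<Rightarrow> cp2) set set set" where
  "strata m = closed_stratum m ` concurrences m ` X3 m"

definition open_stratum :: "nat \<Rightarrow> (nat \<Rightarrow> cp2) set set \<Rightarrow> (nat \<Rightarrow> cp2) set set" where
  "open_stratum m S = S - \<Union>{S' \<in> strata m. S' \<subset> S}"

text \<open>Euler characteristic of the fibre and the numbers \<open>n\<^sub>h\<close> are the same at all points of an open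
  stratum; they are read off at one chosen point.\<close>

definition general_config :: "nat \<Rightarrow> (nat \<Rightarrow> cp2) set set \<Rightarrow> (nat \<Rightarrow> cp2)" where
  "general_config m S = (SOME P. P \<in> config m \<and> orbit3 m P \<in> open_stratum m S)"

definition n_mult :: "nat \<Rightarrow> nat \<Rightarrow> (nat \<Rightarrow> cp2) set set \<Rightarrow> nat" where
  "n_mult m h S = (let P = general_config m S in
     card {q. q \<notin> P ` {1..m} \<and> card {H \<in> arrangement m P. q \<in> H} = h})"


section \<open>Euler characteristic, Moebius function and \<open>\<rho>\<close>\<close>

text \<open>The torsion-free rank of an abelian group (written multiplicatively). For infinite rank
  the value is unspecified.\<close>

definition int_independent :: "('a, 'b) monoid_scheme \<Rightarrow> 'a set \<Rightarrow> bool" where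
  "int_independent G B \<longleftrightarrow> finite B \<and> B \<subseteq> carrier G \<and>
     (\<forall>c :: 'a \<Rightarrow> int. finprod G (\<lambda>b. b [^]\<^bsub>G\<^esub> c b) B = \<one>\<^bsub>G\<^esub> \<longrightarrow> (\<forall>b\<in>B. c b = 0))"

definition group_rank :: "('a, 'b) monoid_scheme \<Rightarrow> nat" where
  "group_rank G = Sup {card B |B. int_independent G B}"

definition betti :: "nat \<Rightarrow> 'a topology \<Rightarrow> nat" where
  "betti p X = group_rank (homology_group (int p) X)"

text \<open>Meaningful for spaces with finitely generated total singular homology.\<close>

definition euler_char :: "'a topology \<Rightarrow> int" where
  "euler_char X = (\<Sum>p | betti p X \<noteq> 0. (- 1) ^ p * int (betti p X))"

definition chi_fibre :: "nat \<Rightarrow> (nat \<Rightarrow> cp2) set set \<Rightarrow> int" where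
  "chi_fibre m S = euler_char (top_of_set (fibre m (general_config m S)))"

text \<open>Moebius function of the finite poset \<open>L\<close>, for arguments in \<open>L\<close>; the finiteness guard is
  there for termination. It is used with sets ordered by inclusion.\<close>

function mobius :: "'a :: order set \<Rightarrow> 'a \<Rightarrow> 'a \<Rightarrow> int" where
  "mobius L x y =
     (if x = y then 1
      else if x < y \<and> finite L then - (\<Sum>z | z \<in> L \<and> x \<le> z \<and> z < y. mobius L x z)
      else 0)"
  by auto
termination
proof (relation "Wellfounded.measure (\<lambda>(L, x, y). card {z \<in> L. x \<le> z \<and> z < y})", goal_cases)
  case (2 L x y z)
  then have "{w \<in> L. x \<le> w \<and> w < z} \<subset> {w \<in> L. x \<le> w \<and> w < y}"
    by auto
  with 2 show ?case
    by (auto intro!: psubset_card_mono)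
qed auto

declare mobius.simps [simp del]

definition rho :: "nat \<Rightarrow> (nat \<Rightarrow> cp2) set set \<Rightarrow> int" where
  "rho m S = (\<Sum>S' | S' \<in> strata m \<and> S \<subseteq> S'.
     mobius (strata m) S S' * (chi_fibre m (X3 m) - chi_fibre m S'))"


section \<open>Consistency of the definitions\<close>

text \<open>Concurrence does not depend on the representative of a class
  (\<open>concurrent_locus_orbit3\<close>), the open stratum is the locus with a prescribed set of
  concurrences (\<open>open_stratum_eq\<close>), the poset of strata is finite (\<open>finite_strata\<close>), and
  \<open>fibre m P\<close> is identified with the fibre of the deletion map (\<open>bij_betw_fibre\<close>).\<close>

lemma linear_mult_vec: "Vector_Spaces.linear (*s) (*s) ((*v) (A :: complex^3^3))"
  by (rule matrix_vector_mul_linear_gen)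

lemma subspace_vectors: "vec.subspace (vectors p)" and dim_vectors: "vec.dim (vectors p) = 1"
  using vectors[of p] by auto

lemma inj_mult_vec:
  assumes "invertible (A :: complex^3^3)" shows "inj ((*v) A)"
  using assms inj_matrix_vector_mult by blast

lemma vectors_gl_act:
  assumes "invertible A" shows "vectors (gl_act A p) = (\<lambda>v. A *v v) ` vectors p"
proof -
  have "vec.subspace ((\<lambda>v. A *v v) ` vectors p)"
    using linear_mult_vec vec.linear_subspace_image subspace_vectors by blast
  moreover have "vec.dim ((\<lambda>v. A *v v) ` vectors p) = 1"
    using vec.dim_image_eq[OF linear_mult_vec, of A "vectors p"] inj_mult_vec[OF assms]
      dim_vectors[of p] by (simp add: inj_on_subset)
  ultimately show ?thesis
    by (simp add: gl_act_def Abs_cp2_inverse)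
qed

lemma gl_act_one: "gl_act (mat 1) p = p"
  by (simp add: gl_act_def vectors_inverse)

lemma gl_act_mult:
  assumes "invertible A" "invertible B" shows "gl_act A (gl_act B p) = gl_act (A ** B) p"
  using assms by (simp add: vectors_inject[symmetric] vectors_gl_act invertible_mult image_image
      matrix_vector_mul_assoc)

lemma gl_act_inverse:
  assumes "invertible A" obtains B where "invertible B" "\<And>p. gl_act B (gl_act A p) = p"
proof -
  obtain B where B: "A ** B = mat 1" "B ** A = mat 1" using assms by (auto simp: invertible_def)
  then have "invertible B" by (auto simp: invertible_def)
  with that B assms show thesis by (simp add: gl_act_mult gl_act_one)
qed

lemma equiv_gl_equiv: "equiv (config m) (gl_equiv m)"
proof (rule equivI)
  show "gl_equiv m \<subseteq> config m \<times> config m" by (auto simp: gl_equiv_def)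
  have "invertible (mat 1 :: complex^3^3)"
    unfolding invertible_def by (rule exI[of _ "mat 1"]) simp
  then show "refl_on (config m) (gl_equiv m)"
    by (auto simp: refl_on_def gl_equiv_def gl_act_one intro!: exI[of _ "mat 1"])
  show "sym (gl_equiv m)"
    by (auto simp: sym_def gl_equiv_def) (metis gl_act_inverse)
  show "trans (gl_equiv m)"
    unfolding trans_def gl_equiv_def
    by clarsimp (metis gl_act_mult invertible_mult)
qed

lemma join_line_gl_act:
  assumes A: "invertible A" and eq: "\<And>i. i \<in> e \<Longrightarrow> Q i = gl_act A (P i)"
  shows "gl_act A q \<in> join_line Q e \<longleftrightarrow> q \<in> join_line P e"
proof -
  have "(\<Union>i\<in>e. vectors (Q i)) = (\<lambda>v. A *v v) ` (\<Union>i\<in>e. vectors (P i))"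
    using eq by (auto simp: vectors_gl_act[OF A] image_iff)
  then have "vec.span (\<Union>i\<in>e. vectors (Q i)) = (\<lambda>v. A *v v) ` vec.span (\<Union>i\<in>e. vectors (P i))"
    using vec.linear_span_image[OF linear_mult_vec] by metis
  then show ?thesis
    by (simp add: join_line_def vectors_gl_act[OF A] inj_image_subset_iff[OF inj_mult_vec[OF A]])
qed

lemma concurrent_locus_orbit3:
  assumes P: "P \<in> config m" and \<tau>: "\<tau> \<in> pair_triples m"
  shows "orbit3 m P \<in> concurrent_locus m \<tau> \<longleftrightarrow> (\<Inter>e\<in>\<tau>. join_line P e) \<noteq> {}"
proof -
  have self: "P \<in> orbit3 m P"
    using P equiv_class_self[OF equiv_gl_equiv] by (simp add: orbit3_def)
  have X: "orbit3 m P \<in> X3 m"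
    using P by (auto simp: orbit3_def X3_def quotientI)
  have "(\<Inter>e\<in>\<tau>. join_line P e) \<noteq> {}"
    if PQ: "(P, Q) \<in> gl_equiv m" and ne: "(\<Inter>e\<in>\<tau>. join_line Q e) \<noteq> {}" for Q
  proof -
    have "(Q, P) \<in> gl_equiv m"
      using PQ equivE[OF equiv_gl_equiv[of m]] symD by metis
    then obtain A where A: "invertible A" "\<forall>i\<in>{1..m}. P i = gl_act A (Q i)"
      by (auto simp: gl_equiv_def)
    obtain q where q: "\<And>e. e \<in> \<tau> \<Longrightarrow> q \<in> join_line Q e" using ne by auto
    have "gl_act A q \<in> join_line P e" if "e \<in> \<tau>" for e
    proof -
      have "e \<subseteq> {1..m}" using that \<tau> by (auto simp: pair_triples_def index_pairs_def)
      then show ?thesis using join_line_gl_act[OF A(1), of e P Q q] A(2) q[OF that] by blast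
    qed
    then show ?thesis by auto
  qed
  with self X show ?thesis unfolding concurrent_locus_def by (auto simp: orbit3_def)
qed

lemma finite_pair_triples: "finite (pair_triples m)"
proof -
  have "pair_triples m \<subseteq> Pow (Pow {1..m})"
    by (auto simp: pair_triples_def index_pairs_def)
  then show ?thesis using finite_subset by blast
qed

lemma finite_strata: "finite (strata m)"
proof -
  have "strata m \<subseteq> closed_stratum m ` Pow (pair_triples m)"
    by (auto simp: strata_def concurrences_def)
  then show ?thesis using finite_pair_triples finite_subset by blast
qed

lemma open_stratum_eq:
  assumes "x \<in> X3 m"
  shows "open_stratum m (closed_stratum m (concurrences m x)) =
    {y \<in> X3 m. concurrences m y = concurrences m x}"
proof -
  have mem: "y \<in> closed_stratum m (concurrences m z) \<longleftrightarrow>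
      y \<in> X3 m \<and> concurrences m z \<subseteq> concurrences m y" for y z
    by (auto simp: closed_stratum_def concurrences_def)
  have le: "closed_stratum m (concurrences m y) \<subseteq> closed_stratum m (concurrences m z) \<longleftrightarrow>
      concurrences m z \<subseteq> concurrences m y" if "y \<in> X3 m" for y z
  proof
    assume "closed_stratum m (concurrences m y) \<subseteq> closed_stratum m (concurrences m z)"
    moreover have "y \<in> closed_stratum m (concurrences m y)" using mem[of y y] that by simp
    ultimately show "concurrences m z \<subseteq> concurrences m y" using mem[of y z] by blast
  next
    assume "concurrences m z \<subseteq> concurrences m y"
    then show "closed_stratum m (concurrences m y) \<subseteq> closed_stratum m (concurrences m z)"
      by (auto simp: closed_stratum_def)
  qed
  have sub: "closed_stratum m (concurrences m y) \<subset> closed_stratum m (concurrences m x) \<longleftrightarrow>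
      concurrences m x \<subset> concurrences m y" if "y \<in> X3 m" for y
    using le[OF that, of x] le[OF assms, of y] by blast
  show ?thesis
  proof (intro Set.set_eqI iffI)
    fix y assume y: "y \<in> open_stratum m (closed_stratum m (concurrences m x))"
    then have "y \<in> X3 m" "concurrences m x \<subseteq> concurrences m y"
      by (auto simp: open_stratum_def mem)
    moreover have "\<not> concurrences m x \<subset> concurrences m y"
    proof
      assume "concurrences m x \<subset> concurrences m y"
      then have "closed_stratum m (concurrences m y) \<subset> closed_stratum m (concurrences m x)"
        using sub \<open>y \<in> X3 m\<close> by blast
      moreover have "y \<in> closed_stratum m (concurrences m y)" using mem \<open>y \<in> X3 m\<close> by blast
      ultimately show False using y \<open>y \<in> X3 m\<close> by (auto simp: open_stratum_def strata_def)
    qed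
    ultimately show "y \<in> {y \<in> X3 m. concurrences m y = concurrences m x}" by blast
  next
    fix y assume y: "y \<in> {y \<in> X3 m. concurrences m y = concurrences m x}"
    have "y \<notin> closed_stratum m (concurrences m z)"
      if "z \<in> X3 m" "closed_stratum m (concurrences m z) \<subset> closed_stratum m (concurrences m x)" for z
      using sub[OF that(1)] that(2) y mem by auto
    then show "y \<in> open_stratum m (closed_stratum m (concurrences m x))"
      using y mem by (auto simp: open_stratum_def strata_def)
  qed
qed

definition vec_of :: "cp2 \<Rightarrow> complex^3" where
  "vec_of p = (SOME v. v \<noteq> 0 \<and> vectors p = vec.span {v})"

lemma vec_of: "vec_of p \<noteq> 0" "vectors p = vec.span {vec_of p}"
proof -
  obtain B where B: "B \<subseteq> vectors p" "vec.independent B" "vectors p \<subseteq> vec.span B" "card B = 1"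
    using vec.basis_exists[of "vectors p"] dim_vectors[of p] by metis
  then obtain v where v: "B = {v}" by (auto simp: card_1_singleton_iff)
  have "v \<noteq> 0" "vectors p = vec.span {v}"
    using B v subspace_vectors[of p] by (auto simp: vec.span_minimal subset_antisym vec.dependent_zero)
  then have "vec_of p \<noteq> 0 \<and> vectors p = vec.span {vec_of p}"
    unfolding vec_of_def by (intro someI[of "\<lambda>v. v \<noteq> 0 \<and> vectors p = vec.span {v}"]) auto
  then show "vec_of p \<noteq> 0" "vectors p = vec.span {vec_of p}" by auto
qed

lemma vectors_subset_iff:
  assumes "vec.subspace W" shows "vectors p \<subseteq> W \<longleftrightarrow> vec_of p \<in> W"
proof
  have "vec_of p \<in> vectors p" unfolding vec_of(2)[of p] by (simp add: vec.span_base)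
  then show "vec_of p \<in> W" if "vectors p \<subseteq> W" using that by blast
  show "vectors p \<subseteq> W" if "vec_of p \<in> W"
    unfolding vec_of(2)[of p] using assms that by (simp add: vec.span_minimal)
qed

lemma join_line_eq: "join_line P e = {q. vec_of q \<in> vec.span ((\<lambda>i. vec_of (P i)) ` e)}"
proof -
  have "vec.span (\<Union>i\<in>e. vectors (P i)) = vec.span ((\<lambda>i. vec_of (P i)) ` e)"
  proof
    show "vec.span (\<Union>i\<in>e. vectors (P i)) \<subseteq> vec.span ((\<lambda>i. vec_of (P i)) ` e)"
      by (intro vec.span_minimal UN_least)
        (simp_all add: vectors_subset_iff vec.subspace_span vec.span_base)
    show "vec.span ((\<lambda>i. vec_of (P i)) ` e) \<subseteq> vec.span (\<Union>i\<in>e. vectors (P i))"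
      by (intro vec.span_mono) (use vec_of(2) vec.span_base in blast)
  qed
  then show ?thesis by (simp add: join_line_def vectors_subset_iff vec.subspace_span)
qed

lemma dim_UNIV_3: "vec.dim (UNIV :: (complex^3) set) = 3"
  by (simp only: vec_dim_card) simp

lemma in_plane:
  assumes "vec.dim (V :: (complex^3) set) \<le> 2"
  obtains W where "vec.subspace W" "vec.dim W = 2" "V \<subseteq> W"
proof -
  obtain B where B: "B \<subseteq> V" "vec.independent B" "V \<subseteq> vec.span B" "card B = vec.dim V"
    using vec.basis_exists by metis
  obtain C where C: "B \<subseteq> C" "vec.independent C" "UNIV \<subseteq> vec.span C"
    using vec.maximal_independent_subset_extend[OF subset_UNIV B(2)] by metis
  have "card C = 3"
    using C(3) vec.dim_span_eq_card_independent[OF C(2)] dim_UNIV_3 by (simp add: top.extremum_unique)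
  then obtain D where D: "B \<subseteq> D" "D \<subseteq> C" "card D = 2"
  proof -
    have "finite C" using \<open>card C = 3\<close> by (metis card.infinite zero_neq_numeral)
    then show thesis using that exists_subset_between[of B 2 C] assms B C \<open>card C = 3\<close> by auto
  qed
  have "vec.dim (vec.span D) = 2"
    using D C vec.independent_mono vec.dim_span_eq_card_independent by metis
  moreover have "V \<subseteq> vec.span D" using B D vec.span_mono by blast
  ultimately show thesis using that vec.subspace_span by blast
qed

lemma not_collinear_iff:
  "(\<nexists>H. is_line H \<and> {p, q, r} \<subseteq> H) \<longleftrightarrow> vec.span {vec_of p, vec_of q, vec_of r} = UNIV"
proof -
  have "(\<exists>H. is_line H \<and> {p, q, r} \<subseteq> H) \<longleftrightarrow>
      (\<exists>W. vec.subspace W \<and> vec.dim W = 2 \<and> {vec_of p, vec_of q, vec_of r} \<subseteq> W)"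
  proof
    assume "\<exists>H. is_line H \<and> {p, q, r} \<subseteq> H"
    then show "\<exists>W. vec.subspace W \<and> vec.dim W = 2 \<and> {vec_of p, vec_of q, vec_of r} \<subseteq> W"
      by (auto simp: is_line_def vectors_subset_iff)
  next
    assume "\<exists>W. vec.subspace W \<and> vec.dim W = 2 \<and> {vec_of p, vec_of q, vec_of r} \<subseteq> W"
    then obtain W where "vec.subspace W" "vec.dim W = 2" "{vec_of p, vec_of q, vec_of r} \<subseteq> W"
      by blast
    then have "is_line {p. vectors p \<subseteq> W}" "{p, q, r} \<subseteq> {p. vectors p \<subseteq> W}"
      by (unfold is_line_def, blast) (simp add: vectors_subset_iff)
    then show "\<exists>H. is_line H \<and> {p, q, r} \<subseteq> H" by blast
  qed
  also have "\<dots> \<longleftrightarrow> vec.dim {vec_of p, vec_of q, vec_of r} \<le> 2"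
    by (metis in_plane vec.dim_subset)
  also have "\<dots> \<longleftrightarrow> vec.dim {vec_of p, vec_of q, vec_of r} \<noteq> 3"
  proof -
    have "vec.dim {vec_of p, vec_of q, vec_of r} \<le> card {vec_of p, vec_of q, vec_of r}"
      by (intro vec.dim_le_card) (auto intro: vec.span_base)
    also have "\<dots> \<le> 3" by (simp add: card_insert_if)
    finally show ?thesis by linarith
  qed
  also have "\<dots> \<longleftrightarrow> vec.span {vec_of p, vec_of q, vec_of r} \<noteq> UNIV"
  proof
    assume "vec.dim {vec_of p, vec_of q, vec_of r} \<noteq> 3"
    then show "vec.span {vec_of p, vec_of q, vec_of r} \<noteq> UNIV"
      using dim_UNIV_3 vec.dim_span by metis
  next
    assume "vec.span {vec_of p, vec_of q, vec_of r} \<noteq> UNIV"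
    then show "vec.dim {vec_of p, vec_of q, vec_of r} \<noteq> 3"
      using dim_UNIV_3 vec.dim_eq_full vec.dim_UNIV vec.dimension_def by metis
  qed
  finally show ?thesis by blast
qed

lemma config_iff: "P \<in> config m \<longleftrightarrow> P \<in> {1..m} \<rightarrow>\<^sub>E UNIV \<and>
   (\<forall>i\<in>{1..m}. \<forall>j\<in>{1..m}. \<forall>k\<in>{1..m}. i \<noteq> j \<and> i \<noteq> k \<and> j \<noteq> k \<longrightarrow>
     vec.span {vec_of (P i), vec_of (P j), vec_of (P k)} = UNIV)"
  unfolding config_def not_collinear_iff by blast

lemma config_span:
  assumes "P \<in> config m" "i \<in> {1..m}" "j \<in> {1..m}" "k \<in> {1..m}" "i \<noteq> j" "i \<noteq> k" "j \<noteq> k"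
  shows "vec.span {vec_of (P i), vec_of (P j), vec_of (P k)} = UNIV"
  using assms by (simp add: config_iff)

lemma span3_iff:
  assumes ind: "vec.span {u, v, w} = UNIV"
  shows "vec.span {u, v, x} = UNIV \<longleftrightarrow> x \<notin> vec.span {u, v :: complex^3}"
proof
  have "vec.dim {u, v} < 3"
  proof -
    have "vec.dim {u, v} \<le> card {u, v}"
      by (intro vec.dim_le_card) (auto intro: vec.span_base)
    also have "\<dots> \<le> 2" by (simp add: card_insert_if)
    finally show ?thesis by linarith
  qed
  then have ne: "vec.span {u, v} \<noteq> UNIV"
    using dim_UNIV_3 by (metis less_irrefl vec.dim_span)
  have swap: "{u, v, y} = insert y {u, v}" for y by auto
  show "x \<notin> vec.span {u, v}" if "vec.span {u, v, x} = UNIV"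
    using ne that vec.span_redundant[of x "{u, v}"] swap by metis
  show "vec.span {u, v, x} = UNIV" if x: "x \<notin> vec.span {u, v}"
  proof -
    have "x \<in> vec.span (insert w {u, v})" using ind swap by auto
    then have "w \<in> vec.span (insert x {u, v})" using x vec.in_span_insert by blast
    then have "{u, v, w} \<subseteq> vec.span {u, v, x}" by (auto simp: swap[of x] intro: vec.span_base)
    then show ?thesis using ind vec.span_minimal[OF _ vec.subspace_span]
      by (metis top.extremum_uniqueI)
  qed
qed

lemma fun_upd_config:
  assumes P: "P \<in> config m" and m: "m \<ge> 3"
  shows "P(Suc m := q) \<in> config (Suc m) \<longleftrightarrow> q \<in> fibre m P"
proof -
  have iff: "vec.span {vec_of (P i), vec_of (P j), vec_of q} = UNIV \<longleftrightarrow> q \<notin> join_line P {i, j}"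
    if ij: "i \<in> {1..m}" "j \<in> {1..m}" "i \<noteq> j" for i j
  proof -
    have "card {i, j} \<le> 2" by (simp add: card_insert_if)
    then have "\<not> {1..m} \<subseteq> {i, j}" using m card_mono[of "{i, j}" "{1..m}"] by auto
    then obtain k where k: "k \<in> {1..m}" "k \<noteq> i" "k \<noteq> j" by blast
    have "vec.span {vec_of (P i), vec_of (P j), vec_of (P k)} = UNIV"
      using config_span[OF P] ij k by simp
    from span3_iff[OF this] show ?thesis by (simp add: join_line_eq)
  qed
  have fib: "q \<in> fibre m P \<longleftrightarrow> (\<forall>i\<in>{1..m}. \<forall>j\<in>{1..m}. i \<noteq> j \<longrightarrow> q \<notin> join_line P {i, j})"
  proof -
    have "q \<in> fibre m P \<longleftrightarrow> (\<forall>e\<in>index_pairs m. q \<notin> join_line P e)"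
      by (simp add: fibre_def arrangement_def)
    also have "index_pairs m = {{i, j} |i j. i \<in> {1..m} \<and> j \<in> {1..m} \<and> i \<noteq> j}"
      unfolding index_pairs_def card_2_iff by blast
    finally show ?thesis by blast
  qed
  have perm: "{a, b, c} = {b, c, a}" "{a, b, c} = {a, c, b}" for a b c :: "complex^3" by auto
  show ?thesis
  proof
    assume "P(Suc m := q) \<in> config (Suc m)"
    then have "vec.span {vec_of (P i), vec_of (P j), vec_of q} = UNIV"
      if "i \<in> {1..m}" "j \<in> {1..m}" "i \<noteq> j" for i j
      using that config_span[OF \<open>P(Suc m := q) \<in> config (Suc m)\<close>, of i j "Suc m"] by auto
    then show "q \<in> fibre m P" using iff fib by blast
  next
    assume "q \<in> fibre m P"
    then have q: "vec.span {vec_of (P i), vec_of (P j), vec_of q} = UNIV"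
      if "i \<in> {1..m}" "j \<in> {1..m}" "i \<noteq> j" for i j
      using that iff fib by blast
    have "P(Suc m := q) \<in> {1..Suc m} \<rightarrow>\<^sub>E UNIV"
      using P by (auto simp: config_def PiE_def extensional_def)
    moreover have "vec.span {vec_of ((P(Suc m := q)) i), vec_of ((P(Suc m := q)) j), vec_of ((P(Suc m := q)) k)} = UNIV"
      if ijk: "i \<in> {1..Suc m}" "j \<in> {1..Suc m}" "k \<in> {1..Suc m}" "i \<noteq> j" "i \<noteq> k" "j \<noteq> k" for i j k
    proof -
      consider "k = Suc m" "i \<in> {1..m}" "j \<in> {1..m}" | "j = Suc m" "i \<in> {1..m}" "k \<in> {1..m}"
        | "i = Suc m" "j \<in> {1..m}" "k \<in> {1..m}" | "i \<in> {1..m}" "j \<in> {1..m}" "k \<in> {1..m}"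
        using ijk by (auto simp: le_Suc_eq)
      then show ?thesis
      proof cases
        case 1 then show ?thesis using q ijk by auto
      next
        case 2 then show ?thesis using q[of i k] ijk perm(2)[of "vec_of (P i)" "vec_of q"] by auto
      next
        case 3 then show ?thesis using q[of j k] ijk perm(1)[of "vec_of q" "vec_of (P j)"] by auto
      next
        case 4
        have "i \<noteq> Suc m" "j \<noteq> Suc m" "k \<noteq> Suc m" using 4 by auto
        then show ?thesis using config_span[OF P 4] ijk by simp
      qed
    qed
    ultimately show "P(Suc m := q) \<in> config (Suc m)" by (simp add: config_iff)
  qed
qed

lemma gl_act_fixes_frame:
  assumes P: "P \<in> config m" and m: "m \<ge> 4" and A: "invertible A"
    and fixed: "\<And>i. i \<in> {1..m} \<Longrightarrow> gl_act A (P i) = P i"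
  shows "gl_act A q = q"
proof -
  define u where "u i = vec_of (P i)" for i
  have "\<exists>c. A *v u i = c *s u i" if "i \<in> {1..m}" for i
  proof -
    have "A *v u i \<in> vectors (P i)"
      using fixed[OF that] vectors_gl_act[OF A, of "P i"] vec_of(2)[of "P i"]
      by (metis image_eqI u_def insertI1 vec.span_base)
    then show ?thesis using vec_of(2)[of "P i"] by (auto simp: u_def vec.span_singleton)
  qed
  then obtain c where c: "\<And>i. i \<in> {1..m} \<Longrightarrow> A *v u i = c i *s u i" by metis
  have mem: "1 \<in> {1..m}" "2 \<in> {1..m}" "3 \<in> {1..m}" "4 \<in> {1..m}" using m by auto
  have sp: "vec.span {u i, u j, u k} = UNIV"
    if "i \<in> {1..m}" "j \<in> {1..m}" "k \<in> {1..m}" "i \<noteq> j" "i \<noteq> k" "j \<noteq> k" for i j k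
    using config_span[OF P] that by (simp add: u_def)
  have eig: "c i = c 4" if ijk: "{i, j, k} = {1, 2, 3 :: nat}" "i \<noteq> j" "i \<noteq> k" "j \<noteq> k" for i j k
  proof -
    have i: "i \<in> {1..m}" and j: "j \<in> {1..m}" and k: "k \<in> {1..m}"
      and n4: "i \<noteq> 4" "j \<noteq> 4" "k \<noteq> 4"
      using mem ijk(1)[symmetric]
    proof -
      have sub: "x \<in> {1..m} \<and> x \<noteq> 4" if "x \<in> {1, 2, 3}" for x :: nat using that m by auto
      show "i \<in> {1..m}" "j \<in> {1..m}" "k \<in> {1..m}" "i \<noteq> 4" "j \<noteq> 4" "k \<noteq> 4"
        using sub[of i] sub[of j] sub[of k] ijk(1) by blast+
    qed
    have n_i: "u i \<notin> vec.span {u j, u k}"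
      using span3_iff[OF sp[OF j k mem(4)]] sp[OF j k i] ijk n4 by metis
    have n_4: "u 4 \<notin> vec.span {u j, u k}"
      using span3_iff[OF sp[OF j k i]] sp[OF j k mem(4)] ijk n4 by metis
    have "u 4 \<in> vec.span (insert (u i) {u j, u k})" using sp[OF i j k] ijk by auto
    then obtain a where a: "u 4 - a *s u i \<in> vec.span {u j, u k}"
      by (auto simp: vec.span_breakdown_eq)
    have "a \<noteq> 0" using a n_4 by auto
    have stable: "A *v w \<in> vec.span {u j, u k}" if "w \<in> vec.span {u j, u k}" for w
    proof -
      have "A *v w \<in> vec.span ((*v) A ` {u j, u k})"
        using vec.linear_span_image[OF linear_mult_vec, of A "{u j, u k}"] that by blast
      moreover have "vec.span ((*v) A ` {u j, u k}) \<subseteq> vec.span {u j, u k}"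
        using c[OF j] c[OF k]
        by (intro vec.span_minimal) (auto simp: vec.subspace_span intro!: vec.span_scale intro: vec.span_base)
      ultimately show ?thesis by blast
    qed
    have "A *v (u 4 - a *s u i) = c 4 *s u 4 - (a * c i) *s u i"
      using c[OF mem(4)] c[OF i]
      by (simp add: matrix_vector_mult_diff_distrib vector_scalar_commute)
    then have "c 4 *s u 4 - (a * c i) *s u i - c 4 *s (u 4 - a *s u i) \<in> vec.span {u j, u k}"
      using vec.span_diff[OF stable[OF a] vec.span_scale[OF a, of "c 4"]] by simp
    also have "c 4 *s u 4 - (a * c i) *s u i - c 4 *s (u 4 - a *s u i) = (a * (c 4 - c i)) *s u i"
      by (simp add: vec_eq_iff algebra_simps)
    finally have *: "(a * (c 4 - c i)) *s u i \<in> vec.span {u j, u k}" .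
    have "a * (c 4 - c i) = 0"
    proof (rule ccontr)
      assume nz: "a * (c 4 - c i) \<noteq> 0"
      have "inverse (a * (c 4 - c i)) *s ((a * (c 4 - c i)) *s u i) \<in> vec.span {u j, u k}"
        using * by (rule vec.span_scale)
      then have "(inverse (a * (c 4 - c i)) * (a * (c 4 - c i))) *s u i \<in> vec.span {u j, u k}"
        by (simp only: vec.scale_scale)
      then show False using n_i left_inverse[OF nz] by simp
    qed
    then show "c i = c 4" using \<open>a \<noteq> 0\<close> by simp
  qed
  have cs: "c 1 = c 4" "c 2 = c 4" "c 3 = c 4"
    by (rule eig[of 1 2 3] eig[of 2 1 3] eig[of 3 1 2]; auto)+
  have scal: "A *v x = c 4 *s x" for x
  proof -
    have "x \<in> vec.span {u 1, u 2, u 3}" using sp[OF mem(1,2,3)] by simp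
    then show ?thesis
    proof (induction rule: vec.span_induct)
      case base
      then show ?case
        by (auto simp: vec.subspace_def matrix_vector_right_distrib vector_scalar_commute 
            vector_sadd_rdistrib vec.scale_right_distrib mult.commute)
    next
      case (step x)
      then show ?case using c mem cs by auto
    qed
  qed
  have "vectors (gl_act A q) \<subseteq> vectors q"
    using subspace_vectors[of q] by (auto simp: vectors_gl_act[OF A] scal vec.subspace_def)
  then have "vectors (gl_act A q) = vectors q"
    by (intro vec.subspace_dim_equal) (simp_all add: subspace_vectors dim_vectors)
  then show ?thesis by (simp add: vectors_inject)
qed

lemma gl_act_config:
  assumes P: "P \<in> config m" and A: "invertible A"
  shows "(\<lambda>i\<in>{1..m}. gl_act A (P i)) \<in> config m"
proof -
  have im: "vec.span {vec_of (gl_act A p), vec_of (gl_act A q), vec_of (gl_act A r)} = UNIV"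
    if s: "vec.span {vec_of p, vec_of q, vec_of r} = UNIV" for p q r
  proof -
    let ?V = "vec.span {vec_of (gl_act A p), vec_of (gl_act A q), vec_of (gl_act A r)}"
    have "A *v vec_of x \<in> ?V" if "x \<in> {p, q, r}" for x
    proof -
      have "vectors (gl_act A x) \<subseteq> ?V"
        using that by (auto simp: vectors_subset_iff vec.subspace_span vec.span_base
            simp del: subset_iff)
      moreover have "vec_of x \<in> vectors x" using vec_of(2)[of x] by (metis insertI1 vec.span_base)
      ultimately show ?thesis using vectors_gl_act[OF A, of x] by auto
    qed
    then have "(*v) A ` {vec_of p, vec_of q, vec_of r} \<subseteq> ?V" by auto
    then have "vec.span ((*v) A ` {vec_of p, vec_of q, vec_of r}) \<subseteq> ?V"
      by (simp add: vec.span_minimal vec.subspace_span)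
    moreover have "vec.span ((*v) A ` {vec_of p, vec_of q, vec_of r}) = range ((*v) A)"
      using vec.linear_span_image[OF linear_mult_vec] s by metis
    moreover have "surj ((*v) A)"
      using A by (metis invertible_def matrix_vector_mul_assoc matrix_vector_mul_lid surjI)
    ultimately show ?thesis by auto
  qed
  show ?thesis using P im by (simp add: config_iff)
qed

lemma bij_betw_fibre:
  assumes P: "P \<in> config m" and m: "m \<ge> 4"
  shows "bij_betw (\<lambda>q. orbit3 (Suc m) (P(Suc m := q))) (fibre m P)
           {y \<in> X3 (Suc m). deletion m y = orbit3 m P}"
proof -
  note eq = equiv_gl_equiv
  have PE: "P \<in> {1..m} \<rightarrow>\<^sub>E UNIV" using P by (simp add: config_def)
  have restr: "restrict R {1..m} \<in> config m" if "R \<in> config (Suc m)" for R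
    using that by (auto simp: config_iff)
  have ext: "R = (restrict R {1..m})(Suc m := R (Suc m))" if "R \<in> config (Suc m)" for R
    using that by (auto simp: fun_eq_iff config_def PiE_def extensional_def)
  have mem: "P(Suc m := q) \<in> config (Suc m)" if "q \<in> fibre m P" for q
    using fun_upd_config[OF P, of q] m that by auto
  have del: "deletion m (orbit3 (Suc m) R) = orbit3 m (restrict R {1..m})"
    if R: "R \<in> config (Suc m)" for R
  proof
    show "deletion m (orbit3 (Suc m) R) \<subseteq> orbit3 m (restrict R {1..m})"
      using restr by (fastforce simp: deletion_def orbit3_def gl_equiv_def)
    show "orbit3 m (restrict R {1..m}) \<subseteq> deletion m (orbit3 (Suc m) R)"
    proof
      fix Q assume "Q \<in> orbit3 m (restrict R {1..m})"
      then obtain A where A: "invertible A" "Q \<in> config m" "\<forall>i\<in>{1..m}. Q i = gl_act A (R i)"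
        by (auto simp: orbit3_def gl_equiv_def)
      let ?R = "\<lambda>i\<in>{1..Suc m}. gl_act A (R i)"
      have "?R \<in> orbit3 (Suc m) R"
        using gl_act_config[OF R A(1)] R A(1) by (auto simp: orbit3_def gl_equiv_def)
      moreover have "Q = restrict ?R {1..m}"
        using A(2,3) by (auto simp: fun_eq_iff config_def PiE_def extensional_def)
      ultimately show "Q \<in> deletion m (orbit3 (Suc m) R)" unfolding deletion_def by blast
    qed
  qed
  have rP: "restrict (P(Suc m := q)) {1..m} = P" for q
    using PE by (auto simp: fun_eq_iff PiE_def extensional_def)
  show ?thesis
  proof (intro bij_betwI')
    fix q r assume q: "q \<in> fibre m P" and r: "r \<in> fibre m P"
    show "orbit3 (Suc m) (P(Suc m := q)) = orbit3 (Suc m) (P(Suc m := r)) \<longleftrightarrow> q = r"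
    proof
      assume "orbit3 (Suc m) (P(Suc m := q)) = orbit3 (Suc m) (P(Suc m := r))"
      then have "(P(Suc m := q), P(Suc m := r)) \<in> gl_equiv (Suc m)"
        using eq_equiv_class[OF _ eq] mem[OF r] by (simp add: orbit3_def)
      then obtain A where A: "invertible A"
        "\<forall>i\<in>{1..Suc m}. (P(Suc m := r)) i = gl_act A ((P(Suc m := q)) i)"
        by (auto simp: gl_equiv_def)
      have "gl_act A (P i) = P i" if "i \<in> {1..m}" for i
        using A(2)[rule_format, of i] that by auto
      then have "gl_act A q = q" using gl_act_fixes_frame[OF P m A(1)] by blast
      moreover have "r = gl_act A q" using A(2)[rule_format, of "Suc m"] by auto
      ultimately show "q = r" by simp
    qed simp
  next
    fix q assume q: "q \<in> fibre m P"
    show "orbit3 (Suc m) (P(Suc m := q)) \<in> {y \<in> X3 (Suc m). deletion m y = orbit3 m P}"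
      using del[OF mem[OF q]] rP mem[OF q] by (auto simp: X3_def orbit3_def quotientI)
  next
    fix y assume "y \<in> {y \<in> X3 (Suc m). deletion m y = orbit3 m P}"
    then obtain R where R: "R \<in> config (Suc m)" "y = orbit3 (Suc m) R" "deletion m y = orbit3 m P"
      by (auto simp: X3_def orbit3_def elim: quotientE)
    then have "orbit3 m (restrict R {1..m}) = orbit3 m P" using del by simp
    then have "(restrict R {1..m}, P) \<in> gl_equiv m"
      using eq_equiv_class[OF _ eq] P by (simp add: orbit3_def)
    then obtain A where A: "invertible A" "\<forall>i\<in>{1..m}. P i = gl_act A (R i)"
      by (auto simp: gl_equiv_def)
    let ?R = "\<lambda>i\<in>{1..Suc m}. gl_act A (R i)" and ?q = "gl_act A (R (Suc m))"
    have R': "?R \<in> config (Suc m)" by (rule gl_act_config[OF R(1) A(1)])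
    have eqR: "?R = P(Suc m := ?q)"
      using A(2) PE by (auto simp: fun_eq_iff PiE_def extensional_def le_Suc_eq)
    have "?q \<in> fibre m P" using fun_upd_config[OF P, of ?q] R' eqR m by simp
    moreover have "(R, ?R) \<in> gl_equiv (Suc m)"
      using R(1) R' A(1) by (auto simp: gl_equiv_def)
    then have "y = orbit3 (Suc m) (P(Suc m := ?q))"
      using R(2) equiv_class_eq[OF eq] eqR by (simp add: orbit3_def)
    ultimately show "\<exists>q\<in>fibre m P. y = orbit3 (Suc m) (P(Suc m := q))" by blast
  qed
qed

end

theory Submission
  imports Defs
begin

text \<open>
  For a set \<open>A\<close> of at least three pairwise disjoint index pairs let \<open>S\<^sub>A\<close> be the locus where all lines
  indexed by \<open>A\<close> are concurrent. Removing one line \<open>H\<close> from the complement \<open>M\<close> of an arrangement lowers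
  the Euler characteristic by that of \<open>H \<inter> M\<close>, since a punctured tubular neighbourhood of \<open>H \<inter> M\<close> has
  Euler characteristic \<open>0\<close>. By induction the complement of \<open>n\<close> lines has Euler characteristic
  \<open>3 - 2n + \<Sum>\<^sub>q (mult q - 1)\<close>, and rewriting each \<open>mult q - 1\<close> as an alternating sum over sets of lines
  through \<open>q\<close> gives \<open>\<chi>(F\<^sub>X) - \<chi>(F\<^sub>S) = \<Sum> (-1)\<^bsup>card A - 1\<^esup>\<close>, where \<open>A\<close> ranges over the sets with
  \<open>S \<subseteq> S\<^sub>A\<close>. A generic choice of points on lines through a common point shows that \<open>S\<^sub>A\<close> is a stratum
  whose generic element has no concurrences besides those forced by \<open>A\<close>. Moebius inversion therefore
  yields \<open>\<rho>(S) = (-1)\<^bsup>card A - 1\<^esup>\<close> if \<open>S = S\<^sub>A\<close>, and \<open>0\<close> if \<open>S\<close> is not of this form.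
\<close>

section \<open>Ranks of abelian groups\<close>

text \<open>\<open>euler_char\<close> is built from suprema and a sum over a possibly infinite set
  of degrees, so additivity cannot be used before finiteness is known. Every step therefore yields
  the value together with finite ranks, and Mayer-Vietoris is also needed in a form that deduces
  finiteness for the piece left over. One line is always kept at infinity. The rest of the
  complement is then open in C^2 and the next line is a coordinate slice, so its tubular
  neighbourhood is a family of discs over the slice and no bundle theory is required. Multiplicities
  are attached to points, which have no counterpart in other strata. A family \<open>A\<close> of
  index pairs makes sense for all configurations at once, and concurrence of its lines becomes an
  order relation between strata; this is the reason for the alternating sum. Two lines always meet,
  so families of size two contribute a constant that cancels in the difference, and \<open>A\<close>
  starts at size three. Disjointness of the pairs encodes that the common point is new, since lines
  sharing an index meet in a point of the configuration.\<close>

primrec lcomb :: "('a, 'b) monoid_scheme \<Rightarrow> (nat \<Rightarrow> int) \<Rightarrow> (nat \<Rightarrow> 'a) \<Rightarrow> nat \<Rightarrow> 'a" where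
  "lcomb G c v 0 = \<one>\<^bsub>G\<^esub>"
| "lcomb G c v (Suc n) = lcomb G c v n \<otimes>\<^bsub>G\<^esub> v n [^]\<^bsub>G\<^esub> c n"

text \<open>Families indexed by an initial segment can be concatenated and lifted along
  homomorphisms without attention to repetitions, unlike the sets in \<open>int_independent\<close>.
  The two notions are compared in \<open>group_rank_eq\<close>.\<close>

definition indep_family :: "('a, 'b) monoid_scheme \<Rightarrow> (nat \<Rightarrow> 'a) \<Rightarrow> nat \<Rightarrow> bool" where
  "indep_family G v n \<longleftrightarrow> (\<forall>i<n. v i \<in> carrier G) \<and>
     (\<forall>c. lcomb G c v n = \<one>\<^bsub>G\<^esub> \<longrightarrow> (\<forall>i<n. c i = 0))"

definition rank_le :: "('a, 'b) monoid_scheme \<Rightarrow> 'a set \<Rightarrow> nat \<Rightarrow> bool" where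
  "rank_le G S r \<longleftrightarrow> (\<forall>v n. indep_family G v n \<and> (\<forall>i<n. v i \<in> S) \<longrightarrow> n \<le> r)"

text \<open>Ranks are attached to subsets of an ambient group, so that kernels and images need no group
  structure of their own.\<close>

definition has_rank :: "('a, 'b) monoid_scheme \<Rightarrow> 'a set \<Rightarrow> nat \<Rightarrow> bool" where
  "has_rank G S r \<longleftrightarrow> (\<exists>v. indep_family G v r \<and> (\<forall>i<r. v i \<in> S)) \<and> rank_le G S r"

section \<open>Integer combinations in abelian groups\<close>

lemma lcomb_cong:
  assumes "\<And>i. i < n \<Longrightarrow> c i = d i" "\<And>i. i < n \<Longrightarrow> v i = w i"
  shows "lcomb G c v n = lcomb G d w n"
  using assms by (induction n) auto

context comm_group
begin

lemma lcomb_closed: "(\<And>i. i < n \<Longrightarrow> v i \<in> carrier G) \<Longrightarrow> lcomb G c v n \<in> carrier G"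
  by (induction n) auto

lemma lcomb_add:
  assumes "\<And>i. i < n \<Longrightarrow> v i \<in> carrier G"
  shows "lcomb G (\<lambda>i. c i + d i) v n = lcomb G c v n \<otimes> lcomb G d v n"
  using assms
proof (induction n)
  case (Suc n)
  then have "lcomb G c v n \<in> carrier G" "lcomb G d v n \<in> carrier G" "v n \<in> carrier G"
    by (auto intro: lcomb_closed)
  then show ?case using Suc by (simp add: int_pow_mult m_ac)
qed simp

lemma lcomb_scale:
  assumes "\<And>i. i < n \<Longrightarrow> v i \<in> carrier G"
  shows "lcomb G (\<lambda>i. c i * k) v n = lcomb G c v n [^] (k :: int)"
  using assms
proof (induction n)
  case (Suc n)
  then have "lcomb G c v n \<in> carrier G" "v n \<in> carrier G"
    by (auto intro: lcomb_closed)
  then show ?case using Suc by (simp add: int_pow_distrib int_pow_pow)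
qed simp

lemma lcomb_zero: "(\<And>i. i < n \<Longrightarrow> v i \<in> carrier G) \<Longrightarrow> lcomb G (\<lambda>i. 0) v n = \<one>"
  by (induction n) auto

lemma lcomb_one: "(\<And>i. i < n \<Longrightarrow> v i = \<one>) \<Longrightarrow> lcomb G c v n = \<one>"
  by (induction n) auto

lemma lcomb_mult_coeff:
  assumes "\<And>i. i < n \<Longrightarrow> v i \<in> carrier G"
  shows "lcomb G (\<lambda>i. N i * c i) v n = lcomb G c (\<lambda>i. v i [^] (N i :: int)) n"
  using assms by (induction n) (auto simp: int_pow_pow)

lemma lcomb_append:
  assumes "\<And>i. i < k + n \<Longrightarrow> v i \<in> carrier G"
  shows "lcomb G c v (k + n) = lcomb G c v k \<otimes> lcomb G (\<lambda>i. c (k + i)) (\<lambda>i. v (k + i)) n"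
  using assms
proof (induction n)
  case 0
  then show ?case by (simp add: lcomb_closed)
next
  case (Suc n)
  have "lcomb G c v k \<in> carrier G" "lcomb G (\<lambda>i. c (k + i)) (\<lambda>i. v (k + i)) n \<in> carrier G"
     "v (k + n) \<in> carrier G"
    using Suc.prems by (auto intro!: lcomb_closed)
  then show ?case using Suc by (simp add: m_assoc)
qed

lemma lcomb_lcomb:
  assumes "\<And>i. i < n \<Longrightarrow> v i \<in> carrier G"
  shows "lcomb G z (\<lambda>a. lcomb G (M a) v n) k = lcomb G (\<lambda>b. \<Sum>a<k. M a b * z a) v n"
proof (induction k)
  case 0
  then show ?case using assms by (simp add: lcomb_zero)
next
  case (Suc k)
  then show ?case
    using lcomb_add[of n v "\<lambda>b. \<Sum>a<k. M a b * z a" "\<lambda>b. M k b * z k"]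
      lcomb_scale[of n v "M k" "z k"] assms by simp
qed

lemma lcomb_delta:
  assumes "\<And>i. i < n \<Longrightarrow> v i \<in> carrier G" "j < n"
  shows "lcomb G (\<lambda>i. if i = j then 1 else 0) v n = v j"
  using assms
proof (induction n)
  case (Suc n)
  show ?case
  proof (cases "j = n")
    case True
    have "lcomb G (\<lambda>i. if i = j then 1 else 0) v n = lcomb G (\<lambda>i. 0) v n"
      using True by (intro lcomb_cong) auto
    then show ?thesis using Suc.prems True by (simp add: lcomb_zero)
  next
    case False
    then show ?thesis using Suc by simp
  qed
qed simp

end

lemma lcomb_hom:
  assumes "f \<in> hom G H" "group G" "group H" "\<And>i. i < n \<Longrightarrow> v i \<in> carrier G" "comm_group G"
  shows "f (lcomb G c v n) = lcomb H c (\<lambda>i. f (v i)) n"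
  using assms(4)
proof (induction n)
  case 0
  then show ?case using assms hom_one by auto
next
  case (Suc n)
  interpret group_hom G H f using assms by (simp add: group_hom_def group_hom_axioms_def)
  interpret comm_group G by fact
  from Suc show ?case by (simp add: lcomb_closed hom_int_pow)
qed

text \<open>Gaussian elimination without fractions, which keeps the solution integral so that its
  entries can serve as exponents in an abelian group.\<close>

lemma int_kernel_exists:
  fixes M :: "'a \<Rightarrow> nat \<Rightarrow> int"
  assumes "finite A" "card A > n"
  shows "\<exists>z. (\<exists>a\<in>A. z a \<noteq> 0) \<and> (\<forall>b<n. (\<Sum>a\<in>A. M a b * z a) = 0)"
  using assms
proof (induction n arbitrary: A M)
  case 0
  then have "A \<noteq> {}" by auto
  then show ?case by (intro exI[of _ "\<lambda>_. 1"]) auto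
next
  case (Suc n)
  show ?case
  proof (cases "\<forall>a\<in>A. M a n = 0")
    case True
    obtain z where "\<exists>a\<in>A. z a \<noteq> 0" "\<forall>b<n. (\<Sum>a\<in>A. M a b * z a) = 0"
      using Suc.IH[of A M] Suc.prems by auto
    then show ?thesis using True by (intro exI[of _ z]) (auto simp: less_Suc_eq)
  next
    case False
    then obtain a0 where a0: "a0 \<in> A" "M a0 n \<noteq> 0" by auto
    \<comment> \<open>Eliminates the unknown \<open>a0\<close> by cross-multiplication with the
      pivot \<open>M a0 n\<close>. Column \<open>n\<close> of \<open>M'\<close> vanishes
      identically, so \<open>y\<close> below solves equation \<open>n\<close> as well.\<close>
    define M' where "M' a b = M a0 n * M a b - M a n * M a0 b" for a b
    obtain z where z: "\<exists>a\<in>A - {a0}. z a \<noteq> 0" "\<forall>b<n. (\<Sum>a\<in>A - {a0}. M' a b * z a) = 0"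
    proof -
      have "card (A - {a0}) > n" using Suc.prems a0 by simp
      then show thesis using Suc.IH[of "A - {a0}" M'] Suc.prems that by blast
    qed
    define y where "y a = (if a = a0 then - (\<Sum>a\<in>A - {a0}. M a n * z a) else M a0 n * z a)" for a
    have "(\<Sum>a\<in>A. M a b * y a) = (\<Sum>a\<in>A - {a0}. M' a b * z a)" for b
    proof -
      have "(\<Sum>a\<in>A. M a b * y a) = M a0 b * y a0 + (\<Sum>a\<in>A - {a0}. M a b * y a)"
        using Suc.prems a0 by (simp add: sum.remove)
      also have "\<dots> = (\<Sum>a\<in>A - {a0}. M' a b * z a)"
        by (simp add: y_def M'_def sum_distrib_left sum_subtractf algebra_simps)
      finally show ?thesis .
    qed
    moreover have "M' a n = 0" for a by (simp add: M'_def)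
    ultimately have "\<forall>b<Suc n. (\<Sum>a\<in>A. M a b * y a) = 0"
      using z(2) by (auto simp: less_Suc_eq)
    moreover have "\<exists>a\<in>A. y a \<noteq> 0"
    proof -
      obtain a where "a \<in> A - {a0}" "z a \<noteq> 0" using z(1) by blast
      then show ?thesis using a0 by (intro bexI[of _ a]) (auto simp: y_def)
    qed
    ultimately show ?thesis by blast
  qed
qed

context comm_group
begin

text \<open>Exchange argument up to multiples. If \<open>k\<close> exceeded \<open>n\<close>, an
  integer vector \<open>z\<close> annihilating the coefficients would give a relation of the
  \<open>v\<close> with coefficients \<open>N i * z i\<close>, not all zero because no
  \<open>N i\<close> is zero.\<close>

lemma indep_family_le:
  assumes v: "indep_family G v k" and w: "\<And>i. i < n \<Longrightarrow> w i \<in> carrier G"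
    and dep: "\<And>a. a < k \<Longrightarrow> \<exists>N M. N \<noteq> 0 \<and> v a [^] (N :: int) = lcomb G M w n"
  shows "k \<le> n"
proof (rule ccontr)
  assume "\<not> k \<le> n"
  obtain N M where NM: "\<And>a. a < k \<Longrightarrow> N a \<noteq> 0" "\<And>a. a < k \<Longrightarrow> v a [^] (N a :: int) = lcomb G (M a) w n"
    using dep by metis
  obtain z where z: "\<exists>a<k. z a \<noteq> 0" "\<forall>b<n. (\<Sum>a<k. M a b * z a) = 0"
    using int_kernel_exists[of "{..<k}" n M] \<open>\<not> k \<le> n\<close> by auto
  have vc: "\<And>i. i < k \<Longrightarrow> v i \<in> carrier G" using v by (simp add: indep_family_def)
  have "lcomb G (\<lambda>i. N i * z i) v k = lcomb G z (\<lambda>i. lcomb G (M i) w n) k"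
    using lcomb_mult_coeff[of k v N z] vc NM by (auto intro: lcomb_cong)
  also have "\<dots> = lcomb G (\<lambda>b. 0) w n"
    using lcomb_lcomb[OF w] z(2) by (auto intro: lcomb_cong)
  finally have "lcomb G (\<lambda>i. N i * z i) v k = \<one>" using w by (simp add: lcomb_zero)
  moreover have "\<forall>c. lcomb G c v k = \<one> \<longrightarrow> (\<forall>i<k. c i = 0)"
    using v by (simp add: indep_family_def)
  ultimately have "\<forall>i<k. N i * z i = 0" by fast
  then show False using z(1) NM(1) by auto
qed

text \<open>By maximality, adjoining \<open>x\<close> creates a relation, and independence of
  \<open>v\<close> forces the coefficient of \<open>x\<close> in it to be nonzero. Passing to a
  multiple is unavoidable: in the integers, 2 is a maximal independent family that does not generate
  1.\<close>

lemma has_rank_torsion_spanned: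
  assumes v: "indep_family G v k" "\<And>i. i < k \<Longrightarrow> v i \<in> S" and le: "rank_le G S k"
    and S: "S \<subseteq> carrier G" "x \<in> S"
  shows "\<exists>N M. N \<noteq> 0 \<and> x [^] (N :: int) = lcomb G M v k"
proof -
  have vc: "\<And>i. i < k \<Longrightarrow> v i \<in> carrier G" using v by (simp add: indep_family_def)
  let ?w = "v(k := x)"
  have w: "\<forall>i<Suc k. ?w i \<in> S" using v(2) S by (auto simp: less_Suc_eq)
  have "\<not> indep_family G ?w (Suc k)"
    using le w unfolding rank_le_def by fastforce
  then obtain c j where c: "lcomb G c ?w (Suc k) = \<one>" "j < Suc k" "c j \<noteq> 0"
    using w S unfolding indep_family_def by blast
  have eq: "lcomb G c ?w k = lcomb G c v k" by (rule lcomb_cong) auto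
  have cl: "lcomb G c v k \<in> carrier G" using vc by (simp add: lcomb_closed)
  have xk: "x \<in> carrier G" using S by auto
  have 1: "lcomb G c v k \<otimes> x [^] c k = \<one>" using c(1) eq by simp
  have ck: "c k \<noteq> 0"
  proof
    assume "c k = 0"
    then have "lcomb G c v k = \<one>" using 1 cl by simp
    then have "\<forall>i<k. c i = 0" using v by (simp add: indep_family_def)
    then show False using c \<open>c k = 0\<close> by (auto simp: less_Suc_eq)
  qed
  have "x [^] c k = inv (lcomb G c v k)" using 1 cl xk
    by (metis int_pow_closed inv_equality m_comm)
  also have "\<dots> = lcomb G c v k [^] (- 1 :: int)" using cl by (simp add: int_pow_neg)
  also have "\<dots> = lcomb G (\<lambda>i. c i * - 1) v k" using lcomb_scale[of k v c "-1"] vc by metis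
  finally show ?thesis using ck by blast
qed

end

section \<open>Ranks of subsets and exactness\<close>

lemma rank_le_mono: "rank_le G S r \<Longrightarrow> S' \<subseteq> S \<Longrightarrow> r \<le> r' \<Longrightarrow> rank_le G S' r'"
  unfolding rank_le_def by (meson le_trans subset_iff)

lemma rank_le_imp_has_rank:
  assumes "rank_le G S r"
  shows "\<exists>k. has_rank G S k"
proof -
  let ?P = "\<lambda>n. \<exists>v. indep_family G v n \<and> (\<forall>i<n. v i \<in> S)"
  have "?P 0" by (simp add: indep_family_def)
  moreover have "\<And>n. ?P n \<Longrightarrow> n \<le> r" using assms by (auto simp: rank_le_def)
  ultimately have G: "?P (GREATEST n. ?P n)" "\<And>n. ?P n \<Longrightarrow> n \<le> (GREATEST n. ?P n)"
    using GreatestI_nat[of ?P 0 r] Greatest_le_nat[of ?P _ r] by blast+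
  show ?thesis unfolding has_rank_def rank_le_def using G by blast
qed

lemma has_rank_unique: "has_rank G S k \<Longrightarrow> has_rank G S k' \<Longrightarrow> k = k'"
  unfolding has_rank_def rank_le_def by (meson le_antisym)

lemma has_rank_mono:
  assumes "has_rank G S k" "S' \<subseteq> S" obtains k' where "has_rank G S' k'"
proof -
  have "rank_le G S' k" using assms(1,2) rank_le_mono[of G S k S' k] by (simp add: has_rank_def)
  then show thesis using rank_le_imp_has_rank that by blast
qed

lemma has_rank_trivial:
  assumes "comm_group G" shows "has_rank G {\<one>\<^bsub>G\<^esub>} 0"
proof -
  interpret comm_group G by fact
  have "n = 0" if v: "indep_family G v n" "\<forall>i<n. v i = \<one>\<^bsub>G\<^esub>" for v n
  proof (rule ccontr)
    assume "n \<noteq> 0"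
    moreover have "lcomb G (\<lambda>_. 1) v n = \<one>\<^bsub>G\<^esub>" using v by (simp add: lcomb_one)
    ultimately show False using v by (force simp: indep_family_def)
  qed
  then show ?thesis by (auto simp: has_rank_def rank_le_def indep_family_def)
qed

lemma indep_family_lift:
  assumes f: "f \<in> hom G H" and G: "comm_group G" and H: "comm_group H"
    and ind: "indep_family H (\<lambda>i. f (w i)) n" and w: "\<And>i. i < n \<Longrightarrow> w i \<in> carrier G"
  shows "indep_family G w n"
proof -
  have g: "group G" "group H" using G H by (simp_all add: comm_group_def)
  interpret group_hom G H f using f g by (simp add: group_hom_def group_hom_axioms_def)
  have "lcomb H c (\<lambda>i. f (w i)) n = \<one>\<^bsub>H\<^esub>" if "lcomb G c w n = \<one>\<^bsub>G\<^esub>" for c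
    using lcomb_hom[OF f g _ G, of n w c] w that hom_one by simp
  then show ?thesis using ind w by (auto simp: indep_family_def)
qed

text \<open>A maximal independent family of the kernel, followed by lifts of one of the image, is
  independent and generates a multiple of every element.\<close>

theorem rank_nullity:
  assumes f: "f \<in> hom G H" and G: "comm_group G" and H: "comm_group H"
    and k: "has_rank G (kernel G H f) k" and i: "has_rank H (f ` carrier G) i"
  shows "has_rank G (carrier G) (k + i)"
proof -
  interpret G: comm_group G by fact
  interpret H: comm_group H by fact
  interpret group_hom G H f using f by (simp add: group_hom_def group_hom_axioms_def)
  have gr: "group G" "group H" by unfold_locales
  obtain v where v: "indep_family G v k" "\<forall>j<k. v j \<in> kernel G H f"
    using k by (auto simp: has_rank_def)
  obtain w where w: "indep_family H w i" "\<forall>j<i. w j \<in> f ` carrier G"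
    using i by (auto simp: has_rank_def)
  then obtain w' where w': "\<And>j. j < i \<Longrightarrow> w' j \<in> carrier G" "\<And>j. j < i \<Longrightarrow> f (w' j) = w j"
    unfolding image_iff by metis
  define u where "u j = (if j < k then v j else w' (j - k))" for j
  have vc: "v j \<in> carrier G" "f (v j) = \<one>\<^bsub>H\<^esub>" if "j < k" for j
    using v that by (auto simp: kernel_def)
  have uc: "u j \<in> carrier G" if "j < k + i" for j
    using that vc w' by (auto simp: u_def)
  have split: "lcomb G c u (k + i) = lcomb G c v k \<otimes>\<^bsub>G\<^esub> lcomb G (\<lambda>j. c (k + j)) w' i" for c
  proof -
    have "lcomb G c u k = lcomb G c v k" by (rule lcomb_cong) (auto simp: u_def)
    moreover have "lcomb G (\<lambda>j. c (k + j)) (\<lambda>j. u (k + j)) i = lcomb G (\<lambda>j. c (k + j)) w' i"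
      by (rule lcomb_cong) (auto simp: u_def)
    ultimately show ?thesis using G.lcomb_append[of k i u c] uc by simp
  qed
  have vcl: "lcomb G c v k \<in> carrier G" and fv: "f (lcomb G c v k) = \<one>\<^bsub>H\<^esub>" for c
    using vc lcomb_hom[OF f gr vc(1) G] H.lcomb_one by (auto intro: G.lcomb_closed)
  have wcl: "lcomb G c w' i \<in> carrier G" for c
    using w' by (auto intro: G.lcomb_closed)
  have fw: "f (lcomb G c w' i) = lcomb H c w i" for c
    using lcomb_hom[OF f gr w'(1) G] w'(2) lcomb_cong[of i c c "\<lambda>j. f (w' j)" w H] by simp
  have wc: "\<And>j. j < i \<Longrightarrow> w j \<in> carrier H" using w by (simp add: indep_family_def)
  have "indep_family G u (k + i)"
    unfolding indep_family_def
  proof (intro conjI allI impI)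
    fix c j assume c: "lcomb G c u (k + i) = \<one>\<^bsub>G\<^esub>" and j: "j < k + i"
    have "f (lcomb G c u (k + i)) = \<one>\<^bsub>H\<^esub>" using c hom_one by simp
    then have "lcomb H (\<lambda>j. c (k + j)) w i = \<one>\<^bsub>H\<^esub>"
      using fv fw vcl wcl wc by (simp add: split H.lcomb_closed)
    then have 0: "\<forall>j<i. c (k + j) = 0" using w by (auto simp: indep_family_def)
    then have "lcomb G (\<lambda>j. c (k + j)) w' i = lcomb G (\<lambda>j. 0) w' i"
      by (intro lcomb_cong) auto
    then have "lcomb G c v k = \<one>\<^bsub>G\<^esub>" using c split[of c] vcl w' by (simp add: G.lcomb_zero)
    then have "\<forall>j<k. c j = 0" using v by (auto simp: indep_family_def)
    then show "c j = 0" using 0 j by (metis add_diff_inverse_nat nat_add_left_cancel_less)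
  qed (use uc in auto)
  moreover have "rank_le G (carrier G) (k + i)"
    unfolding rank_le_def
  proof clarify
    fix x n assume x: "indep_family G x n"
    show "n \<le> k + i"
    proof (rule G.indep_family_le[OF x, of "k + i" u])
      fix a assume "a < n"
      then have xa: "x a \<in> carrier G" using x by (simp add: indep_family_def)
      obtain N M where NM: "N \<noteq> 0" "f (x a) [^]\<^bsub>H\<^esub> (N :: int) = lcomb H M w i"
      proof (rule exE)
        show "\<exists>N M. N \<noteq> 0 \<and> f (x a) [^]\<^bsub>H\<^esub> (N :: int) = lcomb H M w i"
          by (rule H.has_rank_torsion_spanned[of w i "f ` carrier G"])
            (use w i xa in \<open>auto simp: has_rank_def\<close>)
      qed blast
      \<comment> \<open>The lifts account for a multiple of the image of \<open>x a\<close>;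
        dividing them out leaves an element of the kernel.\<close>
      let ?y = "x a [^]\<^bsub>G\<^esub> N \<otimes>\<^bsub>G\<^esub> inv\<^bsub>G\<^esub> lcomb G M w' i"
      have "?y \<in> kernel G H f"
        using NM xa wcl[of M] fw[of M] H.lcomb_closed[of i w M] wc
        by (auto simp: kernel_def hom_int_pow)
      obtain N' M' where N': "N' \<noteq> 0" "?y [^]\<^bsub>G\<^esub> (N' :: int) = lcomb G M' v k"
      proof (rule exE)
        show "\<exists>N' M'. N' \<noteq> 0 \<and> ?y [^]\<^bsub>G\<^esub> (N' :: int) = lcomb G M' v k"
          by (rule G.has_rank_torsion_spanned[of v k "kernel G H f"])
            (use v k \<open>?y \<in> _\<close> in \<open>auto simp: has_rank_def kernel_def\<close>)
      qed blast
      have "x a [^]\<^bsub>G\<^esub> N = ?y \<otimes>\<^bsub>G\<^esub> lcomb G M w' i"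
        using xa wcl[of M] by (simp add: G.m_assoc)
      then have "x a [^]\<^bsub>G\<^esub> (N * N') = (?y \<otimes>\<^bsub>G\<^esub> lcomb G M w' i) [^]\<^bsub>G\<^esub> N'"
        using xa by (simp flip: G.int_pow_pow)
      also have "\<dots> = lcomb G M' v k \<otimes>\<^bsub>G\<^esub> lcomb G (\<lambda>j. M j * N') w' i"
        using N' xa wcl[of M] w' by (simp add: G.int_pow_distrib G.lcomb_scale)
      also have "\<dots> = lcomb G (\<lambda>j. if j < k then M' j else M (j - k) * N') u (k + i)"
        unfolding split by (intro arg_cong2[where f = "(\<otimes>\<^bsub>G\<^esub>)"] lcomb_cong) auto
      finally show "\<exists>N M. N \<noteq> 0 \<and> x a [^]\<^bsub>G\<^esub> (N :: int) = lcomb G M u (k + i)"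
        using NM(1) N'(1) by (meson mult_eq_0_iff)
    qed (use uc in auto)
  qed
  ultimately show ?thesis using uc by (auto simp: has_rank_def)
qed

lemma has_rank_image:
  assumes f: "f \<in> hom G H" and G: "comm_group G" and H: "comm_group H"
    and r: "has_rank G (carrier G) r"
  obtains i where "has_rank H (f ` carrier G) i"
proof -
  have "rank_le H (f ` carrier G) r"
    unfolding rank_le_def
  proof clarify
    fix v n assume v: "indep_family H v n" "\<forall>i<n. v i \<in> f ` carrier G"
    then obtain w where w: "\<And>i. i < n \<Longrightarrow> w i \<in> carrier G" "\<And>i. i < n \<Longrightarrow> f (w i) = v i"
      unfolding image_iff by metis
    have "indep_family H (\<lambda>i. f (w i)) n"
      using v(1) w(2) lcomb_cong[of n _ _ "\<lambda>i. f (w i)" v H] by (auto simp: indep_family_def)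
    then have "indep_family G w n" using indep_family_lift[OF f G H] w by blast
    then show "n \<le> r" using r w by (auto simp: has_rank_def rank_le_def)
  qed
  then show thesis using rank_le_imp_has_rank that by blast
qed

text \<open>Exactness makes the kernel of \<open>g\<close> an image of \<open>A\<close>, and the
  image of \<open>g\<close> is a subset of \<open>C\<close>. Only the existence of a finite rank
  results; the numbers are related in \<open>rank_decomposition\<close>.\<close>

lemma exact_has_rank:
  assumes f: "f \<in> hom A B" and g: "g \<in> hom B C"
    and ab: "comm_group A" "comm_group B" "comm_group C"
    and ex: "f ` carrier A = kernel B C g"
    and a: "has_rank A (carrier A) a" and c: "has_rank C (carrier C) c"
  obtains b where "has_rank B (carrier B) b"
proof -
  obtain i where "has_rank B (kernel B C g) i"
    using has_rank_image[OF f ab(1,2) a] ex by auto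
  moreover have "g ` carrier B \<subseteq> carrier C" using g by (auto simp: hom_def)
  then obtain j where "has_rank C (g ` carrier B) j" by (rule has_rank_mono[OF c])
  ultimately show thesis using rank_nullity[OF g ab(2,3)] that by blast
qed

lemma has_rank_iso:
  assumes "G \<cong> H" "comm_group G" "comm_group H" "has_rank H (carrier H) r"
  shows "has_rank G (carrier G) r"
proof -
  obtain f where f: "f \<in> hom G H" "bij_betw f (carrier G) (carrier H)"
    using assms by (auto simp: is_iso_def iso_def)
  interpret G: comm_group G by fact
  interpret H: comm_group H by fact
  interpret group_hom G H f using f by (simp add: group_hom_def group_hom_axioms_def)
  have "kernel G H f = {\<one>\<^bsub>G\<^esub>}"
    using f(2) inj_iff_trivial_ker by (auto simp: bij_betw_def)
  then show ?thesis
    using rank_nullity[OF f(1) assms(2,3), of 0 r] has_rank_trivial[OF assms(2)] f(2) assms(4)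
    by (auto simp: bij_betw_def)
qed

section \<open>Agreement with the rank defined by independent sets\<close>

lemma (in comm_group) finprod_lcomb:
  assumes "\<And>i. i < n \<Longrightarrow> v i \<in> carrier G"
  shows "finprod G (\<lambda>i. v i [^] (c i :: int)) {..<n} = lcomb G c v n"
  using assms
proof (induction n)
  case (Suc n)
  then have "(\<lambda>i. v i [^] c i) \<in> {..<n} \<rightarrow> carrier G" by auto
  with Suc show ?case by (simp add: lessThan_Suc m_comm lcomb_closed)
qed simp

text \<open>The bound in \<open>has_rank\<close> turns the supremum into a maximum. Sets and
  families yield the same cardinalities because an independent family cannot repeat a
  member.\<close>

lemma (in comm_group) group_rank_eq:
  assumes r: "has_rank G (carrier G) r"
  shows "group_rank G = r"
proof -
  have "n \<in> {card B |B. int_independent G B} \<longleftrightarrow> (\<exists>v. indep_family G v n)" for n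
  proof
    assume "n \<in> {card B |B. int_independent G B}"
    then obtain B where B: "int_independent G B" "n = card B" by auto
    then have fin: "finite B" by (simp add: int_independent_def)
    then obtain h where h: "bij_betw h {..<n} B" using B(2) ex_bij_betw_nat_finite
      by (metis atLeast0LessThan)
    have hc: "h i \<in> carrier G" if "i < n" for i
      using h that B by (auto simp: bij_betw_def int_independent_def)
    have "indep_family G h n"
      unfolding indep_family_def
    proof (intro conjI allI impI)
      fix c i assume c: "lcomb G c h n = \<one>" and i: "i < n"
      define d where "d b = c (inv_into {..<n} h b)" for b
      have d: "d (h j) = c j" if "j < n" for j
        using h that by (simp add: d_def bij_betw_def inv_into_f_f)
      have inj: "inj_on h {..<n}" and im: "h ` {..<n} = B" using h by (auto simp: bij_betw_def)
      have "finprod G (\<lambda>b. b [^] d b) B = finprod G (\<lambda>b. b [^] d b) (h ` {..<n})"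
        by (simp add: im)
      also have "\<dots> = finprod G (\<lambda>j. h j [^] d (h j)) {..<n}"
        using hc inj by (intro finprod_reindex) auto
      also have "\<dots> = lcomb G (\<lambda>j. d (h j)) h n" using hc by (intro finprod_lcomb) auto
      also have "\<dots> = lcomb G c h n" by (intro lcomb_cong) (auto simp: d)
      finally have "\<forall>b\<in>B. d b = 0" using c B by (auto simp: int_independent_def)
      then show "c i = 0" using d[OF i] h i by (auto simp: bij_betw_def)
    qed (use hc in auto)
    then show "\<exists>v. indep_family G v n" by blast
  next
    assume "\<exists>v. indep_family G v n"
    then obtain v where v: "indep_family G v n" by blast
    then have vc: "v i \<in> carrier G" if "i < n" for i using that by (simp add: indep_family_def)
    have inj: "inj_on v {..<n}"
    proof (rule inj_onI, rule ccontr)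
      fix i j assume ij: "i \<in> {..<n}" "j \<in> {..<n}" "v i = v j" "i \<noteq> j"
      let ?d = "\<lambda>k l. if l = k then 1 else 0 :: int"
      \<comment> \<open>A repeated member gives the nontrivial relation with coefficient 1 at
        \<open>i\<close> and -1 at \<open>j\<close>.\<close>
      have "lcomb G (\<lambda>l. ?d i l + ?d j l * - 1) v n = lcomb G (?d i) v n \<otimes> lcomb G (?d j) v n [^] (- 1 :: int)"
        using lcomb_add[of n v "?d i" "\<lambda>l. ?d j l * - 1"] lcomb_scale[of n v "?d j" "-1"] vc by simp
      also have "\<dots> = v i \<otimes> v j [^] (- 1 :: int)"
        using lcomb_delta[of n v i] lcomb_delta[of n v j] ij vc by simp
      also have "\<dots> = \<one>" using ij vc by (simp add: int_pow_neg)
      finally have "\<forall>l<n. ?d i l + ?d j l * - 1 = 0" using v unfolding indep_family_def by blast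
      then have "?d i i + ?d j i * - 1 = 0" using ij by blast
      then show False using ij by simp
    qed
    have "int_independent G (v ` {..<n})"
      unfolding int_independent_def
    proof (intro conjI allI impI ballI)
      fix c b assume c: "finprod G (\<lambda>b. b [^] (c b :: int)) (v ` {..<n}) = \<one>" and b: "b \<in> v ` {..<n}"
      have "finprod G (\<lambda>b. b [^] c b) (v ` {..<n}) = finprod G (\<lambda>j. v j [^] c (v j)) {..<n}"
        using vc inj by (intro finprod_reindex) auto
      also have "\<dots> = lcomb G (\<lambda>j. c (v j)) v n" using vc by (intro finprod_lcomb) auto
      finally have "lcomb G (\<lambda>j. c (v j)) v n = \<one>" using c by simp
      then have "\<forall>j<n. c (v j) = 0" using v unfolding indep_family_def by blast
      then show "c b = 0" using b by auto
    qed (use vc in auto)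
    moreover have "card (v ` {..<n}) = n" using inj by (simp add: card_image)
    ultimately show "n \<in> {card B |B. int_independent G B}" by (intro CollectI exI[of _ "v ` {..<n}"]) simp
  qed
  then have "{card B |B. int_independent G B} = {n. \<exists>v. indep_family G v n}" by blast
  moreover have "r \<in> {n. \<exists>v. indep_family G v n}" "\<And>n. n \<in> {n. \<exists>v. indep_family G v n} \<Longrightarrow> n \<le> r"
    using r by (auto simp: has_rank_def rank_le_def indep_family_def)
  ultimately show ?thesis unfolding group_rank_def using cSup_eq_maximum[of r] by metis
qed

lemma has_rank_integer_group: "has_rank integer_group (carrier integer_group) 1"
proof -
  interpret comm_group integer_group by (rule abelian_integer_group)
  let ?v = "\<lambda>_ :: nat. 1 :: int"
  have l: "lcomb integer_group c ?v 1 = c 0" for c by simp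
  have v: "indep_family integer_group ?v 1" using l by (auto simp: indep_family_def)
  moreover have "n \<le> 1" if "indep_family integer_group w n" for w n
  proof (rule indep_family_le[OF that, of 1 ?v])
    fix a
    have "w a [^]\<^bsub>integer_group\<^esub> (1 :: int) = lcomb integer_group (\<lambda>_. w a) ?v 1" by simp
    then show "\<exists>N M. N \<noteq> 0 \<and> w a [^]\<^bsub>integer_group\<^esub> (N :: int) = lcomb integer_group M ?v 1"
      by (metis zero_neq_one)
  qed simp
  ultimately show ?thesis by (auto simp: has_rank_def rank_le_def)
qed


section \<open>Euler characteristics of pairs of spaces\<close>

abbreviation hom_rank :: "int \<Rightarrow> 'a topology \<Rightarrow> 'a set \<Rightarrow> nat \<Rightarrow> bool" where
  "hom_rank p X S r \<equiv>
     has_rank (relative_homology_group p X S) (carrier (relative_homology_group p X S)) r"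

text \<open>The witness \<open>b\<close> records finiteness of all ranks and vanishing in large degrees, without which
  \<^const>\<open>group_rank\<close> and \<^const>\<open>euler_char\<close> return junk values.\<close>

definition has_chi :: "'a topology \<Rightarrow> 'a set \<Rightarrow> int \<Rightarrow> bool" where
  "has_chi X S x \<longleftrightarrow> (\<exists>b n. (\<forall>p. hom_rank (int p) X S (b p)) \<and> (\<forall>p\<ge>n. b p = 0) \<and>
     x = (\<Sum>p<n. (- 1) ^ p * int (b p)))"

lemma has_chiI:
  assumes "\<And>p. hom_rank (int p) X S (b p)" "\<And>p. p \<ge> n \<Longrightarrow> b p = 0"
  shows "has_chi X S (\<Sum>p<n. (- 1) ^ p * int (b p))"
  using assms unfolding has_chi_def by blast

lemma has_chi_imp_euler_char:
  assumes "has_chi X {} x" shows "euler_char X = x"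
proof -
  obtain b n where b: "\<And>p. hom_rank (int p) X {} (b p)" "\<And>p. p \<ge> n \<Longrightarrow> b p = 0"
    "x = (\<Sum>p<n. (- 1) ^ p * int (b p))"
    using assms unfolding has_chi_def by blast
  have betti: "betti p X = b p" for p
    unfolding betti_def by (rule comm_group.group_rank_eq[OF _ b(1)]) simp
  have "{p. b p \<noteq> 0} \<subseteq> {..<n}" using b(2) by (metis (mono_tags, lifting) CollectD lessThan_iff not_le subsetI)
  then show ?thesis
    unfolding euler_char_def betti b(3) by (intro sum.mono_neutral_left) auto
qed

lemma has_chi_iso:
  assumes "\<And>p. relative_homology_group p X S \<cong> relative_homology_group p Y T" "has_chi Y T x"
  shows "has_chi X S x"
proof -
  have "hom_rank p X S r" if "hom_rank p Y T r" for p r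
    using has_rank_iso[OF assms(1)] that by simp
  then show ?thesis using assms(2) unfolding has_chi_def by blast
qed

lemma has_rank_trivial_group:
  assumes "trivial_group G" "comm_group G" shows "has_rank G (carrier G) 0"
  using assms has_rank_trivial by (metis trivial_group_def)

section \<open>The long exact sequence of a pair\<close>

locale homology_pair =
  fixes X :: "'a topology" and S :: "'a set"
begin

abbreviation "HX p \<equiv> homology_group p X"
abbreviation "HS p \<equiv> homology_group p (subtopology X S)"
abbreviation "HR p \<equiv> relative_homology_group p X S"
abbreviation "fi p \<equiv> hom_induced p (subtopology X S) {} X {} id"
abbreviation "fj p \<equiv> hom_induced p X {} X S id"
abbreviation "fd p \<equiv> hom_boundary p X S"

lemma homs: "fi p \<in> hom (HS p) (HX p)" "fj p \<in> hom (HX p) (HR p)" "fd p \<in> hom (HR p) (HS (p - 1))"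
  by (simp_all add: hom_induced_hom hom_boundary_hom)

lemma exact:
  "fj p ` carrier (HX p) = kernel (HR p) (HS (p - 1)) (fd p)"
  "fd (p + 1) ` carrier (HR (p + 1)) = kernel (HS p) (HX p) (fi p)"
  "fi p ` carrier (HS p) = kernel (HX p) (HR p) (fj p)"
  using homology_exactness_axiom_1[of p X S] homology_exactness_axiom_2[of "p + 1" X S]
    homology_exactness_axiom_3[of p X S] by auto

lemma rank_space:
  assumes "hom_rank p (subtopology X S) {} a" "hom_rank p X S c" obtains b where "hom_rank p X {} b"
  by (rule exact_has_rank[OF homs(1,2) _ _ _ exact(3) assms]) auto

lemma rank_rel:
  assumes "hom_rank p X {} b" "hom_rank (p - 1) (subtopology X S) {} a" obtains c where "hom_rank p X S c"
  by (rule exact_has_rank[OF homs(2,3) _ _ _ exact(1) assms]) auto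

lemma rank_subspace:
  assumes "hom_rank (p + 1) X S c" "hom_rank p X {} b" obtains a where "hom_rank p (subtopology X S) {} a"
proof -
  have "fd (p + 1) \<in> hom (HR (p + 1)) (HS p)" using homs(3)[of "p + 1"] by simp
  from this homs(1) show thesis
    by (rule exact_has_rank[OF _ _ _ _ _ exact(2) assms]) (auto intro: that)
qed

text \<open>\<open>i\<close>, \<open>j\<close> and \<open>d\<close> are the ranks of the images of
  the inclusion, the projection and the boundary map; by exactness each is also the rank of the next
  kernel. \<open>d\<close> is indexed by the degree of the relative group, hence the shift in the
  formula for \<open>a\<close>, and \<open>d 0\<close> vanishes because homology in degree -1 is
  trivial.\<close>

lemma rank_decomposition:
  assumes a: "\<And>p. hom_rank (int p) (subtopology X S) {} (a p)" and b: "\<And>p. hom_rank (int p) X {} (b p)"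
    and c: "\<And>p. hom_rank (int p) X S (c p)"
  obtains i j d where "\<And>p :: nat. a p = d (Suc p) + i p" "\<And>p. b p = i p + j p" "\<And>p. c p = j p + d p"
    "d 0 = (0 :: nat)"
proof -
  have "\<exists>i. has_rank (HX (int p)) (fi (int p) ` carrier (HS (int p))) i" for p
    by (rule has_rank_image[OF homs(1) _ _ a]) auto
  then obtain i where i: "\<And>p. has_rank (HX (int p)) (fi (int p) ` carrier (HS (int p))) (i p)" by metis
  have "\<exists>i. has_rank (HR (int p)) (fj (int p) ` carrier (HX (int p))) i" for p
    by (rule has_rank_image[OF homs(2) _ _ b]) auto
  then obtain j where j: "\<And>p. has_rank (HR (int p)) (fj (int p) ` carrier (HX (int p))) (j p)" by metis
  have "\<exists>i. has_rank (HS (int p - 1)) (fd (int p) ` carrier (HR (int p))) i" for p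
    by (rule has_rank_image[OF homs(3) _ _ c]) auto
  then obtain d where d: "\<And>p. has_rank (HS (int p - 1)) (fd (int p) ` carrier (HR (int p))) (d p)" by metis
  show thesis
  proof
    fix p
    have "has_rank (HS (int p)) (kernel (HS (int p)) (HX (int p)) (fi (int p))) (d (Suc p))"
      using d[of "Suc p"] by (simp add: exact(2)[symmetric] add.commute)
    from rank_nullity[OF homs(1) _ _ this i] show "a p = d (Suc p) + i p"
      using has_rank_unique[OF a] by simp
    have "has_rank (HX (int p)) (kernel (HX (int p)) (HR (int p)) (fj (int p))) (i p)"
      using i by (simp add: exact(3)[symmetric])
    from rank_nullity[OF homs(2) _ _ this j] show "b p = i p + j p"
      using has_rank_unique[OF b] by simp
    have "has_rank (HR (int p)) (kernel (HR (int p)) (HS (int p - 1)) (fd (int p))) (j p)"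
      using j by (simp add: exact(1)[symmetric])
    from rank_nullity[OF homs(3) _ _ this d] show "c p = j p + d p"
      using has_rank_unique[OF c] by simp
  next
    have t: "trivial_group (HS (- 1))" by simp
    have "fd 0 ` carrier (HR 0) \<subseteq> carrier (HS (- 1))"
      using homs(3)[of 0] by (auto simp: hom_def)
    moreover have "rank_le (HS (- 1)) (carrier (HS (- 1))) 0"
      using has_rank_trivial_group[OF t] by (simp add: has_rank_def)
    ultimately have "rank_le (HS (- 1)) (fd 0 ` carrier (HR 0)) 0" using rank_le_mono by blast
    then show "d 0 = 0" using d[of 0] unfolding has_rank_def rank_le_def by auto
  qed
qed

text \<open>The decomposition gives \<open>a p - b p + c p = d (Suc p) + d p\<close>, whose
  alternating sum telescopes. Vanishing in large degrees is asked of any two of the three ranks, so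
  that one lemma serves all three ways of solving for a missing Euler characteristic.\<close>

lemma chi_additive:
  assumes a: "\<And>p. hom_rank (int p) (subtopology X S) {} (a p)" and b: "\<And>p. hom_rank (int p) X {} (b p)"
    and c: "\<And>p. hom_rank (int p) X S (c p)"
    and n: "(\<forall>p\<ge>n. a p = 0 \<and> b p = 0) \<or> (\<forall>p\<ge>n. b p = 0 \<and> c p = 0) \<or> (\<forall>p\<ge>n. a p = 0 \<and> c p = 0)"
  obtains x y where "has_chi (subtopology X S) {} x" "has_chi X {} (x + y)" "has_chi X S y"
proof -
  obtain i j d where ijd: "\<And>p. a p = d (Suc p) + i p" "\<And>p. b p = i p + j p" "\<And>p. c p = j p + d p"
    "d 0 = (0 :: nat)" using rank_decomposition[OF a b c] by metis
  \<comment> \<open>Vanishing of \<open>c\<close> in degree \<open>p\<close> is read off from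
    \<open>a\<close> in degree \<open>p - 1\<close>, hence the shift by one.\<close>
  define N where "N = Suc n"
  have z: "a p = 0 \<and> b p = 0 \<and> c p = 0" if p: "p \<ge> N" for p
  proof -
    obtain q where q: "p = Suc q" "q \<ge> n" using p unfolding N_def by (cases p) auto
    then have le: "n \<le> q" "n \<le> Suc q" "n \<le> Suc (Suc q)" by linarith+
    note eq = ijd(1)[of q] ijd(1)[of "Suc q"] ijd(2)[of "Suc q"] ijd(3)[of "Suc q"] ijd(3)[of "Suc (Suc q)"]
    from n show ?thesis
    proof (elim disjE)
      assume *: "\<forall>p\<ge>n. a p = 0 \<and> b p = 0"
      show ?thesis using *[rule_format, OF le(1)] *[rule_format, OF le(2)] eq unfolding q(1) by linarith
    next
      assume *: "\<forall>p\<ge>n. b p = 0 \<and> c p = 0"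
      show ?thesis using *[rule_format, OF le(2)] *[rule_format, OF le(3)] eq unfolding q(1) by linarith
    next
      assume *: "\<forall>p\<ge>n. a p = 0 \<and> c p = 0"
      show ?thesis using *[rule_format, OF le(2)] eq unfolding q(1) by linarith
    qed
  qed
  define ec where "ec f = (\<Sum>p<N. (- 1) ^ p * int (f p))" for f
  have "(\<Sum>p<M. (- 1) ^ p * (int (a p) - int (b p) + int (c p))) = - ((- 1) ^ M * int (d M))" for M
    by (induction M) (simp_all add: ijd algebra_simps)
  from this[of N] have "ec a - ec b + ec c = 0"
    using z[of N] ijd(3)[of N] by (simp add: ec_def algebra_simps sum.distrib sum_subtractf)
  then have "ec b = ec a + ec c" by simp
  moreover have "has_chi (subtopology X S) {} (ec a)" "has_chi X {} (ec b)" "has_chi X S (ec c)"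
    unfolding ec_def using z by (blast intro: has_chiI[OF a] has_chiI[OF b] has_chiI[OF c])+
  ultimately show thesis using that by simp
qed

end

lemma has_chi_unique:
  assumes "has_chi X S x" "has_chi X S y" shows "x = y"
proof -
  obtain b n where b: "\<And>p. hom_rank (int p) X S (b p)" "\<And>p. p \<ge> n \<Longrightarrow> b p = 0"
    "x = (\<Sum>p<n. (- 1) ^ p * int (b p))" using assms(1) unfolding has_chi_def by blast
  obtain c m where c: "\<And>p. hom_rank (int p) X S (c p)" "\<And>p. p \<ge> m \<Longrightarrow> c p = 0"
    "y = (\<Sum>p<m. (- 1) ^ p * int (c p))" using assms(2) unfolding has_chi_def by blast
  have eq: "b = c" using has_rank_unique[OF b(1) c(1)] by auto
  have "x = (\<Sum>p<max n m. (- 1) ^ p * int (b p))"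
    unfolding b(3) using b(2) by (intro sum.mono_neutral_left) auto
  also have "\<dots> = y"
    unfolding c(3) eq using c(2) by (intro sum.mono_neutral_right) auto
  finally show "x = y" .
qed

lemma has_chi_space:
  assumes "has_chi (subtopology X S) {} x" "has_chi X S y" shows "has_chi X {} (x + y)"
proof -
  interpret homology_pair X S .
  obtain a n where a: "\<And>p. hom_rank (int p) (subtopology X S) {} (a p)" "\<And>p. p \<ge> n \<Longrightarrow> a p = 0"
    using assms(1) unfolding has_chi_def by blast
  obtain c m where c: "\<And>p. hom_rank (int p) X S (c p)" "\<And>p. p \<ge> m \<Longrightarrow> c p = 0"
    using assms(2) unfolding has_chi_def by blast
  have "\<exists>b. hom_rank (int p) X {} b" for p by (rule rank_space[OF a(1) c(1)]) auto
  then obtain b where b: "\<And>p. hom_rank (int p) X {} (b p)" by metis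
  obtain x' y' where "has_chi (subtopology X S) {} x'" "has_chi X {} (x' + y')" "has_chi X S y'"
    by (rule chi_additive[OF a(1) b c(1), of "max n m"]) (use a(2) c(2) in auto)
  then show ?thesis using assms has_chi_unique by blast
qed

lemma has_chi_subspace:
  assumes "has_chi X {} x" "has_chi X S y" shows "has_chi (subtopology X S) {} (x - y)"
proof -
  interpret homology_pair X S .
  obtain b n where b: "\<And>p. hom_rank (int p) X {} (b p)" "\<And>p. p \<ge> n \<Longrightarrow> b p = 0"
    using assms(1) unfolding has_chi_def by blast
  obtain c m where c: "\<And>p. hom_rank (int p) X S (c p)" "\<And>p. p \<ge> m \<Longrightarrow> c p = 0"
    using assms(2) unfolding has_chi_def by blast
  have "\<exists>a. hom_rank (int p) (subtopology X S) {} a" for p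
  proof -
    have "hom_rank (int p + 1) X S (c (Suc p))" using c(1)[of "Suc p"] by (simp add: add.commute)
    then show ?thesis using rank_subspace[OF _ b(1)] by blast
  qed
  then obtain a where a: "\<And>p. hom_rank (int p) (subtopology X S) {} (a p)" by metis
  obtain x' y' where "has_chi (subtopology X S) {} x'" "has_chi X {} (x' + y')" "has_chi X S y'"
    by (rule chi_additive[OF a b(1) c(1), of "max n m"]) (use b(2) c(2) in auto)
  moreover have "x' + y' = x" "y' = y" using calculation assms has_chi_unique by blast+
  ultimately show ?thesis by auto
qed

lemma has_chi_rel:
  assumes "has_chi (subtopology X S) {} x" "has_chi X {} y" shows "has_chi X S (y - x)"
proof -
  interpret homology_pair X S .
  obtain a n where a: "\<And>p. hom_rank (int p) (subtopology X S) {} (a p)" "\<And>p. p \<ge> n \<Longrightarrow> a p = 0"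
    using assms(1) unfolding has_chi_def by blast
  obtain b m where b: "\<And>p. hom_rank (int p) X {} (b p)" "\<And>p. p \<ge> m \<Longrightarrow> b p = 0"
    using assms(2) unfolding has_chi_def by blast
  have "\<exists>c. hom_rank (int p) X S c" for p
  proof (cases p)
    case 0
    \<comment> \<open>The boundary map from degree 0 lands in trivial homology, so the rank argument
      also applies at the end of the sequence.\<close>
    have "hom_rank (- 1) (subtopology X S) {} 0" by (intro has_rank_trivial_group) auto
    then have "hom_rank (int p - 1) (subtopology X S) {} 0" using 0 by simp
    then show ?thesis using rank_rel[OF b(1)] by blast
  next
    case (Suc q)
    then have "hom_rank (int p - 1) (subtopology X S) {} (a q)" using a(1)[of q] by simp
    then show ?thesis using rank_rel[OF b(1)] by blast
  qed
  then obtain c where c: "\<And>p. hom_rank (int p) X S (c p)" by metis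
  obtain x' y' where "has_chi (subtopology X S) {} x'" "has_chi X {} (x' + y')" "has_chi X S y'"
    by (rule chi_additive[OF a(1) b(1) c, of "max n m"]) (use a(2) b(2) in auto)
  moreover have "x' + y' = y" "x' = x" using calculation assms has_chi_unique by blast+
  ultimately show ?thesis by auto
qed

text \<open>The excised set is the complement of \<open>U\<close>: it is closed, and it lies in the
  open set \<open>V\<close> because \<open>U\<close> and \<open>V\<close> cover the space.\<close>

lemma has_chi_excision:
  assumes "openin X U" "openin X V" "U \<union> V = topspace X"
  shows "has_chi (subtopology X U) (U \<inter> V) x \<longleftrightarrow> has_chi X V x"
proof -
  have eq: "topspace X - (topspace X - U) = U" "V - (topspace X - U) = U \<inter> V"
    using openin_subset[OF assms(1)] openin_subset[OF assms(2)] by auto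
  have "X closure_of (topspace X - U) \<subseteq> X interior_of V"
    using assms by (simp add: closure_of_closedin closedin_diff interior_of_openin) blast
  then have "hom_induced p (subtopology X U) (U \<inter> V) (subtopology X (topspace X)) V id
    \<in> iso (relative_homology_group p (subtopology X U) (U \<inter> V))
        (relative_homology_group p (subtopology X (topspace X)) V)" for p
    using homology_excision_axiom[of X "topspace X - U" V "topspace X" p] openin_subset[OF assms(2)]
    unfolding eq by simp
  then have iso: "relative_homology_group p (subtopology X U) (U \<inter> V) \<cong> relative_homology_group p X V" for p
    by (auto simp: is_iso_def)
  moreover have "relative_homology_group p X V \<cong> relative_homology_group p (subtopology X U) (U \<inter> V)" for p
    using iso group.iso_sym group_relative_homology_group by blast
  ultimately show ?thesis using has_chi_iso by blast
qed

section \<open>Euler characteristics of subsets and Mayer-Vietoris\<close>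

abbreviation chi_set :: "'a :: topological_space set \<Rightarrow> int \<Rightarrow> bool" where
  "chi_set S x \<equiv> has_chi (top_of_set S) {} x"

text \<open>Excision identifies the relative term of the pair \<open>A \<union> B\<close>,
  \<open>B\<close> with that of the pair \<open>A\<close>, \<open>A \<inter> B\<close>, whose Euler
  characteristic is \<open>a - c\<close>.\<close>

lemma chi_set_Un:
  assumes "openin (top_of_set (A \<union> B)) A" "openin (top_of_set (A \<union> B)) B"
    and "chi_set A a" "chi_set B b" "chi_set (A \<inter> B) c"
  shows "chi_set (A \<union> B) (a + b - c)"
proof -
  let ?X = "top_of_set (A \<union> B)"
  have eq: "subtopology ?X A = top_of_set A" "subtopology ?X B = top_of_set B"
    "subtopology (top_of_set A) (A \<inter> B) = top_of_set (A \<inter> B)"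
    by (simp_all add: subtopology_subtopology Int_absorb1 Int_absorb2 inf_commute)
  have "has_chi (subtopology ?X A) (A \<inter> B) (a - c)"
    unfolding eq by (rule has_chi_rel) (use assms eq in auto)
  then have "has_chi ?X B (a - c)"
    using has_chi_excision[OF assms(1,2)] by simp
  then show ?thesis using has_chi_space[of ?X B b "a - c"] assms(4) eq by (simp add: algebra_simps)
qed

text \<open>The same relative term, solved for \<open>B\<close> instead of the union. Finiteness for
  \<open>B\<close> is part of the conclusion, as needed when a piece is removed from a known
  space.\<close>

lemma chi_set_Un_cancel:
  assumes "openin (top_of_set (A \<union> B)) A" "openin (top_of_set (A \<union> B)) B"
    and "chi_set A a" "chi_set (A \<union> B) x" "chi_set (A \<inter> B) c"
  shows "chi_set B (x - a + c)"
proof -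
  let ?X = "top_of_set (A \<union> B)"
  have eq: "subtopology ?X A = top_of_set A" "subtopology ?X B = top_of_set B"
    "subtopology (top_of_set A) (A \<inter> B) = top_of_set (A \<inter> B)"
    by (simp_all add: subtopology_subtopology Int_absorb1 Int_absorb2 inf_commute)
  have "has_chi (subtopology ?X A) (A \<inter> B) (a - c)"
    unfolding eq by (rule has_chi_rel) (use assms eq in auto)
  then have "has_chi ?X B (a - c)"
    using has_chi_excision[OF assms(1,2)] by simp
  then show ?thesis using has_chi_subspace[of ?X x B "a - c"] assms(4) eq by (simp add: algebra_simps)
qed

lemma chi_set_homotopy_eqv:
  assumes "S homotopy_eqv T" "chi_set T x" shows "chi_set S x"
  using assms homotopy_equivalent_space_imp_isomorphic_homology_groups has_chi_iso by blast

lemma chi_set_homeomorphic: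
  assumes "S homeomorphic T" "chi_set T x" shows "chi_set S x"
  using assms homeomorphic_imp_homotopy_eqv chi_set_homotopy_eqv by blast

lemma chi_set_empty: "chi_set {} 0"
proof -
  have "hom_rank (int p) (top_of_set {}) {} 0" for p
    by (intro has_rank_trivial_group trivial_homology_group_empty) auto
  then show ?thesis unfolding has_chi_def by (intro exI[of _ "\<lambda>_. 0"]) auto
qed

lemma chi_set_singleton: "chi_set {a} 1"
proof -
  have t: "topspace (top_of_set {a}) = {a}" by simp
  have "hom_rank (int p) (top_of_set {a}) {} (if p = 0 then 1 else 0)" for p
  proof (cases "p = 0")
    case True
    have "hom_rank 0 (top_of_set {a}) {} 1"
      by (rule has_rank_iso[OF homology_coefficients[OF t]])
        (use has_rank_integer_group in \<open>auto simp: abelian_integer_group\<close>)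
    then show ?thesis using True by simp
  next
    case False
    then show ?thesis using has_rank_trivial_group[OF homology_dimension_axiom[OF t, of "int p"]] by auto
  qed
  then show ?thesis unfolding has_chi_def
    by (intro exI[of _ "\<lambda>p. if p = 0 then 1 else 0"] exI[of _ 1]) auto
qed


section \<open>Removing a complex slice\<close>

lemma chi_set_contractible:
  fixes S :: "'a :: real_normed_vector set"
  assumes "contractible S" "S \<noteq> {}" shows "chi_set S 1"
proof -
  have "S homotopy_eqv {0 :: real}"
    using assms by (intro homotopy_eqv_contractible_sets) auto
  then show ?thesis using chi_set_singleton chi_set_homotopy_eqv by blast
qed

lemma chi_set_open_Un:
  assumes "openin (top_of_set Z) A" "openin (top_of_set Z) B"
    and "chi_set A a" "chi_set B b" "chi_set (A \<inter> B) c"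
  shows "chi_set (A \<union> B) (a + b - c)"
proof -
  have "A \<union> B \<subseteq> Z" using assms openin_imp_subset by blast
  then show ?thesis using assms openin_subset_trans by (intro chi_set_Un) blast+
qed

text \<open>Each fibre of \<open>W\<close> is star-shaped about the section \<open>s\<close>, so a
  straight-line homotopy along the fibres deforms \<open>W\<close> to the graph of
  \<open>s\<close>.\<close>

lemma homotopy_eqv_fibrewise:
  fixes W :: "('a :: real_normed_vector \<times> 'b :: real_normed_vector) set"
  assumes s: "continuous_on X s" "\<And>x. x \<in> X \<Longrightarrow> (x, s x) \<in> W"
    and W: "\<And>x y. (x, y) \<in> W \<Longrightarrow> x \<in> X"
      "\<And>x y z. (x, y) \<in> W \<Longrightarrow> z \<in> closed_segment y (s x) \<Longrightarrow> (x, z) \<in> W"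
  shows "W homotopy_eqv X"
proof -
  have f: "continuous_map (top_of_set W) (top_of_set X) fst"
    using W(1) by (auto intro!: continuous_intros)
  have g: "continuous_map (top_of_set X) (top_of_set W) (\<lambda>x. (x, s x))"
    using s by (auto intro!: continuous_intros)
  have "homotopic_with_canon (\<lambda>z. True) W W ((\<lambda>x. (x, s x)) \<circ> fst) id"
  proof (rule homotopic_with_linear)
    show "continuous_on W ((\<lambda>x. (x, s x)) \<circ> fst)"
      unfolding comp_def using W(1)
      by (intro continuous_intros continuous_on_compose2[OF s(1)]) auto
    show "continuous_on W id" by (rule continuous_on_id')
    fix p assume p: "p \<in> W"
    obtain x y where xy: "p = (x, y)" by (cases p)
    show "closed_segment (((\<lambda>x. (x, s x)) \<circ> fst) p) (id p) \<subseteq> W"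
    proof
      fix q assume "q \<in> closed_segment (((\<lambda>x. (x, s x)) \<circ> fst) p) (id p)"
      then obtain u where u: "0 \<le> u" "u \<le> 1" "q = (1 - u) *\<^sub>R (x, s x) + u *\<^sub>R (x, y)"
        by (auto simp: closed_segment_def xy)
      then have "q = (x, (1 - u) *\<^sub>R s x + u *\<^sub>R y)" by (simp add: algebra_simps)
      moreover have "(1 - u) *\<^sub>R s x + u *\<^sub>R y \<in> closed_segment (s x) y"
        using u unfolding closed_segment_def by blast
      ultimately show "q \<in> W" using W(2)[of x y] p by (simp add: xy closed_segment_commute)
    qed
  qed
  moreover have "homotopic_with_canon (\<lambda>z. True) X X (fst \<circ> (\<lambda>x. (x, s x))) id"
    by (simp add: comp_def homotopic_with_refl flip: id_def)
  ultimately show ?thesis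
    unfolding homotopy_equivalent_space_def using f g by blast
qed

text \<open>The radius varies with the base point, since an open set around the slice need not
  contain a tube of constant radius. \<open>K\<close> restricts the offset from the slice, which
  treats full tubes, punctured tubes, half planes and quadrants alike.\<close>

definition tube :: "'a set \<Rightarrow> ('a \<Rightarrow> real) \<Rightarrow> complex \<Rightarrow> complex set \<Rightarrow> ('a \<times> complex) set" where
  "tube X \<epsilon> p K = {(x, y). x \<in> X \<and> norm (y - p) < \<epsilon> x \<and> y - p \<in> K}"

lemma tube_Un: "tube X \<epsilon> p (K \<union> L) = tube X \<epsilon> p K \<union> tube X \<epsilon> p L"
  and tube_Int: "tube X \<epsilon> p (K \<inter> L) = tube X \<epsilon> p K \<inter> tube X \<epsilon> p L"
  and tube_empty: "tube X \<epsilon> p {} = {}"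
  by (auto simp: tube_def)

locale tube_nbhd =
  fixes X :: "'a :: real_normed_vector set" and \<epsilon> :: "'a \<Rightarrow> real" and p :: complex and c :: int
  assumes continuous: "continuous_on X \<epsilon>" and pos: "\<And>x. x \<in> X \<Longrightarrow> \<epsilon> x > 0" and chi: "chi_set X c"
begin

lemma openin_tube: "open K \<Longrightarrow> openin (top_of_set (tube X \<epsilon> p UNIV)) (tube X \<epsilon> p K)"
proof -
  assume K: "open K"
  have "open ((\<lambda>z :: 'a \<times> complex. snd z - p) -` K)"
    using K by (intro open_vimage) (auto intro!: continuous_intros)
  moreover have "tube X \<epsilon> p K = tube X \<epsilon> p UNIV \<inter> (\<lambda>z. snd z - p) -` K"
    by (auto simp: tube_def)
  ultimately show ?thesis by (metis openin_open_Int)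
qed

lemma chi_tube_Un:
  assumes "open K" "open L" "chi_set (tube X \<epsilon> p K) k" "chi_set (tube X \<epsilon> p L) l"
    "chi_set (tube X \<epsilon> p (K \<inter> L)) m"
  shows "chi_set (tube X \<epsilon> p (K \<union> L)) (k + l - m)"
  using assms openin_tube unfolding tube_Un tube_Int by (intro chi_set_open_Un) auto

lemma chi_tube_disjoint_Un:
  assumes "open K" "open L" "K \<inter> L = {}" "chi_set (tube X \<epsilon> p K) k" "chi_set (tube X \<epsilon> p L) l"
  shows "chi_set (tube X \<epsilon> p (K \<union> L)) (k + l)"
  using chi_tube_Un[OF assms(1,2,4,5), of 0] assms(3) chi_set_empty by (simp add: tube_empty)

text \<open>Small multiples of the direction \<open>e\<close> form a section of the tube, and the
  convex fibres are star-shaped about it.\<close>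

lemma chi_tube_convex:
  assumes K: "convex K" "\<And>t :: real. 0 < t \<Longrightarrow> t *\<^sub>R e \<in> K" and e: "norm e \<le> 2"
  shows "chi_set (tube X \<epsilon> p K) c"
proof -
  \<comment> \<open>With \<open>norm e\<close> at most 2, a bound that admits the diagonal
    directions such as \<open>1 + \<i>\<close>, the factor 1/3 keeps the section inside the
    disc.\<close>
  define s where "s x = p + (\<epsilon> x / 3) *\<^sub>R e" for x
  have s: "norm (s x - p) < \<epsilon> x" "s x - p \<in> K" if "x \<in> X" for x
  proof -
    have "norm (s x - p) = \<epsilon> x / 3 * norm e" using pos[OF that] by (simp add: s_def)
    also have "\<dots> \<le> \<epsilon> x / 3 * 2" using pos[OF that] e by (intro mult_left_mono) auto
    also have "\<dots> < \<epsilon> x" using pos[OF that] by simp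
    finally show "norm (s x - p) < \<epsilon> x" .
    show "s x - p \<in> K" using K(2)[of "\<epsilon> x / 3"] pos[OF that] by (simp add: s_def)
  qed
  have "tube X \<epsilon> p K homotopy_eqv X"
  proof (rule homotopy_eqv_fibrewise)
    show "continuous_on X s" unfolding s_def by (intro continuous_intros continuous) auto
    fix x y z assume xy: "(x, y) \<in> tube X \<epsilon> p K" and z: "z \<in> closed_segment y (s x)"
    then have x: "x \<in> X" by (simp add: tube_def)
    have "convex (ball p (\<epsilon> x) \<inter> (+) p ` K)"
      using K(1) by (intro convex_Int convex_ball) (simp add: convex_translation)
    moreover have "y \<in> ball p (\<epsilon> x) \<inter> (+) p ` K" "s x \<in> ball p (\<epsilon> x) \<inter> (+) p ` K"
      using xy s[OF x] by (auto simp: tube_def dist_norm norm_minus_commute image_iff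
          intro: bexI[of _ "y - p"] bexI[of _ "s x - p"])
    ultimately have "z \<in> ball p (\<epsilon> x) \<inter> (+) p ` K"
      using z closed_segment_subset[of y _ "s x"] by (meson subsetD)
    then show "(x, z) \<in> tube X \<epsilon> p K"
      using x by (auto simp: tube_def dist_norm norm_minus_commute)
  qed (use s in \<open>auto simp: tube_def\<close>)
  then show ?thesis using chi chi_set_homotopy_eqv by blast
qed

lemma chi_tube: "chi_set (tube X \<epsilon> p UNIV) c"
  by (rule chi_tube_convex[of UNIV 0]) auto

text \<open>The four half-plane pieces \<open>R\<close>, \<open>L\<close>, \<open>U\<close>, \<open>D\<close> and the four quadrants all have Euler
  characteristic \<open>c\<close>, so Mayer-Vietoris gives \<open>2c + 2c - 4c = 0\<close>.\<close>

lemma chi_punctured_tube: "chi_set (tube X \<epsilon> p (- {0})) 0"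
proof -
  define R L U D where RLUD: "R = {z. Re z > 0}" "L = {z. Re z < 0}" "U = {z. Im z > 0}" "D = {z. Im z < 0}"
  have conv: "convex R" "convex L" "convex U" "convex D"
    unfolding RLUD
    by (rule convex_halfspace_Re_gt convex_halfspace_Re_lt convex_halfspace_Im_gt convex_halfspace_Im_lt)+
  have op: "open R" "open L" "open U" "open D"
    unfolding RLUD
    by (rule open_halfspace_Re_gt open_halfspace_Re_lt open_halfspace_Im_gt open_halfspace_Im_lt)+
  have disj: "R \<inter> L = {}" "U \<inter> D = {}" by (auto simp: RLUD)
  have n1: "norm (1 + \<i>) \<le> 2" "norm (1 - \<i>) \<le> 2" "norm (- 1 + \<i>) \<le> 2" "norm (- 1 - \<i>) \<le> 2"
    by (rule order.trans[OF norm_triangle_ineq] order.trans[OF norm_triangle_ineq4]; simp)+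
  have "chi_set (tube X \<epsilon> p R) c" "chi_set (tube X \<epsilon> p L) c" "chi_set (tube X \<epsilon> p U) c" "chi_set (tube X \<epsilon> p D) c"
    by (rule chi_tube_convex[OF conv(1), of 1] chi_tube_convex[OF conv(2), of "-1"]
        chi_tube_convex[OF conv(3), of \<i>] chi_tube_convex[OF conv(4), of "-\<i>"]; simp add: RLUD)+
  then have half: "chi_set (tube X \<epsilon> p (R \<union> L)) (c + c)" "chi_set (tube X \<epsilon> p (U \<union> D)) (c + c)"
    using op disj by (simp_all only: chi_tube_disjoint_Un)
  have "chi_set (tube X \<epsilon> p (R \<inter> U)) c" "chi_set (tube X \<epsilon> p (R \<inter> D)) c"
    "chi_set (tube X \<epsilon> p (L \<inter> U)) c" "chi_set (tube X \<epsilon> p (L \<inter> D)) c"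
    by (rule chi_tube_convex[OF convex_Int[OF conv(1,3)] _ n1(1)]
          chi_tube_convex[OF convex_Int[OF conv(1,4)] _ n1(2)]
          chi_tube_convex[OF convex_Int[OF conv(2,3)] _ n1(3)]
          chi_tube_convex[OF convex_Int[OF conv(2,4)] _ n1(4)]; simp add: RLUD)+
  then have "chi_set (tube X \<epsilon> p ((R \<inter> U \<union> R \<inter> D) \<union> (L \<inter> U \<union> L \<inter> D))) ((c + c) + (c + c))"
    using op disj by (intro chi_tube_disjoint_Un open_Un open_Int; blast)
  moreover have "(R \<inter> U \<union> R \<inter> D) \<union> (L \<inter> U \<union> L \<inter> D) = (R \<union> L) \<inter> (U \<union> D)" by auto
  ultimately have quarter: "chi_set (tube X \<epsilon> p ((R \<union> L) \<inter> (U \<union> D))) ((c + c) + (c + c))" by simp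
  have "(R \<union> L) \<union> (U \<union> D) = - {0}" by (auto simp: RLUD complex_eq_iff)
  then show ?thesis
    using chi_tube_Un[OF _ _ half quarter] op by (simp add: open_Un)
qed

end

text \<open>The distance to the complement of \<open>M\<close> provides the radius of a tubular neighbourhood of the slice.\<close>

lemma chi_set_remove_slice:
  fixes M :: "('a :: real_normed_vector \<times> complex) set"
  assumes M: "open M" "chi_set M a" and H: "chi_set {x. (x, p) \<in> M} b"
  shows "chi_set (M - {z. snd z = p}) (a - b)"
proof -
  define X where "X = {x. (x, p) \<in> M}"
  \<comment> \<open>The distance to the empty set is 0 by convention, so the case
    \<open>M = UNIV\<close> gets a positive radius of its own.\<close>
  define \<epsilon> where "\<epsilon> x = (if M = UNIV then 1 else infdist (x, p) (- M))" for x
  have cont: "continuous_on A \<epsilon>" for A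
    by (cases "M = UNIV") (auto simp: \<epsilon>_def[abs_def] intro!: continuous_intros)
  have pos_iff: "\<epsilon> x > 0 \<longleftrightarrow> x \<in> X" for x
  proof (cases "M = UNIV")
    case False
    then have "(x, p) \<in> - M \<longleftrightarrow> infdist (x, p) (- M) = 0"
      using M(1) by (intro in_closed_iff_infdist_zero) (auto simp: closed_Compl)
    then show ?thesis using False infdist_nonneg[of "(x, p)" "- M"] by (auto simp: \<epsilon>_def X_def less_le)
  qed (auto simp: \<epsilon>_def X_def)
  interpret tube_nbhd X \<epsilon> p b
    using cont pos_iff H by unfold_locales (auto simp: X_def)
  have eq: "tube X \<epsilon> p UNIV = {z. norm (snd z - p) < \<epsilon> (fst z)}"
  proof -
    have "x \<in> X" if "norm (y - p) < \<epsilon> x" for x y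
      using pos_iff[of x] le_less_trans[OF norm_ge_zero that] by blast
    then show ?thesis by (auto simp: tube_def)
  qed
  have "open {z :: 'a \<times> complex. norm (snd z - p) < \<epsilon> (fst z)}"
    by (intro open_Collect_less continuous_intros continuous_on_compose2[OF cont[of UNIV]]) auto
  then have open_N: "open (tube X \<epsilon> p UNIV)" by (simp only: eq)
  have sub: "tube X \<epsilon> p UNIV \<subseteq> M"
  proof (clarsimp simp: eq, rule ccontr)
    fix x y assume xy: "norm (y - p) < \<epsilon> x" "(x, y) \<notin> M"
    then have "\<epsilon> x \<le> dist (x, p) (x, y)" by (auto simp: \<epsilon>_def intro: infdist_le)
    then show False using xy(1) by (simp add: dist_Pair_Pair dist_norm norm_minus_commute)
  qed
  let ?B = "M - {z. snd z = p}"
  have "open ?B"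
    using M(1) by (intro open_Diff closed_Collect_eq continuous_intros) auto
  have un: "tube X \<epsilon> p UNIV \<union> ?B = M" and int: "tube X \<epsilon> p UNIV \<inter> ?B = tube X \<epsilon> p (- {0})"
    using sub pos_iff by (auto simp: tube_def X_def)
  have "chi_set ?B (a - b + 0)"
    by (rule chi_set_Un_cancel[of "tube X \<epsilon> p UNIV"])
      (use un int open_N \<open>open ?B\<close> M chi_tube chi_punctured_tube sub in \<open>auto intro: open_subset\<close>)
  then show ?thesis by simp
qed

text \<open>Multiplying by a contractible factor turns the removal of a point into the removal of a slice.\<close>

lemma chi_set_Compl_finite:
  assumes "finite E" shows "chi_set (- E :: complex set) (1 - int (card E))"
proof -
  have "chi_set (UNIV \<times> (- E) :: (complex \<times> complex) set) (1 - int (card E))"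
    using assms
  proof induction
    case empty
    have "chi_set (UNIV :: (complex \<times> complex) set) 1"
      by (rule chi_set_contractible) (auto simp: convex_imp_contractible)
    then show ?case by simp
  next
    case (insert p E)
    have "chi_set (UNIV :: complex set) 1"
      by (rule chi_set_contractible) (auto simp: convex_imp_contractible)
    then have "chi_set {x :: complex. (x, p) \<in> UNIV \<times> (- E)} 1" using insert by simp
    moreover have "open (UNIV \<times> (- E) :: (complex \<times> complex) set)"
      using insert by (intro open_Times open_Compl finite_imp_closed) auto
    ultimately have "chi_set (UNIV \<times> (- E) - {z :: complex \<times> complex. snd z = p}) (1 - int (card E) - 1)"
      using chi_set_remove_slice insert by blast
    moreover have "UNIV \<times> (- E) - {z :: complex \<times> complex. snd z = p} = UNIV \<times> (- insert p E)" by auto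
    ultimately show ?case using insert by simp
  qed
  moreover have "(- E) \<times> (UNIV :: complex set) homotopy_eqv (- E)"
    by (rule homotopy_eqv_fibrewise[of _ "\<lambda>_. 0"]) auto
  moreover have "(- E) \<times> (UNIV :: complex set) homeomorphic (UNIV :: complex set) \<times> (- E)"
    unfolding homeomorphic_def homeomorphism_def
    by (rule exI[of _ prod.swap], rule exI[of _ prod.swap]) (simp add: product_swap continuous_on_swap)
  ultimately show ?thesis
    by (meson chi_set_homeomorphic chi_set_homotopy_eqv homotopy_equivalent_space_sym)
qed


section \<open>Complements of projective line arrangements\<close>

text \<open>Bilinear, not Hermitian: it identifies linear forms with vectors, so that
  \<open>cross\<close> produces both the line through two points and the intersection point of two
  lines.\<close>

definition pairing :: "complex^3 \<Rightarrow> complex^3 \<Rightarrow> complex" where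
  "pairing a v = a $ 1 * v $ 1 + a $ 2 * v $ 2 + a $ 3 * v $ 3"

definition cross :: "complex^3 \<Rightarrow> complex^3 \<Rightarrow> complex^3" where
  "cross a b = vector [a $ 2 * b $ 3 - a $ 3 * b $ 2, a $ 3 * b $ 1 - a $ 1 * b $ 3,
     a $ 1 * b $ 2 - a $ 2 * b $ 1]"

definition line_of :: "complex^3 \<Rightarrow> cp2 set" where
  "line_of a = {q. pairing a (vec_of q) = 0}"

lemma cross_component: "cross a b $ 1 = a $ 2 * b $ 3 - a $ 3 * b $ 2"
  "cross a b $ 2 = a $ 3 * b $ 1 - a $ 1 * b $ 3" "cross a b $ 3 = a $ 1 * b $ 2 - a $ 2 * b $ 1"
  by (simp_all add: cross_def)

lemma nonzero_component: "(v :: complex^3) \<noteq> 0 \<longleftrightarrow> (\<exists>k. v $ k \<noteq> 0)"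
  by (auto simp: vec_eq_iff)

text \<open>The triple product formula. A vector annihilated by both \<open>a\<close> and
  \<open>b\<close> has zero cross product with \<open>cross a b\<close> and is therefore
  proportional to it if that vector is nonzero, which makes two distinct lines meet in a single
  point.\<close>

lemma cross_cross: "cross v (cross a b) = pairing b v *s a - pairing a v *s b"
  by (simp add: vec_eq_iff forall_3 cross_component pairing_def algebra_simps)

lemma pairing_cross_self: "pairing a (cross a b) = 0" "pairing b (cross a b) = 0"
  "pairing (cross a b) a = 0" "pairing (cross a b) b = 0"
  by (simp_all add: cross_component pairing_def algebra_simps)

lemma pairing_linear: "pairing a (v + w) = pairing a v + pairing a w"
  "pairing a (v - w) = pairing a v - pairing a w" "pairing a (c *s v) = c * pairing a v"
  "pairing (c *s a) v = c * pairing a v"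
  by (simp_all add: pairing_def algebra_simps)

lemma pairing_zero [simp]: "pairing a 0 = 0"
  by (simp add: pairing_def)

lemma continuous_on_pairing [continuous_intros]:
  "continuous_on S f \<Longrightarrow> continuous_on S (\<lambda>x. pairing a (f x))"
  unfolding pairing_def by (intro continuous_intros)

lemma cross_eq_0_imp:
  assumes "cross v n = 0" "n \<noteq> 0" obtains c where "v = c *s n"
proof -
  obtain k where k: "n $ k \<noteq> 0" using assms(2) by (auto simp: nonzero_component)
  have "v $ 2 * n $ 3 = v $ 3 * n $ 2" "v $ 3 * n $ 1 = v $ 1 * n $ 3" "v $ 1 * n $ 2 = v $ 2 * n $ 1"
    using assms(1) by (simp_all add: vec_eq_iff forall_3 cross_component)
  then have "\<forall>j. v $ j * n $ k = v $ k * n $ j"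
    using exhaust_3[of k] by (auto simp: forall_3)
  then have "v = (v $ k / n $ k) *s n" using k by (simp add: vec_eq_iff field_simps)
  then show thesis by (rule that)
qed

lemma vectors_cp2_of:
  assumes "v \<noteq> 0" shows "vectors (cp2_of v) = vec.span {v}"
proof -
  have "vec.dim (vec.span {v}) = 1"
    using assms vec.dim_span_eq_card_independent[of "{v}"] by simp
  then show ?thesis by (simp add: cp2_of_def Abs_cp2_inverse vec.subspace_span)
qed

lemma cp2_of_vec_of: "cp2_of (vec_of q) = q"
  using vec_of[of q] vectors_cp2_of by (simp flip: vectors_inject)

lemma vec_of_cp2_of:
  assumes "v \<noteq> 0" obtains c where "c \<noteq> 0" "vec_of (cp2_of v) = c *s v"
proof -
  have "vec_of (cp2_of v) \<in> vec.span {v}"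
    using vec_of(2)[of "cp2_of v"] vectors_cp2_of[OF assms] by (metis insertI1 vec.span_base)
  then obtain c where "vec_of (cp2_of v) = c *s v" by (auto simp: vec.span_singleton)
  then show thesis using that vec_of(1)[of "cp2_of v"] by fastforce
qed

lemma cp2_of_scale: "c \<noteq> 0 \<Longrightarrow> v \<noteq> 0 \<Longrightarrow> cp2_of (c *s v) = cp2_of v"
proof -
  assume c: "c \<noteq> 0" and v: "v \<noteq> 0"
  have cv: "c *s v \<noteq> 0" using c v by simp
  have "v = inverse c *s (c *s v)" using c by simp
  then have "v \<in> vec.span {c *s v}" by (metis insertI1 vec.span_base vec.span_scale)
  then have "vec.span {c *s v} = vec.span {v}"
    by (intro antisym vec.span_minimal vec.subspace_span)
      (auto intro: vec.span_scale vec.span_base)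
  then show ?thesis using vectors_cp2_of[OF v] vectors_cp2_of[OF cv] by (simp flip: vectors_inject)
qed

lemma cp2_of_in_line: "v \<noteq> 0 \<Longrightarrow> cp2_of v \<in> line_of a \<longleftrightarrow> pairing a v = 0"
  by (rule vec_of_cp2_of[of v]) (auto simp: line_of_def pairing_linear)

lemma cp2_of_notin_line: "v \<noteq> 0 \<and> cp2_of v \<notin> line_of a \<longleftrightarrow> pairing a v \<noteq> 0"
  by (cases "v = 0") (auto simp: cp2_of_in_line)

lemma line_Int:
  assumes "cross a b \<noteq> 0" shows "line_of a \<inter> line_of b = {cp2_of (cross a b)}"
proof
  show "{cp2_of (cross a b)} \<subseteq> line_of a \<inter> line_of b"
    using assms by (simp add: cp2_of_in_line pairing_cross_self)
  show "line_of a \<inter> line_of b \<subseteq> {cp2_of (cross a b)}"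
  proof
    fix q assume "q \<in> line_of a \<inter> line_of b"
    then have "cross (vec_of q) (cross a b) = 0" by (simp add: cross_cross line_of_def)
    then obtain c where c: "vec_of q = c *s cross a b" using cross_eq_0_imp assms by blast
    then have "c \<noteq> 0" using vec_of(1)[of q] by auto
    then show "q \<in> {cp2_of (cross a b)}"
      using cp2_of_scale[OF _ assms] c cp2_of_vec_of[of q] by simp
  qed
qed

lemma cross_nonzero:
  assumes "a \<noteq> 0" "b \<noteq> 0" "line_of a \<noteq> line_of b" shows "cross a b \<noteq> 0"
proof
  assume "cross a b = 0"
  then obtain c where c: "a = c *s b" using cross_eq_0_imp assms by blast
  then have "c \<noteq> 0" using assms by auto
  then have "line_of a = line_of b" by (simp add: line_of_def c pairing_linear)
  then show False using assms by simp
qed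

lemma open_Compl_line: "open (- line_of a)"
proof -
  have "{v. v \<noteq> 0 \<and> cp2_of v \<in> - line_of a} = {v. pairing a v \<noteq> 0}"
    by (simp add: cp2_of_notin_line)
  then show ?thesis
    unfolding open_cp2_def by (auto intro!: open_Collect_neq continuous_intros)
qed

text \<open>An affine chart with \<open>line_of a\<close> at infinity and \<open>line_of b\<close> as the first coordinate axis.\<close>

lemma affine_chart:
  assumes n: "cross a b \<noteq> 0"
  obtains \<kappa> \<phi> where "homeomorphism (- line_of a) (UNIV :: (complex \<times> complex) set) \<kappa> \<phi>"
    "\<And>z. \<phi> z \<in> line_of b \<longleftrightarrow> snd z = 0"
proof -
  let ?n = "cross a b"
  obtain k where k: "?n $ k \<noteq> 0" using n by (auto simp: nonzero_component)
  define e :: "complex^3" where "e = axis k 1"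
  \<comment> \<open>Up to the factor \<open>?n $ k\<close>, the three vectors are the basis dual to
    \<open>e\<close>, \<open>b\<close>, \<open>a\<close>. The fixed coordinate 1 along the last one
    keeps \<open>w z\<close> off \<open>line_of a\<close>.\<close>
  define w where "w z = fst z *s ?n + snd z *s cross e a + cross b e" for z
  have e: "pairing b (cross e a) = ?n $ k" "pairing a (cross b e) = ?n $ k" "cross e a $ k = 0" "cross b e $ k = 0"
    using exhaust_3[of k] by (auto simp: e_def axis_def pairing_def cross_component)
  have id: "?n $ k *s u = u $ k *s ?n + pairing b u *s cross e a + pairing a u *s cross b e" for u
    using exhaust_3[of k]
    by (auto simp: e_def axis_def pairing_def cross_component vec_eq_iff forall_3 algebra_simps)
  have w: "w z $ k = fst z * ?n $ k" "pairing b (w z) = snd z * ?n $ k" "pairing a (w z) = ?n $ k" for z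
    by (simp_all add: w_def pairing_linear pairing_cross_self e)
  have w0: "w z \<noteq> 0" for z using w(3)[of z] k by (auto simp: pairing_def)
  have cont_w: "continuous_on UNIV w"
    unfolding w_def vector_scalar_mult_def by (intro continuous_intros)
  define \<phi> where "\<phi> z = cp2_of (w z)" for z
  define coord where "coord v = (v $ k / pairing a v, pairing b v / pairing a v)" for v
  define \<kappa> where "\<kappa> q = coord (vec_of q)" for q
  have coord_scale: "c \<noteq> 0 \<Longrightarrow> coord (c *s v) = coord v" for c v
    by (simp add: coord_def pairing_linear)
  have \<kappa>: "\<kappa> (cp2_of v) = coord v" if "v \<noteq> 0" for v
    using vec_of_cp2_of[OF that] coord_scale by (metis \<kappa>_def)
  have "continuous_on UNIV \<phi>"
    unfolding continuous_on_open_vimage[OF open_UNIV]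
  proof (intro allI impI)
    fix U :: "cp2 set" assume "open U"
    then have "open (w -` {v. v \<noteq> 0 \<and> cp2_of v \<in> U})"
      using cont_w open_vimage unfolding open_cp2_def by blast
    moreover have "w -` {v. v \<noteq> 0 \<and> cp2_of v \<in> U} = \<phi> -` U \<inter> UNIV"
      using w0 by (auto simp: \<phi>_def)
    ultimately show "open (\<phi> -` U \<inter> UNIV)" by simp
  qed
  moreover have "continuous_on (- line_of a) \<kappa>"
    unfolding continuous_on_open_vimage[OF open_Compl_line]
  proof (intro allI impI)
    fix V :: "(complex \<times> complex) set" assume "open V"
    let ?D = "{v. pairing a v \<noteq> 0}"
    have D: "open ?D" by (auto intro!: open_Collect_neq continuous_intros)
    have "continuous_on ?D coord"
      unfolding coord_def by (intro continuous_intros) auto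
    then have "open (coord -` V \<inter> ?D)"
      using \<open>open V\<close> continuous_on_open_vimage[OF D] by blast
    moreover have "{v. v \<noteq> 0 \<and> cp2_of v \<in> \<kappa> -` V \<inter> - line_of a} = coord -` V \<inter> ?D"
    proof (rule Set.set_eqI)
      fix v
      show "v \<in> {v. v \<noteq> 0 \<and> cp2_of v \<in> \<kappa> -` V \<inter> - line_of a} \<longleftrightarrow> v \<in> coord -` V \<inter> ?D"
        using \<kappa>[of v] cp2_of_notin_line[of v a] by auto
    qed
    ultimately show "open (\<kappa> -` V \<inter> - line_of a)" unfolding open_cp2_def by simp
  qed
  moreover have "\<kappa> (\<phi> z) = z" for z
    using \<kappa>[OF w0] k by (simp add: \<phi>_def coord_def w)
  moreover have \<phi>_line: "\<phi> z \<in> line_of c \<longleftrightarrow> pairing c (w z) = 0" for c z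
    using w0 by (simp add: \<phi>_def cp2_of_in_line)
  then have "\<phi> z \<in> - line_of a" for z using k by (simp add: w)
  moreover have "\<phi> (\<kappa> q) = q" if "q \<in> - line_of a" for q
  proof -
    let ?u = "vec_of q"
    have au: "pairing a ?u \<noteq> 0" using that by (simp add: line_of_def)
    have "w (\<kappa> q) = inverse (pairing a ?u) *s (?n $ k *s ?u)"
      using au unfolding id w_def \<kappa>_def coord_def
      by (simp add: vec_eq_iff field_simps)
    also have "\<dots> = (inverse (pairing a ?u) * ?n $ k) *s ?u" by simp
    finally show ?thesis
      using cp2_of_scale[of "inverse (pairing a ?u) * ?n $ k" ?u] au k vec_of(1)[of q]
      by (simp add: \<phi>_def cp2_of_vec_of)
  qed
  ultimately have "homeomorphism (- line_of a) (UNIV :: (complex \<times> complex) set) \<kappa> \<phi>"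
    by (intro homeomorphismI) auto
  moreover have "\<phi> z \<in> line_of b \<longleftrightarrow> snd z = 0" for z
    using \<phi>_line k by (simp add: w)
  ultimately show thesis by (rule that)
qed

section \<open>Projective lines and the Euler characteristic of their complement\<close>

definition is_proj_line :: "cp2 set \<Rightarrow> bool" where
  "is_proj_line H \<longleftrightarrow> (\<exists>a. a \<noteq> 0 \<and> H = line_of a)"

lemma is_proj_line_Int:
  assumes "is_proj_line A" "is_proj_line B" "A \<noteq> B" obtains q where "A \<inter> B = {q}"
  using assms line_Int cross_nonzero unfolding is_proj_line_def by metis

lemma closed_is_proj_line: "is_proj_line A \<Longrightarrow> closed A"
  using open_Compl_line by (auto simp: is_proj_line_def closed_def)

lemma is_proj_line_chart:
  assumes "is_proj_line A" "is_proj_line B" "A \<noteq> B"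
  obtains \<kappa> \<phi> where "homeomorphism (- A) (UNIV :: (complex \<times> complex) set) \<kappa> \<phi>"
    "\<And>z. \<phi> z \<in> B \<longleftrightarrow> snd z = 0"
proof -
  obtain a b where "A = line_of a" "B = line_of b" "cross a b \<noteq> 0"
    using assms cross_nonzero unfolding is_proj_line_def by metis
  then show thesis using affine_chart that by metis
qed

lemma chi_set_Compl_line:
  assumes "is_proj_line A" shows "chi_set (- A) 1"
proof -
  obtain a where a: "a \<noteq> 0" "A = line_of a" using assms by (auto simp: is_proj_line_def)
  obtain k where k: "a $ k \<noteq> 0" using a(1) by (auto simp: nonzero_component)
  \<comment> \<open>The chart needs some second line. As \<open>a $ k\<close> is nonzero,
    \<open>a\<close> is no multiple of the next unit vector, where the index is cyclic in the type
    \<open>3\<close>.\<close>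
  have "cross a (axis (k + 1) 1) \<noteq> 0"
    using k exhaust_3[of k] by (auto simp: vec_eq_iff forall_3 cross_component axis_def)
  then obtain \<kappa> \<phi> where "homeomorphism (- A) (UNIV :: (complex \<times> complex) set) \<kappa> \<phi>"
    using affine_chart a(2) by blast
  then have "- A homeomorphic (UNIV :: (complex \<times> complex) set)" unfolding homeomorphic_def by blast
  moreover have "chi_set (UNIV :: (complex \<times> complex) set) 1"
    by (rule chi_set_contractible) (auto simp: convex_imp_contractible)
  ultimately show ?thesis by (rule chi_set_homeomorphic)
qed

text \<open>With \<open>A\<close> at infinity, \<open>B\<close> becomes a coordinate slice that
  meets the other lines in the affine points \<open>E\<close>, so a set of Euler characteristic
  \<open>1 - card E\<close> is removed. The point of \<open>A \<inter> B\<close> at infinity also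
  lies in \<open>B \<inter> \<Union>L\<close>, which turns this into
  \<open>2 - card (B \<inter> \<Union>L)\<close>.\<close>

lemma chi_set_remove_line:
  assumes L: "finite L" "\<And>H. H \<in> L \<Longrightarrow> is_proj_line H" "A \<in> L" and B: "is_proj_line B" "B \<notin> L"
    and x: "chi_set (- \<Union>L) x"
  shows "chi_set (- \<Union>(insert B L)) (x - 2 + int (card (B \<inter> \<Union>L)))" "finite (B \<inter> \<Union>L)"
proof -
  have AB: "is_proj_line A" "A \<noteq> B" using assms by auto
  have "finite (B \<inter> H)" if "H \<in> L" for H
    using is_proj_line_Int[OF B(1) L(2)[OF that]] B(2) that by (metis finite.emptyI finite_insert)
  moreover have "B \<inter> \<Union>L = (\<Union>H\<in>L. B \<inter> H)" by auto
  ultimately show fin: "finite (B \<inter> \<Union>L)" using L(1) by (simp only: finite_UN_I)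
  obtain q0 where q0: "A \<inter> B = {q0}" using is_proj_line_Int[OF AB(1) B(1) AB(2)] by blast
  obtain \<kappa> \<phi> where h: "homeomorphism (- A) (UNIV :: (complex \<times> complex) set) \<kappa> \<phi>"
    and line: "\<And>z. \<phi> z \<in> B \<longleftrightarrow> snd z = 0"
    using is_proj_line_chart[OF AB(1) B(1) AB(2)] by blast
  have \<kappa>\<phi>: "\<kappa> (\<phi> z) = z" and \<phi>A: "\<phi> z \<notin> A" for z
    using h unfolding homeomorphism_def by blast+
  have \<phi>\<kappa>: "\<phi> (\<kappa> q) = q" if "q \<notin> A" for q
    using h that unfolding homeomorphism_def by blast
  have hom: "F homeomorphic \<phi> -` F" if "F \<subseteq> - A" for F
  proof -
    have "\<kappa> ` F = \<phi> -` F"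
    proof (intro Set.set_eqI iffI)
      fix z assume "z \<in> \<phi> -` F"
      then show "z \<in> \<kappa> ` F" using \<kappa>\<phi>[of z] by (metis image_eqI vimageE)
    qed (use that \<phi>\<kappa> in auto)
    from homeomorphism_of_subsets[OF h that subset_UNIV this] show ?thesis
      unfolding homeomorphic_def by (intro exI)
  qed
  define M where "M = \<phi> -` (- \<Union>L)"
  define E where "E = {t. \<phi> (t, 0) \<in> \<Union>L}"
  have sub: "- \<Union>L \<subseteq> - A" "- \<Union>(insert B L) \<subseteq> - A" using L(3) by auto
  have "chi_set M x"
    using chi_set_homeomorphic[OF homeomorphic_sym[THEN iffD1, OF hom[OF sub(1)]] x] by (simp add: M_def)
  moreover have "open M"
    unfolding M_def using h L closed_is_proj_line
    by (intro open_vimage open_Compl closed_Union) (auto simp: homeomorphism_def)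
  moreover have E: "B \<inter> \<Union>L = insert q0 ((\<lambda>t. \<phi> (t, 0)) ` E)"
  proof (intro subset_antisym subsetI)
    fix q assume q: "q \<in> B \<inter> \<Union>L"
    show "q \<in> insert q0 ((\<lambda>t. \<phi> (t, 0)) ` E)"
    proof (cases "q \<in> A")
      case True
      then show ?thesis using q q0 by auto
    next
      case False
      then have "snd (\<kappa> q) = 0" using line[of "\<kappa> q"] \<phi>\<kappa> q by auto
      then have "q = \<phi> (fst (\<kappa> q), 0)" using \<phi>\<kappa>[OF False] by (metis prod.collapse)
      then show ?thesis using q by (auto simp: E_def intro!: image_eqI[of _ _ "fst (\<kappa> q)"])
    qed
  next
    fix q assume "q \<in> insert q0 ((\<lambda>t. \<phi> (t, 0)) ` E)"
    then show "q \<in> B \<inter> \<Union>L" using q0 L(3) line by (auto simp: E_def)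
  qed
  have inj: "inj_on (\<lambda>t. \<phi> (t, 0)) E" by (rule inj_onI) (metis \<kappa>\<phi> prod.inject)
  have finE: "finite E" using fin inj by (simp add: E finite_image_iff)
  have q0E: "q0 \<notin> (\<lambda>t. \<phi> (t, 0)) ` E" using \<phi>A q0 by auto
  have card: "card (B \<inter> \<Union>L) = card E + 1"
    unfolding E using finE q0E by (simp add: card_image[OF inj])
  have "{t. (t, 0) \<in> M} = - E" by (auto simp: M_def E_def)
  then have "chi_set {t. (t, 0) \<in> M} (1 - int (card E))" using chi_set_Compl_finite[OF finE] by simp
  ultimately have "chi_set (M - {z. snd z = 0}) (x - (1 - int (card E)))"
    by (intro chi_set_remove_slice)
  moreover have "M - {z. snd z = 0} = \<phi> -` (- \<Union>(insert B L))"
    using line by (auto simp: M_def)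
  ultimately show "chi_set (- \<Union>(insert B L)) (x - 2 + int (card (B \<inter> \<Union>L)))"
    using chi_set_homeomorphic[OF hom[OF sub(2)]] by (simp add: card algebra_simps)
qed

text \<open>A new line raises the multiplicity minus one exactly at the points where it meets an
  earlier line. Truncated subtraction gives 0 at points on at most one line, so \<open>R\<close> may
  be any finite set containing all intersection points.\<close>

theorem chi_set_line_arrangement:
  assumes "finite L" "L \<noteq> {}" "\<And>H. H \<in> L \<Longrightarrow> is_proj_line H"
    and R: "finite R" "\<And>H H'. H \<in> L \<Longrightarrow> H' \<in> L \<Longrightarrow> H \<noteq> H' \<Longrightarrow> H \<inter> H' \<subseteq> R"
  shows "chi_set (- \<Union>L) (3 - 2 * int (card L) + (\<Sum>q\<in>R. int (card {H \<in> L. q \<in> H} - 1)))"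
  using assms(1-3) R(2)
proof (induction rule: finite_ne_induct)
  case (singleton A)
  have "card {H \<in> {A}. q \<in> H} - 1 = 0" for q
    using card_mono[of "{A}" "{H \<in> {A}. q \<in> H}"] by auto
  then show ?case using chi_set_Compl_line singleton by simp
next
  case (insert B L)
  let ?x = "3 - 2 * int (card L) + (\<Sum>q\<in>R. int (card {H \<in> L. q \<in> H} - 1))"
  obtain A where A: "A \<in> L" using insert.hyps by blast
  have x: "chi_set (- \<Union>L) ?x" by (rule insert.IH) (simp_all add: insert.prems)
  have sub: "B \<inter> \<Union>L \<subseteq> R"
  proof
    fix q assume "q \<in> B \<inter> \<Union>L"
    then obtain H where H: "H \<in> L" "q \<in> B \<inter> H" by blast
    then have "B \<noteq> H" using insert.hyps by blast
    then show "q \<in> R" using insert.prems(2)[of B H] H by blast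
  qed
  have "int (card {H \<in> insert B L. q \<in> H} - 1) = int (card {H \<in> L. q \<in> H} - 1) + (if q \<in> B \<inter> \<Union>L then 1 else 0)" for q
  proof (cases "q \<in> B")
    case True
    then have "{H \<in> insert B L. q \<in> H} = insert B {H \<in> L. q \<in> H}" by auto
    then have 1: "card {H \<in> insert B L. q \<in> H} = Suc (card {H \<in> L. q \<in> H})" using insert.hyps by simp
    have "q \<in> \<Union>L \<longleftrightarrow> card {H \<in> L. q \<in> H} \<noteq> 0" using insert.hyps by auto
    then show ?thesis using 1 True by auto
  next
    case False
    then have "{H \<in> insert B L. q \<in> H} = {H \<in> L. q \<in> H}" by auto
    then show ?thesis using False by simp
  qed
  moreover have "(\<Sum>q\<in>R. if q \<in> B \<inter> \<Union>L then 1 else 0 :: int) = int (card (B \<inter> \<Union>L))"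
  proof -
    have "(\<Sum>q\<in>R. if q \<in> B \<inter> \<Union>L then 1 else 0 :: int) = sum (\<lambda>_. 1) (R \<inter> (B \<inter> \<Union>L))"
      by (rule sum.inter_restrict[OF R(1), symmetric])
    also have "\<dots> = int (card (B \<inter> \<Union>L))" unfolding Int_absorb1[OF sub] by simp
    finally show ?thesis .
  qed
  ultimately have eq: "3 - 2 * int (card (insert B L)) + (\<Sum>q\<in>R. int (card {H \<in> insert B L. q \<in> H} - 1))
      = ?x - 2 + int (card (B \<inter> \<Union>L))"
    using insert.hyps by (simp add: sum.distrib)
  show ?case
    unfolding eq by (rule chi_set_remove_line(1)[OF insert.hyps(1) _ A _ _ x])
      (simp_all add: insert.prems insert.hyps)
qed


section \<open>Configurations with prescribed concurrences\<close>

text \<open>A substitute for polynomials in several variables: the restriction to every line is a polynomial.\<close>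

definition poly_on_lines :: "((nat \<Rightarrow> complex) \<Rightarrow> complex) \<Rightarrow> bool" where
  "poly_on_lines f \<longleftrightarrow> (\<forall>x y. \<exists>p. \<forall>t. f (\<lambda>i. x i + t * y i) = poly p t)"

lemma poly_on_lines_const: "poly_on_lines (\<lambda>s. a)"
  unfolding poly_on_lines_def by (intro allI exI[of _ "[:a:]"]) simp

lemma poly_on_lines_coord: "poly_on_lines (\<lambda>s. s i)"
  unfolding poly_on_lines_def
proof (intro allI)
  fix x y :: "nat \<Rightarrow> complex"
  show "\<exists>p. \<forall>t. x i + t * y i = poly p t" by (rule exI[of _ "[:x i, y i:]"]) simp
qed

lemma poly_on_lines_add: "poly_on_lines f \<Longrightarrow> poly_on_lines g \<Longrightarrow> poly_on_lines (\<lambda>s. f s + g s)"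
  and poly_on_lines_diff: "poly_on_lines f \<Longrightarrow> poly_on_lines g \<Longrightarrow> poly_on_lines (\<lambda>s. f s - g s)"
  and poly_on_lines_mult: "poly_on_lines f \<Longrightarrow> poly_on_lines g \<Longrightarrow> poly_on_lines (\<lambda>s. f s * g s)"
  unfolding poly_on_lines_def by (metis poly_add, metis poly_diff, metis poly_mult)

text \<open>On the line joining a point good for \<open>F\<close> to a point where \<open>f\<close>
  is nonzero, every function involved restricts to a nonzero polynomial. Finitely many roots do not
  exhaust the complex numbers.\<close>

lemma poly_on_lines_common_nonzero:
  assumes "finite F" "\<And>f. f \<in> F \<Longrightarrow> poly_on_lines f" "\<And>f. f \<in> F \<Longrightarrow> \<exists>s. f s \<noteq> 0"
  shows "\<exists>s. \<forall>f\<in>F. f s \<noteq> 0"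
  using assms
proof (induction F)
  case (insert f F)
  have "\<exists>x. \<forall>g\<in>F. g x \<noteq> 0" by (rule insert.IH) (simp_all add: insert.prems)
  then obtain x where x: "\<forall>g\<in>F. g x \<noteq> 0" by blast
  obtain y where y: "f y \<noteq> 0" using insert.prems(2)[of f] by auto
  define l where "l t = (\<lambda>i. x i + t * (y i - x i))" for t
  have l01: "l 0 = x" "l 1 = y" by (simp_all add: l_def)
  have "\<forall>g\<in>insert f F. \<exists>p. \<forall>t. g (l t) = poly p t"
  proof
    fix g assume "g \<in> insert f F"
    then have "poly_on_lines g" by (rule insert.prems(1))
    then show "\<exists>p. \<forall>t. g (l t) = poly p t"
      unfolding poly_on_lines_def l_def by (elim allE)
  qed
  then obtain p where p: "\<And>g t. g \<in> insert f F \<Longrightarrow> g (l t) = poly (p g) t" by metis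
  have "p g \<noteq> 0" if "g \<in> insert f F" for g
  proof
    assume "p g = 0"
    then have "g (l t) = 0" for t using p[OF that] by simp
    then show False using that x y l01 by (metis insert_iff)
  qed
  then have "finite (\<Union>g\<in>insert f F. {t. poly (p g) t = 0})"
    using insert.hyps(1) by (intro finite_UN_I poly_roots_finite) auto
  then obtain t where "t \<notin> (\<Union>g\<in>insert f F. {t. poly (p g) t = 0})"
    using ex_new_if_finite[OF infinite_UNIV_char_0] by blast
  then have "\<forall>g\<in>insert f F. g (l t) \<noteq> 0" using p by auto
  then show ?case by blast
qed simp

section \<open>Determinant criteria for spans and incidence\<close>

lemma cramer3:
  "pairing (cross u v) w *s x = pairing (cross v w) x *s u + pairing (cross w u) x *s v + pairing (cross u v) x *s w"
  by (simp add: vec_eq_iff forall_3 cross_component pairing_def algebra_simps)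

lemma subspace_pairing: "vec.subspace {x. pairing a x = 0}"
  by (auto simp: vec.subspace_def pairing_linear)

lemma span2_eq:
  assumes "cross u v \<noteq> 0" shows "vec.span {u, v} = {x. pairing (cross u v) x = 0}"
proof
  show "vec.span {u, v} \<subseteq> {x. pairing (cross u v) x = 0}"
    by (intro vec.span_minimal subspace_pairing) (simp add: pairing_cross_self)
  obtain k where k: "cross u v $ k \<noteq> 0" using assms by (auto simp: nonzero_component)
  define w :: "complex^3" where "w = axis k 1"
  have d: "pairing (cross u v) w = cross u v $ k"
    using exhaust_3[of k] by (auto simp: w_def axis_def pairing_def)
  show "{x. pairing (cross u v) x = 0} \<subseteq> vec.span {u, v}"
  proof
    fix x assume "x \<in> {x. pairing (cross u v) x = 0}"
    then have "cross u v $ k *s x = pairing (cross v w) x *s u + pairing (cross w u) x *s v"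
      using cramer3[of u v w x] d by simp
    also have "\<dots> \<in> vec.span {u, v}"
      by (intro vec.span_add vec.span_scale vec.span_base) auto
    finally have "inverse (cross u v $ k) *s (cross u v $ k *s x) \<in> vec.span {u, v}"
      by (rule vec.span_scale)
    then show "x \<in> vec.span {u, v}" using k by simp
  qed
qed

lemma span3_UNIV_iff:
  assumes "u \<noteq> 0" "v \<noteq> 0" "w \<noteq> 0"
  shows "vec.span {u, v, w} = UNIV \<longleftrightarrow> pairing (cross u v) w \<noteq> 0"
proof
  assume sp: "vec.span {u, v, w} = UNIV"
  \<comment> \<open>A form vanishing on a spanning set is zero. If the determinant vanished,
    \<open>cross u v\<close> would be such a form, and the dependences that follow make all three
    vectors multiples of \<open>w\<close>.\<close>
  have zero: "c = 0" if "pairing c u = 0" "pairing c v = 0" "pairing c w = 0" for c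
  proof -
    have "vec.span {u, v, w} \<subseteq> {x. pairing c x = 0}"
      using that by (intro vec.span_minimal subspace_pairing) auto
    then have "\<forall>x. pairing c x = 0" using sp by auto
    then have "pairing c (axis k 1) = 0" for k by simp
    then have "c $ k = 0" for k
      using exhaust_3[of k] by (auto simp: pairing_def axis_def dest!: spec[of _ k] meta_spec[of _ k])
    then show "c = 0" by (simp add: vec_eq_iff)
  qed
  show "pairing (cross u v) w \<noteq> 0"
  proof
    assume d: "pairing (cross u v) w = 0"
    then have "cross u v = 0" using zero by (simp add: pairing_cross_self)
    then obtain a where a: "u = a *s v" using cross_eq_0_imp assms by blast
    have "cross v w = 0" using zero[of "cross v w"] by (simp add: a pairing_linear pairing_cross_self)
    then obtain b where b: "v = b *s w" using cross_eq_0_imp assms by blast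
    obtain k where "w $ k \<noteq> 0" using assms by (auto simp: nonzero_component)
    then have "cross w (axis (k + 1) 1) \<noteq> 0"
      using exhaust_3[of k] by (auto simp: vec_eq_iff forall_3 cross_component axis_def)
    moreover have "cross w (axis (k + 1) 1) = 0"
      using zero[of "cross w (axis (k + 1) 1)"] by (simp add: a b pairing_linear pairing_cross_self)
    ultimately show False by simp
  qed
next
  assume d: "pairing (cross u v) w \<noteq> 0"
  have "x \<in> vec.span {u, v, w}" for x
  proof -
    have "pairing (cross u v) w *s x \<in> vec.span {u, v, w}"
      by (subst cramer3) (intro vec.span_add vec.span_scale vec.span_base; simp)
    then have "inverse (pairing (cross u v) w) *s (pairing (cross u v) w *s x) \<in> vec.span {u, v, w}"
      by (rule vec.span_scale)
    then show ?thesis using d by simp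
  qed
  then show "vec.span {u, v, w} = UNIV" by blast
qed

lemma cross_scale: "cross (a *s u) (b *s v) = (a * b) *s cross u v"
  by (simp add: vec_eq_iff forall_3 cross_component algebra_simps)

lemma line_of_scale: "c \<noteq> 0 \<Longrightarrow> line_of (c *s a) = line_of a"
  by (simp add: line_of_def pairing_linear)

lemma join_line_cp2_of:
  assumes "P i = cp2_of u" "P j = cp2_of v" "cross u v \<noteq> 0"
  shows "join_line P {i, j} = line_of (cross u v)"
proof -
  have uv: "u \<noteq> 0" "v \<noteq> 0" using assms(3) by (auto simp: cross_def vec_eq_iff forall_3)
  obtain a where a: "a \<noteq> 0" "vec_of (P i) = a *s u" using vec_of_cp2_of[OF uv(1)] assms by metis
  obtain b where b: "b \<noteq> 0" "vec_of (P j) = b *s v" using vec_of_cp2_of[OF uv(2)] assms by metis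
  have "cross (a *s u) (b *s v) \<noteq> 0" using a b assms(3) by (simp add: cross_scale)
  then have "join_line P {i, j} = line_of (cross (a *s u) (b *s v))"
    using a b by (simp add: join_line_eq span2_eq line_of_def)
  then show ?thesis using a b by (simp add: cross_scale line_of_scale)
qed

lemma three_lines_not_concurrent:
  assumes "pairing c (cross a b) \<noteq> 0" shows "line_of a \<inter> line_of b \<inter> line_of c = {}"
proof -
  have ab: "cross a b \<noteq> 0" using assms by auto
  show ?thesis using line_Int[OF ab] assms ab by (auto simp: cp2_of_in_line)
qed

lemma index_pairs_iff: "e \<in> index_pairs m \<longleftrightarrow> (\<exists>i j. e = {i, j} \<and> i \<noteq> j \<and> i \<in> {1..m} \<and> j \<in> {1..m})"
  unfolding index_pairs_def card_2_iff by blast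

lemma disjoint_pairs_unique:
  assumes "disjoint A" "{i, j} \<in> A" "{i, k} \<in> A" shows "j = k"
proof -
  have "{i, j} = {i, k}" using disjointD[OF assms] by auto
  then show ?thesis by (metis doubleton_eq_iff)
qed

text \<open>The classes are the pairs in \<open>A\<close> and the remaining singletons, each
  represented by its least element. Values in the natural numbers can be used directly as
  slopes.\<close>

lemma class_function_exists:
  assumes A: "A \<subseteq> index_pairs m" "disjoint A"
  obtains c :: "nat \<Rightarrow> nat" where "\<And>i j. i \<noteq> j \<Longrightarrow> c i = c j \<longleftrightarrow> {i, j} \<in> A"
proof
  define c where "c i = Min (insert i {j. {i, j} \<in> A})" for i
  have uniq: "j = k" if "{i, j} \<in> A" "{i, k} \<in> A" for i j k
    using disjoint_pairs_unique[OF A(2) that] .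
  have fin: "finite {j. {i, j} \<in> A}" for i
  proof -
    have "{j. {i, j} \<in> A} \<subseteq> {1..m}" using A(1) by (auto simp: index_pairs_def)
    then show ?thesis using finite_subset by blast
  qed
  have c: "c i = i \<or> {i, c i} \<in> A" for i
    using Min_in[of "insert i {j. {i, j} \<in> A}"] fin by (auto simp: c_def)
  fix i j :: nat assume ij: "i \<noteq> j"
  show "c i = c j \<longleftrightarrow> {i, j} \<in> A"
  proof
    assume "{i, j} \<in> A"
    then have "{k. {i, k} \<in> A} = {j}" "{k. {j, k} \<in> A} = {i}"
      using uniq[of i] uniq[of j] by (auto simp: insert_commute)
    then show "c i = c j" by (simp add: c_def insert_commute)
  next
    assume eq: "c i = c j"
    show "{i, j} \<in> A"
    proof (cases "c i = i \<or> c i = j")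
      case True
      then show ?thesis using c[of i] c[of j] eq ij by (auto simp: insert_commute)
    next
      case False
      then have "{c i, i} \<in> A" "{c i, j} \<in> A" using c[of i] c[of j] eq by (auto simp: insert_commute)
      then show ?thesis using uniq ij by blast
    qed
  qed
qed

text \<open>Each pair in \<open>A\<close> spans a line through the point \<open>(0 : 0 : 1)\<close>, at which \<open>c\<close> is the slope; the
  positions \<open>s\<close> on these lines are generic. To see that a determinant is not identically \<open>0\<close>, move
  one or two of the points to \<open>(0 : 0 : 1)\<close>.\<close>

theorem generic_config_exists:
  assumes A: "A \<subseteq> index_pairs m" "disjoint A"
  obtains P where "P \<in> config m"
    "\<And>\<tau>. \<tau> \<in> pair_triples m \<Longrightarrow> (\<Inter>e\<in>\<tau>. join_line P e) \<noteq> {} \<longleftrightarrow> \<tau> \<subseteq> A"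
proof -
  obtain c :: "nat \<Rightarrow> nat" where c: "\<And>i j. i \<noteq> j \<Longrightarrow> c i = c j \<longleftrightarrow> {i, j} \<in> A"
    by (rule class_function_exists[OF A]) (rule that)
  have A_uniq: "j = k" if "{i, j} \<in> A" "{i, k} \<in> A" for i j k
    using disjoint_pairs_unique[OF A(2) that] .
  have two: "c i \<noteq> c j \<or> c i \<noteq> c k" if "i \<noteq> j" "i \<noteq> k" "j \<noteq> k" for i j k
    using c[OF that(1)] c[OF that(2)] A_uniq[of i j k] that by blast
  define u where "u s i = (vector [s i, s i * of_nat (c i), 1] :: complex^3)" for s i
  have u: "u s i $ 1 = s i" "u s i $ 2 = s i * of_nat (c i)" "u s i $ 3 = 1" for s i
    by (simp_all add: u_def)
  define D where "D i j k s = pairing (cross (u s i) (u s j)) (u s k)" for i j k s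
  define E where "E i j k l r t s = pairing (cross (u s i) (u s j))
      (cross (cross (u s k) (u s l)) (cross (u s r) (u s t)))" for i j k l r t s
  define I where "I = {1..m}"
  define ID where "ID = {(i, j, k) \<in> I \<times> I \<times> I. i \<noteq> j \<and> i \<noteq> k \<and> j \<noteq> k}"
  \<comment> \<open>Only the first line needs endpoints of different slope: a triple not contained
    in \<open>A\<close> has such a member, while the other two lines may or may not pass through
    \<open>(0 : 0 : 1)\<close>.\<close>
  define IE where "IE = {(i, j, k, l, r, t) \<in> I \<times> I \<times> I \<times> I \<times> I \<times> I. c i \<noteq> c j \<and>
      i \<notin> {k, l, r, t} \<and> j \<notin> {k, l, r, t} \<and> k \<noteq> l \<and> r \<noteq> t \<and> k \<noteq> r \<and> k \<noteq> t \<and> l \<noteq> r \<and> l \<noteq> t}"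
  define FD where "FD = (\<lambda>(i, j, k). D i j k) ` ID"
  define FE where "FE = (\<lambda>(i, j, k, l, r, t). E i j k l r t) ` IE"
  have finI: "finite I" by (simp add: I_def)
  have "finite ID" by (rule finite_subset[of _ "I \<times> I \<times> I"]) (use finI in \<open>auto simp: ID_def\<close>)
  moreover have "finite IE"
    by (rule finite_subset[of _ "I \<times> I \<times> I \<times> I \<times> I \<times> I"]) (use finI in \<open>auto simp: IE_def\<close>)
  ultimately have fin: "finite (FD \<union> FE)" by (simp add: FD_def FE_def)
  have poly_D: "poly_on_lines (D i j k)" for i j k
    unfolding D_def[abs_def] pairing_def cross_component u
    by (intro poly_on_lines_add poly_on_lines_diff poly_on_lines_mult poly_on_lines_const poly_on_lines_coord)
  have poly_E: "poly_on_lines (E i j k l r t)" for i j k l r t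
    unfolding E_def[abs_def] pairing_def cross_component u
    by (intro poly_on_lines_add poly_on_lines_diff poly_on_lines_mult poly_on_lines_const poly_on_lines_coord)
  have poly: "poly_on_lines f" if "f \<in> FD \<union> FE" for f
    using that poly_D poly_E by (auto simp: FD_def FE_def)
  have D0: "D i j k (\<lambda>n. if n = i then 0 else 1) \<noteq> 0" if "i \<noteq> j" "i \<noteq> k" "c j \<noteq> c k" for i j k
    using that by (simp add: D_def pairing_def cross_component u)
  have perm: "D i j k = D j k i" "D i j k = D k i j" for i j k
    by (auto simp: D_def pairing_def cross_component algebra_simps)
  \<comment> \<open>With the points \<open>k\<close> and \<open>r\<close> at
    \<open>(0 : 0 : 1)\<close>, the lines \<open>kl\<close> and \<open>rt\<close> have different
    slopes and meet only there, while the line \<open>ij\<close> misses that point.\<close>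
  have E0: "E i j k l r t (\<lambda>n. if n = k \<or> n = r then 0 else 1) \<noteq> 0"
    if "c i \<noteq> c j" "c l \<noteq> c t" "k \<noteq> l" "r \<noteq> t" "k \<noteq> t" "l \<noteq> r" "i \<notin> {k, r}" "j \<notin> {k, r}" for i j k l r t
    using that by (simp add: E_def pairing_def cross_component u)
  have E_swap: "E i j k l t r s = - E i j k l r t s" for i j k l t r s
    by (simp add: E_def pairing_def cross_component algebra_simps)
  have nonzero: "\<exists>s. f s \<noteq> 0" if f: "f \<in> FD \<union> FE" for f
    using f
  proof
    assume "f \<in> FD"
    then obtain i j k where ijk: "f = D i j k" "i \<noteq> j" "i \<noteq> k" "j \<noteq> k" by (auto simp: FD_def ID_def)
    consider "c j \<noteq> c k" | "c i \<noteq> c k" | "c i \<noteq> c j"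
      using two[of i j k] ijk by blast
    then show ?thesis
    proof cases
      case 1 then show ?thesis using D0[of i j k] ijk by blast
    next
      case 2
      then have "D j k i (\<lambda>n. if n = j then 0 else 1) \<noteq> 0" using ijk by (intro D0) auto
      then show ?thesis using ijk(1) perm by metis
    next
      case 3
      then have "D k i j (\<lambda>n. if n = k then 0 else 1) \<noteq> 0" using ijk by (intro D0) auto
      then show ?thesis using ijk(1) perm by metis
    qed
  next
    assume "f \<in> FE"
    then obtain i j k l r t where q: "f = E i j k l r t" "c i \<noteq> c j" "i \<notin> {k, l, r, t}" "j \<notin> {k, l, r, t}"
      "k \<noteq> l" "r \<noteq> t" "k \<noteq> r" "k \<noteq> t" "l \<noteq> r" "l \<noteq> t"
      by (auto simp: FE_def IE_def)
    show ?thesis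
    proof (cases "c l = c t")
      case False
      then have "E i j k l r t (\<lambda>n. if n = k \<or> n = r then 0 else 1) \<noteq> 0" using q by (intro E0) auto
      then show ?thesis using q(1) by blast
    next
      \<comment> \<open>Here \<open>l\<close> and \<open>t\<close> share a line through the centre,
        so \<open>l\<close> and \<open>r\<close> do not. Exchanging \<open>r\<close> and
        \<open>t\<close> only changes the sign of the determinant.\<close>
      case True
      then have "c l \<noteq> c r" using two[of l t r] q by auto
      then have "E i j k l t r (\<lambda>n. if n = k \<or> n = t then 0 else 1) \<noteq> 0" using q by (intro E0) auto
      then show ?thesis using q(1) E_swap by (metis neg_equal_0_iff_equal)
    qed
  qed
  obtain s where s: "\<And>f. f \<in> FD \<union> FE \<Longrightarrow> f s \<noteq> 0"
    using poly_on_lines_common_nonzero[OF fin poly nonzero] by blast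
  have u0: "u s i \<noteq> 0" for i by (auto simp: vec_eq_iff forall_3 u)
  define P where "P = (\<lambda>i\<in>{1..m}. cp2_of (u s i))"
  have P: "P i = cp2_of (u s i)" if "i \<in> {1..m}" for i using that by (simp add: P_def)
  have Ds: "pairing (cross (u s i) (u s j)) (u s k) \<noteq> 0"
    if "i \<in> {1..m}" "j \<in> {1..m}" "k \<in> {1..m}" "i \<noteq> j" "i \<noteq> k" "j \<noteq> k" for i j k
  proof -
    have "(i, j, k) \<in> ID" using that by (simp add: ID_def I_def)
    then have "D i j k \<in> FD" unfolding FD_def by force
    then show ?thesis using s[of "D i j k"] by (simp add: D_def)
  qed
  show thesis
  proof
    show "P \<in> config m"
      unfolding config_iff
    proof (intro conjI ballI impI)
      show "P \<in> {1..m} \<rightarrow>\<^sub>E UNIV" by (simp add: P_def)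
      fix i j k assume ijk: "i \<in> {1..m}" "j \<in> {1..m}" "k \<in> {1..m}" "i \<noteq> j \<and> i \<noteq> k \<and> j \<noteq> k"
      obtain a where a: "a \<noteq> 0" "vec_of (P i) = a *s u s i" using vec_of_cp2_of[OF u0] P[OF ijk(1)] by metis
      obtain b where b: "b \<noteq> 0" "vec_of (P j) = b *s u s j" using vec_of_cp2_of[OF u0] P[OF ijk(2)] by metis
      obtain d where d: "d \<noteq> 0" "vec_of (P k) = d *s u s k" using vec_of_cp2_of[OF u0] P[OF ijk(3)] by metis
      have "pairing (cross (vec_of (P i)) (vec_of (P j))) (vec_of (P k)) \<noteq> 0"
        using Ds[OF ijk(1-3)] ijk(4) a b d by (simp add: cross_scale pairing_linear)
      then show "vec.span {vec_of (P i), vec_of (P j), vec_of (P k)} = UNIV"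
        using span3_UNIV_iff vec_of(1) by blast
    qed
    have line: "join_line P {i, j} = line_of (cross (u s i) (u s j))"
      if ij: "i \<in> {1..m}" "j \<in> {1..m}" "i \<noteq> j" "k \<in> {1..m}" "k \<noteq> i" "k \<noteq> j" for i j k
    proof (rule join_line_cp2_of[OF P P])
      show "cross (u s i) (u s j) \<noteq> 0" using Ds[OF ij(1,2,4)] ij by (auto simp: pairing_def)
    qed (use ij in auto)
    fix \<tau> assume \<tau>: "\<tau> \<in> pair_triples m"
    have pairs: "\<tau> \<subseteq> index_pairs m" "card \<tau> = 3" "disjoint \<tau>" using \<tau> by (auto simp: pair_triples_def)
    have line: "join_line P {i, j} = line_of (cross (u s i) (u s j))" if ij: "{i, j} \<in> \<tau>" "i \<noteq> j" for i j
    proof -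
      have "\<exists>e\<in>\<tau>. e \<noteq> {i, j}"
      proof (rule ccontr)
        assume "\<not> (\<exists>e\<in>\<tau>. e \<noteq> {i, j})"
        then have "\<tau> \<subseteq> {{i, j}}" by auto
        then have "card \<tau> \<le> 1" using card_mono[of "{{i, j}}" \<tau>] by simp
        then show False using pairs by simp
      qed
      then obtain e where e: "e \<in> \<tau>" "e \<noteq> {i, j}" by blast
      then have "e \<inter> {i, j} = {}" using pairs(3) ij by (auto simp: disjoint_def)
      moreover obtain k k' where "e = {k, k'}" "k \<in> {1..m}" using e pairs(1) index_pairs_iff by blast
      moreover have "i \<in> {1..m}" "j \<in> {1..m}" using ij pairs(1) by (auto simp: index_pairs_def)
      ultimately show ?thesis using line[of i j k] ij by auto
    qed
    show "(\<Inter>e\<in>\<tau>. join_line P e) \<noteq> {} \<longleftrightarrow> \<tau> \<subseteq> A"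
    proof
      assume sub: "\<tau> \<subseteq> A"
      have "cp2_of (axis 3 1) \<in> join_line P e" if "e \<in> \<tau>" for e
      proof -
        obtain i j where ij: "e = {i, j}" "i \<noteq> j" using \<open>e \<in> \<tau>\<close> pairs(1) index_pairs_iff by blast
        then have "c i = c j" using c \<open>e \<in> \<tau>\<close> sub by blast
        then have "pairing (cross (u s i) (u s j)) (axis 3 1) = 0"
          by (simp add: pairing_def cross_component u axis_def)
        then show ?thesis using line[of i j] ij \<open>e \<in> \<tau>\<close> by (simp add: cp2_of_in_line axis_eq_0_iff)
      qed
      then show "(\<Inter>e\<in>\<tau>. join_line P e) \<noteq> {}" by blast
    next
      assume ne: "(\<Inter>e\<in>\<tau>. join_line P e) \<noteq> {}"
      show "\<tau> \<subseteq> A"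
      proof (rule ccontr)
        assume "\<not> \<tau> \<subseteq> A"
        then obtain e1 where e1: "e1 \<in> \<tau>" "e1 \<notin> A" by blast
        then have "card (\<tau> - {e1}) = 2" using pairs(2) by simp
        then obtain e2 e3 where e23: "\<tau> - {e1} = {e2, e3}" "e2 \<noteq> e3" by (auto simp: card_2_iff)
        then have e: "e2 \<in> \<tau>" "e3 \<in> \<tau>" "e1 \<noteq> e2" "e1 \<noteq> e3" by auto
        obtain i j where ij: "e1 = {i, j}" "i \<noteq> j" "i \<in> I" "j \<in> I"
          using e1 pairs(1) index_pairs_iff unfolding I_def by blast
        obtain k l where kl: "e2 = {k, l}" "k \<noteq> l" "k \<in> I" "l \<in> I"
          using e(1) pairs(1) index_pairs_iff unfolding I_def by blast
        obtain r t where rt: "e3 = {r, t}" "r \<noteq> t" "r \<in> I" "t \<in> I"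
          using e(2) pairs(1) index_pairs_iff unfolding I_def by blast
        have "e1 \<inter> e2 = {}" "e1 \<inter> e3 = {}" "e2 \<inter> e3 = {}"
          using pairs(3) e e1 e23(2) by (simp_all add: disjoint_def)
        moreover have "c i \<noteq> c j" using c[OF ij(2)] e1 ij by simp
        ultimately have "(i, j, k, l, r, t) \<in> IE"
          unfolding ij(1) kl(1) rt(1) IE_def using ij kl rt by auto
        then have "E i j k l r t \<in> FE" unfolding FE_def by force
        then have "E i j k l r t s \<noteq> 0" using s by blast
        then have "join_line P e2 \<inter> join_line P e3 \<inter> join_line P e1 = {}"
          using three_lines_not_concurrent e e1 line ij(1,2) kl(1,2) rt(1,2) by (simp add: E_def)
        then show False using ne e e1 by blast
      qed
    qed
  qed
qed


section \<open>The Euler characteristic of the fibre\<close>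

definition pair_families :: "nat \<Rightarrow> nat set set set" where
  "pair_families m = {A. A \<subseteq> index_pairs m \<and> disjoint A}"

lemma pair_families_subset: "A \<subseteq> B \<Longrightarrow> B \<in> pair_families m \<Longrightarrow> A \<in> pair_families m"
  unfolding pair_families_def using pairwise_subset by (metis (no_types, lifting) mem_Collect_eq order_trans)

lemma finite_index_pairs: "finite (index_pairs m)"
  by (rule finite_subset[of _ "Pow {1..m}"]) (auto simp: index_pairs_def)

lemma finite_pair_families: "finite (pair_families m)"
  by (rule finite_subset[of _ "Pow (index_pairs m)"]) (auto simp: pair_families_def finite_index_pairs)

lemma card_ge_2_elements:
  assumes "card A \<ge> 2" obtains e f where "e \<in> A" "f \<in> A" "e \<noteq> f"
proof -
  obtain B where "B \<subseteq> A" "card B = 2" using obtain_subset_with_card_n[OF assms] by metis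
  then show thesis using that by (auto simp: card_2_iff)
qed

text \<open>The full alternating sum over the subsets of \<open>B\<close> is \<open>0\<close>, and the subsets with at most one
  element contribute \<open>1 - card B\<close>.\<close>

lemma alternating_sum_subsets_ge_2:
  assumes B: "finite B" "B \<noteq> {}"
  shows "(\<Sum>A | A \<subseteq> B \<and> card A \<ge> 2. (- 1) ^ card A) = int (card B - 1)"
proof -
  have small: "{A. A \<subseteq> B \<and> \<not> card A \<ge> 2} = insert {} ((\<lambda>b. {b}) ` B)"
  proof (intro Set.set_eqI iffI)
    fix A assume A: "A \<in> {A. A \<subseteq> B \<and> \<not> card A \<ge> 2}"
    then have "finite A" using B finite_subset by auto
    moreover have "card A = 0 \<or> card A = 1" using A by auto
    ultimately show "A \<in> insert {} ((\<lambda>b. {b}) ` B)"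
      using A by (auto simp: card_1_singleton_iff)
  qed auto
  have fin: "finite {A. A \<subseteq> B \<and> Q A}" for Q using B by simp
  have "(\<Sum>A\<in>Pow B. (- 1) ^ card A :: int) = (\<Prod>b\<in>B. 1 - 1)"
    using prod_diff_conv_sum[OF B(1), of "\<lambda>_. 1 :: int" "\<lambda>_. 1"] by simp
  then have "0 = (\<Sum>A\<in>{A. A \<subseteq> B \<and> card A \<ge> 2} \<union> {A. A \<subseteq> B \<and> \<not> card A \<ge> 2}. (- 1) ^ card A :: int)"
    using B by (simp add: Pow_def Un_def card_gt_0_iff flip: conj_disj_distribL)
  also have "\<dots> = (\<Sum>A | A \<subseteq> B \<and> card A \<ge> 2. (- 1) ^ card A) + (\<Sum>A | A \<subseteq> B \<and> \<not> card A \<ge> 2. (- 1) ^ card A)"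
    using fin by (intro sum.union_disjoint) auto
  also have "(\<Sum>A | A \<subseteq> B \<and> \<not> card A \<ge> 2. (- 1) ^ card A :: int) = 1 + (\<Sum>A\<in>(\<lambda>b. {b}) ` B. (- 1) ^ card A)"
    unfolding small using B(1) by (subst sum.insert) auto
  also have "(\<Sum>A\<in>(\<lambda>b. {b}) ` B. (- 1) ^ card A :: int) = - int (card B)"
    by (subst sum.reindex) (auto simp: inj_on_def)
  finally have "(\<Sum>A | A \<subseteq> B \<and> card A \<ge> 2. (- 1) ^ card A) = int (card B) - 1" by simp
  moreover have "card B \<ge> 1" using B by (simp add: Suc_leI card_gt_0_iff)
  ultimately show ?thesis by simp
qed

text \<open>The part of the Euler characteristic common to all configurations: the lines through
  each \<open>P i\<close> are determined by their indices, and any two lines with disjoint index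
  pairs meet in a new point, so families of size two always contribute.\<close>

definition chi_offset :: "nat \<Rightarrow> int" where
  "chi_offset m = 3 - 2 * int (card (index_pairs m)) + (\<Sum>i\<in>{1..m}. int (card {e \<in> index_pairs m. i \<in> e} - 1))
     + int (card {A \<in> pair_families m. card A = 2})"

section \<open>Incidences in a fixed configuration\<close>

locale configuration =
  fixes m :: nat and P :: "nat \<Rightarrow> cp2"
  assumes config: "P \<in> config m" and m: "m \<ge> 3"
begin

definition lines_at :: "cp2 \<Rightarrow> nat set set" where
  "lines_at q = {e \<in> index_pairs m. q \<in> join_line P e}"

definition concurrent :: "nat set set \<Rightarrow> bool" where
  "concurrent A \<longleftrightarrow> (\<Inter>e\<in>A. join_line P e) \<noteq> {}"

definition multiple_points :: "cp2 set" where
  "multiple_points = {q. q \<notin> P ` {1..m} \<and> card (lines_at q) \<ge> 2}"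

lemma det_nonzero:
  assumes "i \<in> {1..m}" "j \<in> {1..m}" "k \<in> {1..m}" "i \<noteq> j" "i \<noteq> k" "j \<noteq> k"
  shows "pairing (cross (vec_of (P i)) (vec_of (P j))) (vec_of (P k)) \<noteq> 0"
  using config_span[OF config assms] span3_UNIV_iff vec_of(1) by blast

lemma cross_points_nonzero:
  assumes "i \<in> {1..m}" "j \<in> {1..m}" "i \<noteq> j"
  shows "cross (vec_of (P i)) (vec_of (P j)) \<noteq> 0"
proof -
  have "card {i, j} \<le> 2" by (simp add: card_insert_if)
  then have "\<not> {1..m} \<subseteq> {i, j}" using m card_mono[of "{i, j}" "{1..m}"] by auto
  then obtain k where "k \<in> {1..m}" "k \<noteq> i" "k \<noteq> j" by blast
  then show ?thesis using det_nonzero[of i j k] assms by (auto simp: pairing_def)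
qed

lemma join_line_pair:
  assumes "i \<in> {1..m}" "j \<in> {1..m}" "i \<noteq> j"
  shows "join_line P {i, j} = line_of (cross (vec_of (P i)) (vec_of (P j)))"
  using join_line_cp2_of[OF _ _ cross_points_nonzero[OF assms]] cp2_of_vec_of by metis

lemma is_proj_line_join_line: "e \<in> index_pairs m \<Longrightarrow> is_proj_line (join_line P e)"
  using join_line_pair cross_points_nonzero unfolding index_pairs_iff is_proj_line_def by metis

lemma point_in_join_line:
  assumes e: "e \<in> index_pairs m" and k: "k \<in> {1..m}"
  shows "P k \<in> join_line P e \<longleftrightarrow> k \<in> e"
proof -
  obtain i j where ij: "e = {i, j}" "i \<noteq> j" "i \<in> {1..m}" "j \<in> {1..m}"
    using e index_pairs_iff by blast
  have "P k \<in> join_line P e \<longleftrightarrow> pairing (cross (vec_of (P i)) (vec_of (P j))) (vec_of (P k)) = 0"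
    unfolding ij(1) join_line_pair[OF ij(3,4,2)] by (simp add: line_of_def)
  moreover have "\<dots> \<longleftrightarrow> k = i \<or> k = j"
  proof (cases "k = i \<or> k = j")
    case True
    then show ?thesis by (elim disjE) (simp_all add: pairing_cross_self)
  next
    case False
    then show ?thesis using det_nonzero[OF ij(3,4) k ij(2)] by simp
  qed
  ultimately show ?thesis by (simp add: ij(1))
qed

lemma inj_on_join_line: "inj_on (join_line P) (index_pairs m)"
proof (rule inj_onI)
  fix e f assume ef: "e \<in> index_pairs m" "f \<in> index_pairs m" "join_line P e = join_line P f"
  then have "k \<in> e \<longleftrightarrow> k \<in> f" if "k \<in> {1..m}" for k
    using point_in_join_line[OF ef(1) that] point_in_join_line[OF ef(2) that] by simp
  moreover have "e \<subseteq> {1..m}" "f \<subseteq> {1..m}" using ef by (auto simp: index_pairs_def)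
  ultimately show "e = f" by blast
qed

lemma inj_on_P: "inj_on P {1..m}"
proof (rule inj_onI, rule ccontr)
  fix i j assume ij: "i \<in> {1..m}" "j \<in> {1..m}" "P i = P j" "i \<noteq> j"
  then show False using cross_points_nonzero[OF ij(1,2,4)] by (simp add: cross_def vec_eq_iff forall_3 mult.commute)
qed

lemma join_line_Int:
  assumes "e \<in> index_pairs m" "f \<in> index_pairs m" "e \<noteq> f"
  obtains q where "join_line P e \<inter> join_line P f = {q}"
proof -
  have "join_line P e \<noteq> join_line P f" using inj_on_join_line assms by (auto dest: inj_onD)
  then show thesis
    using is_proj_line_Int is_proj_line_join_line assms that by metis
qed

lemma join_line_Int_unique:
  assumes "e \<in> index_pairs m" "f \<in> index_pairs m" "e \<noteq> f"
    "{q, q'} \<subseteq> join_line P e" "{q, q'} \<subseteq> join_line P f"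
  shows "q = q'"
proof -
  obtain r where "join_line P e \<inter> join_line P f = {r}" using join_line_Int[OF assms(1-3)] by metis
  then have "q = r" "q' = r" using assms(4,5) by blast+
  then show ?thesis by simp
qed

lemma finite_lines_at: "finite (lines_at q)"
  unfolding lines_at_def using finite_index_pairs by simp

lemma card_lines_at: "card {H \<in> arrangement m P. q \<in> H} = card (lines_at q)"
proof -
  have "{H \<in> arrangement m P. q \<in> H} = join_line P ` lines_at q"
    by (auto simp: arrangement_def lines_at_def)
  moreover have "inj_on (join_line P) (lines_at q)"
    using inj_on_join_line by (rule inj_on_subset) (auto simp: lines_at_def)
  ultimately show ?thesis by (simp add: card_image)
qed

lemma lines_at_point: "i \<in> {1..m} \<Longrightarrow> lines_at (P i) = {e \<in> index_pairs m. i \<in> e}"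
  using point_in_join_line by (auto simp: lines_at_def)

text \<open>Two distinct lines whose index pairs share \<open>i\<close> meet only in
  \<open>P i\<close>.\<close>

lemma lines_at_new_point:
  assumes "q \<notin> P ` {1..m}" shows "lines_at q \<in> pair_families m"
proof -
  have "e \<inter> f = {}" if ef: "e \<in> lines_at q" "f \<in> lines_at q" "e \<noteq> f" for e f
  proof (rule ccontr)
    assume "e \<inter> f \<noteq> {}"
    then obtain i where i: "i \<in> e" "i \<in> f" by blast
    have I: "e \<in> index_pairs m" "f \<in> index_pairs m" using ef by (auto simp: lines_at_def)
    then have "i \<in> {1..m}" using i by (auto simp: index_pairs_def)
    then have "q = P i"
      using join_line_Int_unique[OF I ef(3)] point_in_join_line I i ef by (auto simp: lines_at_def)
    then show False using assms \<open>i \<in> {1..m}\<close> by blast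
  qed
  then show ?thesis by (auto simp: pair_families_def disjoint_def lines_at_def)
qed

lemma concurrent_iff: "A \<subseteq> index_pairs m \<Longrightarrow> concurrent A \<longleftrightarrow> (\<exists>q. A \<subseteq> lines_at q)"
  by (auto simp: concurrent_def lines_at_def)

lemma common_point_unique:
  assumes "card A \<ge> 2" "A \<subseteq> lines_at q" "A \<subseteq> lines_at q'"
  shows "q = q'"
proof -
  obtain e f where ef: "e \<in> A" "f \<in> A" "e \<noteq> f"
    by (rule card_ge_2_elements[OF assms(1)])
  have I: "e \<in> index_pairs m" "f \<in> index_pairs m" using ef assms by (auto simp: lines_at_def)
  show ?thesis by (rule join_line_Int_unique[OF I ef(3)]) (use ef assms in \<open>auto simp: lines_at_def\<close>)
qed

text \<open>Every line through \<open>P i\<close> has \<open>i\<close> in its index pair, which is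
  impossible for two disjoint pairs.\<close>

lemma common_point_new:
  assumes A: "A \<in> pair_families m" "card A \<ge> 2" "A \<subseteq> lines_at q"
  shows "q \<in> multiple_points"
proof -
  have "q \<notin> P ` {1..m}"
  proof
    assume "q \<in> P ` {1..m}"
    then obtain i where i: "i \<in> {1..m}" "q = P i" by blast
    then have all: "\<forall>e\<in>A. i \<in> e" using A(3) lines_at_point by auto
    obtain e f where ef: "e \<in> A" "f \<in> A" "e \<noteq> f"
      by (rule card_ge_2_elements[OF A(2)])
    then have "e \<inter> f = {}" using A(1) by (auto simp: pair_families_def disjoint_def)
    then show False using all ef by blast
  qed
  moreover have "card A \<le> card (lines_at q)" using A(3) finite_lines_at by (rule card_mono[rotated])
  ultimately show ?thesis using A(2) by (simp add: multiple_points_def)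
qed

lemma finite_multiple_points: "finite multiple_points"
proof -
  let ?J = "{(e, f) \<in> index_pairs m \<times> index_pairs m. e \<noteq> f}"
  have fin: "finite ?J"
    by (rule finite_subset[of _ "index_pairs m \<times> index_pairs m"]) (auto simp: finite_index_pairs)
  have "multiple_points \<subseteq> (\<Union>(e, f)\<in>?J. join_line P e \<inter> join_line P f)"
  proof
    fix q assume "q \<in> multiple_points"
    then have "card (lines_at q) \<ge> 2" by (simp add: multiple_points_def)
    then obtain e f where "e \<in> lines_at q" "f \<in> lines_at q" "e \<noteq> f"
      by (rule card_ge_2_elements)
    then have "(e, f) \<in> ?J" "q \<in> join_line P e \<inter> join_line P f" by (auto simp: lines_at_def)
    then show "q \<in> (\<Union>(e, f)\<in>?J. join_line P e \<inter> join_line P f)" by blast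
  qed
  moreover have "finite (\<Union>(e, f)\<in>?J. join_line P e \<inter> join_line P f)"
  proof (rule finite_UN_I[OF fin])
    fix x assume "x \<in> ?J"
    then obtain e f where x: "x = (e, f)" "e \<in> index_pairs m" "f \<in> index_pairs m" "e \<noteq> f" by blast
    obtain q where "join_line P e \<inter> join_line P f = {q}" using join_line_Int[OF x(2-4)] by metis
    then show "finite (case x of (e, f) \<Rightarrow> join_line P e \<inter> join_line P f)" using x by simp
  qed
  ultimately show ?thesis using finite_subset by blast
qed

lemma concurrent_pair: "A \<subseteq> index_pairs m \<Longrightarrow> card A = 2 \<Longrightarrow> concurrent A"
proof -
  assume A: "A \<subseteq> index_pairs m" "card A = 2"
  then obtain e f where ef: "A = {e, f}" "e \<noteq> f" by (auto simp: card_2_iff)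
  then obtain q where "join_line P e \<inter> join_line P f = {q}" using join_line_Int[of e f] A by auto
  then show ?thesis using ef by (auto simp: concurrent_def)
qed

text \<open>A set of at least two lines has at most one common point, so a sum over points becomes a sum over
  concurrent sets of lines.\<close>

lemma sum_multiple_points:
  "(\<Sum>q\<in>multiple_points. int (card (lines_at q) - 1)) =
     (\<Sum>A | A \<in> pair_families m \<and> card A \<ge> 2 \<and> concurrent A. (- 1) ^ card A)"
proof -
  have sub: "lines_at q \<in> pair_families m" if "q \<in> multiple_points" for q
    using that lines_at_new_point by (simp add: multiple_points_def)
  note subset = pair_families_subset
  have "(\<Sum>q\<in>multiple_points. int (card (lines_at q) - 1)) =
      (\<Sum>q\<in>multiple_points. \<Sum>A | A \<subseteq> lines_at q \<and> card A \<ge> 2. (- 1) ^ card A)"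
    using finite_lines_at
    by (intro sum.cong refl alternating_sum_subsets_ge_2[symmetric]) (auto simp: multiple_points_def)
  also have "\<dots> = (\<Sum>A\<in>(\<Union>q\<in>multiple_points. {A. A \<subseteq> lines_at q \<and> card A \<ge> 2}). (- 1) ^ card A)"
  proof (rule sum.UNION_disjoint[symmetric])
    show "\<forall>q\<in>multiple_points. finite {A. A \<subseteq> lines_at q \<and> card A \<ge> 2}"
      using finite_lines_at by simp
    show "\<forall>q\<in>multiple_points. \<forall>q'\<in>multiple_points. q \<noteq> q' \<longrightarrow>
        {A. A \<subseteq> lines_at q \<and> card A \<ge> 2} \<inter> {A. A \<subseteq> lines_at q' \<and> card A \<ge> 2} = {}"
      using common_point_unique by blast
  qed (rule finite_multiple_points)
  also have "(\<Union>q\<in>multiple_points. {A. A \<subseteq> lines_at q \<and> card A \<ge> 2}) =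
      {A. A \<in> pair_families m \<and> card A \<ge> 2 \<and> concurrent A}" (is "?L = ?R")
  proof (intro Set.set_eqI iffI)
    fix A assume "A \<in> ?L"
    then obtain q where q: "q \<in> multiple_points" "A \<subseteq> lines_at q" "card A \<ge> 2" by blast
    then have "A \<in> pair_families m" using sub subset by blast
    then show "A \<in> ?R" using q concurrent_iff by (auto simp: pair_families_def)
  next
    fix A assume A: "A \<in> ?R"
    then obtain q where q: "A \<subseteq> lines_at q" using concurrent_iff by (auto simp: pair_families_def)
    then have "q \<in> multiple_points" using A common_point_new by blast
    then show "A \<in> ?L" using q A by blast
  qed
  finally show ?thesis .
qed

text \<open>Lines intersect either in the points \<open>P i\<close>, whose multiplicities are purely
  combinatorial, or in new points, which \<open>sum_multiple_points\<close> converts into families.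
  Families of size two are always concurrent and move into \<open>chi_offset\<close>.\<close>

theorem euler_char_fibre:
  "euler_char (top_of_set (fibre m P)) = chi_offset m
     + (\<Sum>A | A \<in> pair_families m \<and> card A \<ge> 3 \<and> concurrent A. (- 1) ^ card A)"
proof -
  define R where "R = P ` {1..m} \<union> multiple_points"
  have fin: "finite (arrangement m P)" using finite_index_pairs by (simp add: arrangement_def)
  have "{1, 2} \<in> index_pairs m" unfolding index_pairs_iff using m by (intro exI[of _ 1] exI[of _ 2]) auto
  then have ne: "arrangement m P \<noteq> {}" by (auto simp: arrangement_def)
  have "chi_set (- \<Union>(arrangement m P)) (3 - 2 * int (card (arrangement m P)) +
      (\<Sum>q\<in>R. int (card {H \<in> arrangement m P. q \<in> H} - 1)))"
  proof (rule chi_set_line_arrangement[OF fin ne])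
    show "is_proj_line H" if "H \<in> arrangement m P" for H
      using that is_proj_line_join_line by (auto simp: arrangement_def)
    show "finite R" using finite_multiple_points by (simp add: R_def)
    fix H H' assume H: "H \<in> arrangement m P" "H' \<in> arrangement m P" "H \<noteq> H'"
    show "H \<inter> H' \<subseteq> R"
    proof
      fix q assume q: "q \<in> H \<inter> H'"
      have "card {H, H'} \<le> card {H \<in> arrangement m P. q \<in> H}"
        using H q fin by (intro card_mono) auto
      then have "card (lines_at q) \<ge> 2" using H(3) by (simp add: card_lines_at)
      then show "q \<in> R" by (auto simp: R_def multiple_points_def)
    qed
  qed
  moreover have "card (arrangement m P) = card (index_pairs m)"
    unfolding arrangement_def by (rule card_image[OF inj_on_join_line])
  moreover have "(\<Sum>q\<in>R. int (card (lines_at q) - 1)) =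
      (\<Sum>i\<in>{1..m}. int (card {e \<in> index_pairs m. i \<in> e} - 1)) + (\<Sum>q\<in>multiple_points. int (card (lines_at q) - 1))"
  proof -
    have "(\<Sum>q\<in>R. int (card (lines_at q) - 1)) =
        (\<Sum>q\<in>P ` {1..m}. int (card (lines_at q) - 1)) + (\<Sum>q\<in>multiple_points. int (card (lines_at q) - 1))"
      unfolding R_def using finite_multiple_points
      by (intro sum.union_disjoint) (auto simp: multiple_points_def)
    also have "(\<Sum>q\<in>P ` {1..m}. int (card (lines_at q) - 1)) = (\<Sum>i\<in>{1..m}. int (card (lines_at (P i)) - 1))"
      unfolding sum.reindex[OF inj_on_P] by (simp only: o_def)
    also have "\<dots> = (\<Sum>i\<in>{1..m}. int (card {e \<in> index_pairs m. i \<in> e} - 1))"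
      by (intro sum.cong refl) (simp add: lines_at_point)
    finally show ?thesis .
  qed
  moreover have "(\<Sum>q\<in>multiple_points. int (card (lines_at q) - 1)) = int (card {A \<in> pair_families m. card A = 2})
      + (\<Sum>A | A \<in> pair_families m \<and> card A \<ge> 3 \<and> concurrent A. (- 1) ^ card A)"
  proof -
    have split: "{A. A \<in> pair_families m \<and> card A \<ge> 2 \<and> concurrent A} =
        {A \<in> pair_families m. card A = 2} \<union> {A. A \<in> pair_families m \<and> card A \<ge> 3 \<and> concurrent A}"
      using concurrent_pair by (auto simp: pair_families_def)
    have "(\<Sum>A | A \<in> pair_families m \<and> card A \<ge> 2 \<and> concurrent A. (- 1) ^ card A :: int) =
        (\<Sum>A | A \<in> pair_families m \<and> card A = 2. (- 1) ^ card A) +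
        (\<Sum>A | A \<in> pair_families m \<and> card A \<ge> 3 \<and> concurrent A. (- 1) ^ card A)"
      unfolding split
    proof (rule sum.union_disjoint)
      show "finite {A \<in> pair_families m. card A = 2}"
        "finite {A. A \<in> pair_families m \<and> card A \<ge> 3 \<and> concurrent A}"
        by (rule finite_subset[OF _ finite_pair_families]; blast)+
    qed auto
    moreover have "(\<Sum>A | A \<in> pair_families m \<and> card A = 2. (- 1) ^ card A :: int) =
        int (card {A \<in> pair_families m. card A = 2})"
    proof -
      have "(\<Sum>A | A \<in> pair_families m \<and> card A = 2. (- 1) ^ card A :: int) =
          (\<Sum>A | A \<in> pair_families m \<and> card A = 2. 1)" by (rule sum.cong) auto
      then show ?thesis by simp
    qed
    ultimately show ?thesis unfolding sum_multiple_points by simp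
  qed
  ultimately have "chi_set (- \<Union>(arrangement m P)) (chi_offset m
      + (\<Sum>A | A \<in> pair_families m \<and> card A \<ge> 3 \<and> concurrent A. (- 1) ^ card A))"
    by (simp only: card_lines_at chi_offset_def add.assoc)
  then show ?thesis unfolding fibre_def Compl_eq_Diff_UNIV[symmetric] by (rule has_chi_imp_euler_char)
qed

end


section \<open>Moebius inversion over the strata\<close>

text \<open>Translates a family of lines into the language of the strata, which record only
  concurrences of three lines.\<close>

definition triples :: "nat set set \<Rightarrow> nat set set set" where
  "triples A = {\<tau>. \<tau> \<subseteq> A \<and> card \<tau> = 3}"

text \<open>Every member of a set with at least three elements lies in one of its three-element
  subsets, so such a family can be recovered from its triples.\<close>

lemma triples_mono_iff:
  assumes "card A \<ge> 3" shows "triples A \<subseteq> triples B \<longleftrightarrow> A \<subseteq> B"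
proof
  assume sub: "triples A \<subseteq> triples B"
  show "A \<subseteq> B"
  proof
    fix e assume "e \<in> A"
    have "finite A" using assms by (metis card.infinite not_numeral_le_zero)
    then obtain \<tau> where "{e} \<subseteq> \<tau>" "\<tau> \<subseteq> A" "card \<tau> = 3"
      using exists_subset_between[of "{e}" 3 A] \<open>e \<in> A\<close> assms by auto
    then show "e \<in> B" using sub by (auto simp: triples_def)
  qed
qed (auto simp: triples_def)

lemma triples_eq_iff:
  assumes "card A \<ge> 3" "card B \<ge> 3" shows "triples A = triples B \<longleftrightarrow> A = B"
  using triples_mono_iff[OF assms(1), of B] triples_mono_iff[OF assms(2), of A] by auto

lemma triples_nonempty:
  assumes "card A \<ge> 3" shows "triples A \<noteq> {}"
proof -
  obtain \<tau> where "\<tau> \<subseteq> A" "card \<tau> = 3" using obtain_subset_with_card_n[OF assms] by metis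
  then show ?thesis by (auto simp: triples_def)
qed

lemma pair_triples_eq: "pair_triples m = {\<tau> \<in> pair_families m. card \<tau> = 3}"
  by (auto simp: pair_triples_def pair_families_def)

context configuration
begin

lemma orbit3_in_X3: "orbit3 m P \<in> X3 m"
  using config by (auto simp: orbit3_def X3_def quotientI)

lemma concurrences_eq: "concurrences m (orbit3 m P) = {\<tau> \<in> pair_triples m. concurrent \<tau>}"
  using concurrent_locus_orbit3[OF config] by (auto simp: concurrences_def concurrent_def)

text \<open>Two fixed members of \<open>A\<close> have only one common point. Each triple containing
  both puts its third line through that point, so all of \<open>A\<close> passes through it.\<close>

lemma concurrent_iff_triples:
  assumes A: "A \<in> pair_families m" "card A \<ge> 3"
  shows "concurrent A \<longleftrightarrow> triples A \<subseteq> concurrences m (orbit3 m P)"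
proof
  assume "concurrent A"
  then obtain q where q: "A \<subseteq> lines_at q" using A concurrent_iff by (auto simp: pair_families_def)
  show "triples A \<subseteq> concurrences m (orbit3 m P)"
  proof
    fix \<tau> assume "\<tau> \<in> triples A"
    then have \<tau>: "\<tau> \<subseteq> A" "card \<tau> = 3" by (auto simp: triples_def)
    then have "\<tau> \<in> pair_families m" using A pair_families_subset by blast
    moreover from this have "concurrent \<tau>" using concurrent_iff[of \<tau>] \<tau> q by (auto simp: pair_families_def)
    ultimately show "\<tau> \<in> concurrences m (orbit3 m P)" using \<tau> by (simp add: concurrences_eq pair_triples_eq)
  qed
next
  assume sub: "triples A \<subseteq> concurrences m (orbit3 m P)"
  have AI: "A \<subseteq> index_pairs m" using A by (simp add: pair_families_def)
  have fin: "finite A" using A(2) by (metis card.infinite not_numeral_le_zero)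
  obtain B where B: "B \<subseteq> A" "card B = 2" using obtain_subset_with_card_n[of 2 A] A(2) by auto
  have "\<exists>q. insert e B \<subseteq> lines_at q" if "e \<in> A" for e
  proof -
    have "card (insert e B) \<le> 3" using B by (simp add: card_insert_if card_ge_0_finite)
    then obtain \<tau> where \<tau>: "insert e B \<subseteq> \<tau>" "\<tau> \<subseteq> A" "card \<tau> = 3"
      using exists_subset_between[of "insert e B" 3 A] A(2) B \<open>e \<in> A\<close> fin by auto
    then have "concurrent \<tau>" using sub by (auto simp: concurrences_eq triples_def)
    then obtain q where "\<tau> \<subseteq> lines_at q" using concurrent_iff[of \<tau>] \<tau>(2) AI by auto
    then show ?thesis using \<tau>(1) by blast
  qed
  then obtain q where q: "\<And>e. e \<in> A \<Longrightarrow> insert e B \<subseteq> lines_at (q e)" by metis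
  have "A \<noteq> {}" using A(2) by auto
  then obtain e0 where e0: "e0 \<in> A" by blast
  have "q e = q e0" if "e \<in> A" for e
    using common_point_unique[of B "q e" "q e0"] B(2) q[OF that] q[OF e0] by auto
  then have "A \<subseteq> lines_at (q e0)" using q by (metis insert_subset subsetI)
  then show "concurrent A" using concurrent_iff[OF AI] by blast
qed

text \<open>Infinite sets also have cardinality 0; finiteness allows a vanishing count to be read as
  emptiness.\<close>

lemma finite_new_points: "h \<ge> 3 \<Longrightarrow> finite {q. q \<notin> P ` {1..m} \<and> card (lines_at q) = h}"
  by (rule finite_subset[OF _ finite_multiple_points]) (auto simp: multiple_points_def)

lemma triples_lines_at_subset:
  assumes "q \<notin> P ` {1..m}" "card (lines_at q) \<ge> 3"
  shows "triples (lines_at q) \<subseteq> concurrences m (orbit3 m P)"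
  using concurrent_iff_triples[OF lines_at_new_point[OF assms(1)] assms(2)] concurrent_iff
  by (auto simp: lines_at_def)

text \<open>Forward, a concurrent triple meets in a new point of multiplicity at least 3, which can
  only be the one counted. Backward, the lines through any such point form a subfamily of
  \<open>A\<close>, so it is the common point of \<open>A\<close>, and \<open>A\<close> is the full
  set of lines there.\<close>

lemma single_multiple_point_iff:
  assumes h: "h \<ge> 3"
  shows "card {q. q \<notin> P ` {1..m} \<and> card (lines_at q) = h} = 1 \<and>
      (\<forall>i\<ge>3. i \<noteq> h \<longrightarrow> card {q. q \<notin> P ` {1..m} \<and> card (lines_at q) = i} = 0) \<longleftrightarrow>
    (\<exists>A\<in>pair_families m. card A = h \<and> concurrences m (orbit3 m P) = triples A)"
    (is "card (?N h) = 1 \<and> ?Z \<longleftrightarrow> _")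
proof (intro iffI; (elim conjE bexE)?)
  assume one: "card (?N h) = 1" and zero: ?Z
  obtain q where q: "?N h = {q}" using one by (auto simp: card_1_singleton_iff)
  then have q': "q \<notin> P ` {1..m}" "card (lines_at q) = h" by blast+
  have "concurrences m (orbit3 m P) \<subseteq> triples (lines_at q)"
  proof
    fix \<tau> assume "\<tau> \<in> concurrences m (orbit3 m P)"
    then have \<tau>: "\<tau> \<in> pair_families m" "card \<tau> = 3" "concurrent \<tau>"
      by (auto simp: concurrences_eq pair_triples_eq)
    then obtain r where r: "\<tau> \<subseteq> lines_at r" using concurrent_iff by (auto simp: pair_families_def)
    then have new: "r \<notin> P ` {1..m}" using common_point_new[OF \<tau>(1)] \<tau>(2) by (simp add: multiple_points_def)
    have ge: "card (lines_at r) \<ge> 3" using card_mono[OF finite_lines_at r] \<tau>(2) by simp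
    have "card (lines_at r) = h"
    proof (rule ccontr)
      assume "card (lines_at r) \<noteq> h"
      then have "card (?N (card (lines_at r))) = 0" using zero ge by simp
      then have "?N (card (lines_at r)) = {}" using finite_new_points[OF ge] by simp
      then show False using new by blast
    qed
    then have "r \<in> ?N h" using new by simp
    then have "r = q" unfolding q by simp
    then show "\<tau> \<in> triples (lines_at q)" using r \<tau>(2) by (simp add: triples_def)
  qed
  then have "concurrences m (orbit3 m P) = triples (lines_at q)"
    using triples_lines_at_subset[OF q'(1)] q'(2) h by auto
  then show "\<exists>A\<in>pair_families m. card A = h \<and> concurrences m (orbit3 m P) = triples A"
    using lines_at_new_point[OF q'(1)] q'(2) by blast
next
  fix A assume A: "A \<in> pair_families m" "card A = h" and eq: "concurrences m (orbit3 m P) = triples A"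
  have cA: "card A \<ge> 3" using A h by simp
  have "concurrent A" using concurrent_iff_triples[OF A(1) cA] eq by simp
  then obtain q where q: "A \<subseteq> lines_at q" using A(1) concurrent_iff by (auto simp: pair_families_def)
  have new: "q \<notin> P ` {1..m}" using common_point_new[OF A(1) _ q] cA by (simp add: multiple_points_def)
  have le: "lines_at r \<subseteq> A" if "r \<notin> P ` {1..m}" "card (lines_at r) \<ge> 3" for r
    using triples_lines_at_subset[OF that] triples_mono_iff[OF that(2)] eq by simp
  have "card (lines_at q) \<ge> 3" using card_mono[OF finite_lines_at q] cA by simp
  then have Aq: "lines_at q = A" using le[OF new] q by blast
  have uniq: "r = q" if "r \<notin> P ` {1..m}" "card (lines_at r) \<ge> 3" for r
    using common_point_unique[of "lines_at r" r q] le[OF that] that(2) Aq by simp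
  have only: "x = q \<and> i = h" if "i \<ge> 3" "x \<in> ?N i" for x i
  proof -
    have "x \<notin> P ` {1..m}" "card (lines_at x) = i" using that(2) by blast+
    moreover from this have "x = q" using uniq that(1) by blast
    ultimately show ?thesis using Aq A(2) by simp
  qed
  have "q \<in> ?N h" using new Aq A(2) by simp
  then have "?N h = {q}" using only[OF h] by blast
  then have "card (?N h) = card {q}" by (rule arg_cong)
  then have "card (?N h) = 1" by simp
  moreover have "card (?N i) = 0" if "i \<ge> 3" "i \<noteq> h" for i
  proof -
    have "?N i = {}" using only[OF that(1)] that(2) by blast
    then show ?thesis by (simp only: card.empty)
  qed
  ultimately show "card (?N h) = 1 \<and> ?Z" by blast
qed

end

lemma mobius_sum:
  fixes x y :: "'a :: order"
  assumes L: "finite L" "y \<in> L"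
  shows "(\<Sum>z | z \<in> L \<and> x \<le> z \<and> z \<le> y. mobius L x z) = (if x = y then 1 else 0)"
proof -
  consider "x = y" | "x < y" | "\<not> x \<le> y" by (auto simp: less_le)
  then show ?thesis
  proof cases
    case 1
    then have "{z. z \<in> L \<and> x \<le> z \<and> z \<le> y} = {y}" using L by auto
    then show ?thesis using 1 by (simp add: mobius.simps[of L y y])
  next
    case 2
    then have "{z. z \<in> L \<and> x \<le> z \<and> z \<le> y} = insert y {z. z \<in> L \<and> x \<le> z \<and> z < y}"
      using L by auto
    then have "(\<Sum>z | z \<in> L \<and> x \<le> z \<and> z \<le> y. mobius L x z) =
        mobius L x y + (\<Sum>z | z \<in> L \<and> x \<le> z \<and> z < y. mobius L x z)"
      using L by simp
    also have "mobius L x y = - (\<Sum>z | z \<in> L \<and> x \<le> z \<and> z < y. mobius L x z)"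
      by (subst mobius.simps) (simp add: 2 L less_imp_neq[OF 2])
    finally show ?thesis using 2 by simp
  next
    case 3
    then have "{z. z \<in> L \<and> x \<le> z \<and> z \<le> y} = {}" "x \<noteq> y" by auto
    then show ?thesis by (simp only: sum.empty if_False)
  qed
qed

section \<open>Strata and their general configurations\<close>

definition general_concurrences :: "nat \<Rightarrow> (nat \<Rightarrow> cp2) set set \<Rightarrow> nat set set set" where
  "general_concurrences m S = concurrences m (orbit3 m (general_config m S))"

lemma X3_E:
  assumes "x \<in> X3 m" obtains P where "P \<in> config m" "x = orbit3 m P"
  using assms by (auto simp: X3_def orbit3_def elim: quotientE)

lemma closed_stratum_in_strata: "x \<in> X3 m \<Longrightarrow> closed_stratum m (concurrences m x) \<in> strata m"
  by (simp add: strata_def)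

text \<open>The choice behind \<open>general_config\<close> is harmless: the open stratum contains
  \<open>x\<close>, and all its points have the same concurrences.\<close>

lemma general_config_closed_stratum:
  assumes x: "x \<in> X3 m"
  shows "general_config m (closed_stratum m (concurrences m x)) \<in> config m"
    "general_concurrences m (closed_stratum m (concurrences m x)) = concurrences m x"
proof -
  let ?S = "closed_stratum m (concurrences m x)"
  have "x \<in> open_stratum m ?S" using open_stratum_eq[OF x] x by simp
  then have "\<exists>P. P \<in> config m \<and> orbit3 m P \<in> open_stratum m ?S" using X3_E[OF x] by metis
  then have "general_config m ?S \<in> config m \<and> orbit3 m (general_config m ?S) \<in> open_stratum m ?S"
    unfolding general_config_def by (rule someI_ex)
  then show "general_config m ?S \<in> config m" "general_concurrences m ?S = concurrences m x"
    using open_stratum_eq[OF x] by (auto simp: general_concurrences_def)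
qed

lemma strata_E:
  assumes "S \<in> strata m" obtains x where "x \<in> X3 m" "S = closed_stratum m (concurrences m x)"
  using assms by (auto simp: strata_def)

lemma general_config_stratum:
  assumes "S \<in> strata m"
  shows "general_config m S \<in> config m" "closed_stratum m (general_concurrences m S) = S"
  using strata_E[OF assms] general_config_closed_stratum by metis+

text \<open>A stratum contains the point that defines it, so an inclusion of strata forces the
  conditions of the larger one to hold at that point.\<close>

lemma stratum_le_iff:
  assumes "S \<in> strata m" "S' \<in> strata m"
  shows "S \<subseteq> S' \<longleftrightarrow> general_concurrences m S' \<subseteq> general_concurrences m S"
proof -
  obtain x where x: "x \<in> X3 m" "S = closed_stratum m (concurrences m x)" using strata_E[OF assms(1)] .
  obtain y where y: "y \<in> X3 m" "S' = closed_stratum m (concurrences m y)" using strata_E[OF assms(2)] .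
  have "S \<subseteq> S' \<longleftrightarrow> concurrences m y \<subseteq> concurrences m x"
  proof
    assume "S \<subseteq> S'"
    moreover have "x \<in> S" using x by (auto simp: closed_stratum_def concurrences_def)
    ultimately have "x \<in> S'" by blast
    then show "concurrences m y \<subseteq> concurrences m x"
      unfolding y(2) by (auto simp: closed_stratum_def concurrences_def)
  next
    assume "concurrences m y \<subseteq> concurrences m x"
    then show "S \<subseteq> S'" unfolding x(2) y(2) by (auto simp: closed_stratum_def)
  qed
  then show ?thesis using general_config_closed_stratum(2) x y by simp
qed

lemma family_stratum:
  assumes A: "A \<in> pair_families m" and m: "m \<ge> 3"
  shows "closed_stratum m (triples A) \<in> strata m"
    "general_concurrences m (closed_stratum m (triples A)) = triples A"
proof -
  have A': "A \<subseteq> index_pairs m" "disjoint A" using A by (auto simp: pair_families_def)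
  obtain P where P: "P \<in> config m"
    "\<And>\<tau>. \<tau> \<in> pair_triples m \<Longrightarrow> (\<Inter>e\<in>\<tau>. join_line P e) \<noteq> {} \<longleftrightarrow> \<tau> \<subseteq> A"
    using generic_config_exists[OF A'] by metis
  interpret configuration m P using P(1) m by unfold_locales
  have "triples A \<subseteq> pair_triples m"
    using A pair_families_subset by (auto simp: triples_def pair_triples_eq)
  then have "concurrences m (orbit3 m P) = triples A"
    using P(2) by (auto simp: concurrences_eq concurrent_def triples_def pair_triples_eq)
  then show "closed_stratum m (triples A) \<in> strata m"
    "general_concurrences m (closed_stratum m (triples A)) = triples A"
    using general_config_closed_stratum(2)[OF orbit3_in_X3] closed_stratum_in_strata[OF orbit3_in_X3]
    by simp_all
qed

section \<open>Euler characteristics of the strata and the value of \<open>rho\<close>\<close>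

lemma chi_fibre_stratum:
  assumes S: "S \<in> strata m" and m: "m \<ge> 3"
  shows "chi_fibre m S = chi_offset m
     + (\<Sum>A | A \<in> pair_families m \<and> card A \<ge> 3 \<and> triples A \<subseteq> general_concurrences m S. (- 1) ^ card A)"
proof -
  interpret configuration m "general_config m S"
    using general_config_stratum(1)[OF S] m by unfold_locales
  have "{A. A \<in> pair_families m \<and> card A \<ge> 3 \<and> concurrent A} =
      {A. A \<in> pair_families m \<and> card A \<ge> 3 \<and> triples A \<subseteq> general_concurrences m S}"
    using concurrent_iff_triples by (auto simp: general_concurrences_def)
  then show ?thesis by (simp add: chi_fibre_def euler_char_fibre)
qed

text \<open>A general point of \<open>X3 m\<close> has no concurrences, so only
  \<open>chi_offset\<close> is left for it, and this term cancels. The condition on triples becomes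
  an inclusion of strata by \<open>stratum_le_iff\<close>, the form on which Moebius inversion
  acts.\<close>

lemma chi_fibre_difference:
  assumes S: "S \<in> strata m" and m: "m \<ge> 3"
  shows "chi_fibre m (X3 m) - chi_fibre m S =
    (\<Sum>A | A \<in> pair_families m \<and> card A \<ge> 3 \<and> S \<subseteq> closed_stratum m (triples A). (- 1) ^ (card A - 1))"
proof -
  have empty: "triples {} = {}" "{} \<in> pair_families m" by (auto simp: triples_def pair_families_def)
  have X: "closed_stratum m {} = X3 m" by (simp add: closed_stratum_def)
  have XS: "X3 m \<in> strata m" "general_concurrences m (X3 m) = {}"
    using family_stratum[OF empty(2) m] unfolding empty(1) X by simp_all
  have "{A. A \<in> pair_families m \<and> card A \<ge> 3 \<and> triples A \<subseteq> general_concurrences m (X3 m)} = {}"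
    using triples_nonempty unfolding XS(2) by auto
  then have 1: "chi_fibre m (X3 m) = chi_offset m"
    using chi_fibre_stratum[OF XS(1) m] by (simp only: sum.empty add_0_right)
  have "{A. A \<in> pair_families m \<and> card A \<ge> 3 \<and> triples A \<subseteq> general_concurrences m S} =
      {A. A \<in> pair_families m \<and> card A \<ge> 3 \<and> S \<subseteq> closed_stratum m (triples A)}"
  proof (rule Collect_cong)
    fix A
    show "A \<in> pair_families m \<and> card A \<ge> 3 \<and> triples A \<subseteq> general_concurrences m S \<longleftrightarrow>
        A \<in> pair_families m \<and> card A \<ge> 3 \<and> S \<subseteq> closed_stratum m (triples A)"
      using stratum_le_iff[OF S family_stratum(1)[of A m]] family_stratum(2)[of A m] m by metis
  qed
  then have "chi_fibre m (X3 m) - chi_fibre m S =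
      (\<Sum>A | A \<in> pair_families m \<and> card A \<ge> 3 \<and> S \<subseteq> closed_stratum m (triples A). - ((- 1) ^ card A))"
    using chi_fibre_stratum[OF S m] 1 by (simp add: sum_negf)
  also have "\<dots> = (\<Sum>A | A \<in> pair_families m \<and> card A \<ge> 3 \<and> S \<subseteq> closed_stratum m (triples A). (- 1) ^ (card A - 1))"
  proof (rule sum.cong[OF refl])
    fix A assume "A \<in> {A. A \<in> pair_families m \<and> card A \<ge> 3 \<and> S \<subseteq> closed_stratum m (triples A)}"
    then obtain k where "card A = Suc k" by (cases "card A") auto
    then show "- ((- 1) ^ card A) = (- 1 :: int) ^ (card A - 1)" by simp
  qed
  finally show ?thesis .
qed

text \<open>After exchanging the sums, each \<open>A\<close> is weighted by the sum of the Moebius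
  function over the interval from \<open>S\<close> to the stratum of \<open>A\<close>, which is 1 if
  the two coincide and 0 otherwise.\<close>

theorem rho_eq:
  assumes S: "S \<in> strata m" and m: "m \<ge> 3"
  shows "rho m S = (\<Sum>A | A \<in> pair_families m \<and> card A \<ge> 3 \<and> general_concurrences m S = triples A.
    (- 1) ^ (card A - 1))"
proof -
  let ?F = "{A. A \<in> pair_families m \<and> card A \<ge> 3}"
  let ?U = "{S'. S' \<in> strata m \<and> S \<subseteq> S'}"
  define st where "st A = closed_stratum m (triples A)" for A
  define g where "g A = (- 1 :: int) ^ (card A - 1)" for A :: "nat set set"
  have finF: "finite ?F" and finU: "finite ?U" using finite_pair_families finite_strata by auto
  have st: "st A \<in> strata m" "general_concurrences m (st A) = triples A" if "A \<in> ?F" for A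
    using family_stratum[OF _ m] that by (auto simp: st_def)
  have "rho m S = (\<Sum>S'\<in>?U. mobius (strata m) S S' * (\<Sum>A\<in>{A \<in> ?F. S' \<subseteq> st A}. g A))"
    unfolding rho_def st_def g_def
    by (intro sum.cong refl arg_cong2[where f = "(*)"]) (simp add: chi_fibre_difference m conj_assoc)
  also have "\<dots> = (\<Sum>S'\<in>?U. \<Sum>A\<in>?F. if S' \<subseteq> st A then mobius (strata m) S S' * g A else 0)"
    by (intro sum.cong refl) (simp only: sum.inter_filter[OF finF, symmetric] sum_distrib_left)
  also have "\<dots> = (\<Sum>A\<in>?F. \<Sum>S'\<in>?U. if S' \<subseteq> st A then mobius (strata m) S S' * g A else 0)"
    by (rule sum.swap)
  also have "\<dots> = (\<Sum>A\<in>?F. if S = st A then g A else 0)"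
  proof (rule sum.cong[OF refl])
    fix A assume A: "A \<in> ?F"
    have "(\<Sum>S'\<in>?U. if S' \<subseteq> st A then mobius (strata m) S S' * g A else 0) =
        (\<Sum>S'\<in>{S' \<in> ?U. S' \<subseteq> st A}. mobius (strata m) S S' * g A)"
      by (rule sum.inter_filter[symmetric, OF finU])
    also have "\<dots> = (\<Sum>S' | S' \<in> strata m \<and> S \<subseteq> S' \<and> S' \<subseteq> st A. mobius (strata m) S S') * g A"
      by (simp add: sum_distrib_right conj_assoc)
    also have "\<dots> = (if S = st A then g A else 0)"
      using mobius_sum[OF finite_strata st(1)[OF A], of S] by simp
    finally show "(\<Sum>S'\<in>?U. if S' \<subseteq> st A then mobius (strata m) S S' * g A else 0) = (if S = st A then g A else 0)" .
  qed
  also have "\<dots> = (\<Sum>A\<in>{A \<in> ?F. S = st A}. g A)" by (rule sum.inter_filter[symmetric, OF finF])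
  also have "{A \<in> ?F. S = st A} = {A. A \<in> pair_families m \<and> card A \<ge> 3 \<and> general_concurrences m S = triples A}"
    using st general_config_stratum(2)[OF S] by (auto simp: st_def)
  finally show ?thesis by (simp add: g_def)
qed

lemma rho_family:
  assumes S: "S \<in> strata m" and m: "m \<ge> 3"
    and A: "A \<in> pair_families m" "card A \<ge> 3" "general_concurrences m S = triples A"
  shows "rho m S = (- 1) ^ (card A - 1)"
proof -
  have "{B. B \<in> pair_families m \<and> card B \<ge> 3 \<and> general_concurrences m S = triples B} = {A}"
    using A triples_eq_iff[OF A(2)] by auto
  then show ?thesis unfolding rho_eq[OF S m] by simp
qed

lemma rho_no_family:
  assumes S: "S \<in> strata m" and m: "m \<ge> 3"
    and "\<And>A. A \<in> pair_families m \<Longrightarrow> card A \<ge> 3 \<Longrightarrow> general_concurrences m S \<noteq> triples A"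
  shows "rho m S = 0"
proof -
  have "{B. B \<in> pair_families m \<and> card B \<ge> 3 \<and> general_concurrences m S = triples B} = {}"
    using assms(3) by auto
  then show ?thesis unfolding rho_eq[OF S m] by (simp only: sum.empty)
qed

text \<open>Translates case (a) into the existence of a family, the form in which \<open>rho\<close>
  is computed.\<close>

lemma n_mult_single_iff:
  assumes S: "S \<in> strata m" and m: "m \<ge> 3" and h: "h \<ge> 3"
  shows "n_mult m h S = 1 \<and> (\<forall>i\<ge>3. i \<noteq> h \<longrightarrow> n_mult m i S = 0) \<longleftrightarrow>
    (\<exists>A\<in>pair_families m. card A = h \<and> general_concurrences m S = triples A)"
proof -
  interpret configuration m "general_config m S"
    using general_config_stratum(1)[OF S] m by unfold_locales
  show ?thesis
    using single_multiple_point_iff[OF h]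
    by (simp add: n_mult_def Let_def card_lines_at general_concurrences_def)
qed

theorem theorem5p4:
  fixes m :: nat and S :: "(nat \<Rightarrow> cp2) set set"
  assumes "m \<ge> 6" and "S \<in> strata m"
  shows "rho m S \<in> {-1, 0, 1}
    \<and> (\<forall>h\<ge>3. n_mult m h S = 1 \<and> (\<forall>i\<ge>3. i \<noteq> h \<longrightarrow> n_mult m i S = 0)
          \<longrightarrow> rho m S = (-1) ^ (h - 1))
    \<and> (\<not> (\<exists>h\<ge>3. n_mult m h S = 1 \<and> (\<forall>i\<ge>3. i \<noteq> h \<longrightarrow> n_mult m i S = 0))
          \<longrightarrow> rho m S = 0)"
proof -
  have m: "m \<ge> 3" and S: "S \<in> strata m" using assms by simp_all
  have a: "rho m S = (-1) ^ (h - 1)"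
    if "h \<ge> 3" "n_mult m h S = 1 \<and> (\<forall>i\<ge>3. i \<noteq> h \<longrightarrow> n_mult m i S = 0)" for h
    using n_mult_single_iff[OF S m that(1)] that rho_family[OF S m] by auto
  have b: "rho m S = 0"
    if "\<not> (\<exists>h\<ge>3. n_mult m h S = 1 \<and> (\<forall>i\<ge>3. i \<noteq> h \<longrightarrow> n_mult m i S = 0))"
  proof (rule rho_no_family[OF S m])
    fix A assume "A \<in> pair_families m" "card A \<ge> 3"
    then show "general_concurrences m S \<noteq> triples A" using n_mult_single_iff[OF S m] that by blast
  qed
  have "rho m S \<in> {-1, 0, 1}"
  proof (cases "\<exists>h\<ge>3. n_mult m h S = 1 \<and> (\<forall>i\<ge>3. i \<noteq> h \<longrightarrow> n_mult m i S = 0)")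
    case True
    then obtain h where "rho m S = (-1) ^ (h - 1)" using a by blast
    then show ?thesis by (cases "even (h - 1)") simp_all
  qed (simp add: b)
  then show ?thesis using a b by blast
qed


end
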